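(* Let $a>-1$ and $b>-1/2$. Let $\{X,X_n;n\ge1\}$ be i.i.d. random variables with $$\mathbb E X=0,\qquad \mathbb E X^2=\sigma^2<\infty,\qquad \mathbb E\big[X^2(\log|X|)^a(\log\log|X|)^{b-1}\big]<\infty,$$ and $$\mathbb E\big[X^2 I\{|X|\ge t\}\big]=o\big((\log\log t)^{-1}\big)\quad\text{as } t\to\infty .$$ Let $a_n(\epsilon)$ (defined for $n\ge1$ and $\epsilon$ in a right neighbourhood of $\sqrt{1+a}$) satisfy $a_n(\epsilon)\log\log n\to\tau\in\mathbb R$ as $n\to\infty$ and $\epsilon\searrow\sqrt{1+a}$ jointly. Then $$\lim_{\epsilon\searrow\sqrt{1+a}}(\epsilon^2-a-1)^{b+1/2}\sum_{n=1}^\infty\frac{(\log n)^a(\log\log n)^b}{n}\,\mathbb P\big\{M_n\ge\sigma\phi(n)(\epsilon+a_n(\epsilon))\big\}=2\sqrt{\tfrac{1}{\pi(a+1)}}\,e^{-2\tau\sqrt{1+a}}\,\Gamma(b+1/2)$$ and $$\lim_{\epsilon\searrow\sqrt{1+a}}(\epsilon^2-a-1)^{b+1/2}\sum_{n=1}^\infty\frac{(\log n)^a(\log\log n)^b}{n}\,\mathbb P\big\{|S_n|\ge\sigma\phi(n)(\epsilon+a_n(\epsilon))\big\}=\sqrt{\tfrac{1}{\pi(a+1)}}\,e^{-2\tau\sqrt{1+a}}\,\Gamma(b+1/2).$$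
   Context: Conventions: $\log x=\ln(x\vee e)$, $\log\log x=\log(\log x)$, $\phi(x)=\sqrt{2x\log\log x}$. For i.i.d. $X_1,X_2,\dots$, $S_n=X_1+\dots+X_n$ and $M_n=\max_{k\le n}|S_k|$. $\Gamma$ is the Gamma function. The joint limit condition on $a_n(\epsilon)$ means: for every $\eta>0$ there exist $n_0$ and $\delta>0$ such that $|a_n(\epsilon)\log\log n-\tau|<\eta$ for all $n\ge n_0$ and all $\epsilon\in(\sqrt{1+a},\sqrt{1+a}+\delta)$.
   Formalization: The formal statement assumes σ > 0 (X not almost surely zero); for σ = 0 every probability equals 1, the series diverges since a > −1, and the claimed limits fail. *)

theory Defs
  imports "HOL-Probability.Probability"
begin

definition Lg :: "real \<Rightarrow> real" where
  "Lg x = ln (max x (exp 1))"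

definition LgLg :: "real \<Rightarrow> real" where
  "LgLg x = Lg (Lg x)"

definition phi :: "real \<Rightarrow> real" where
  "phi x = sqrt (2 * x * LgLg x)"

definition partial_sum :: "(nat \<Rightarrow> 'a \<Rightarrow> real) \<Rightarrow> nat \<Rightarrow> 'a \<Rightarrow> real" where
  "partial_sum X n \<omega> = (\<Sum>i\<in>{1..n}. X i \<omega>)"

definition max_partial_sum :: "(nat \<Rightarrow> 'a \<Rightarrow> real) \<Rightarrow> nat \<Rightarrow> 'a \<Rightarrow> real" where
  "max_partial_sum X n \<omega> = Max ((\<lambda>k. \<bar>partial_sum X k \<omega>\<bar>) ` {..n})"

end

theory Submission
  imports Defs "HOL-Real_Asymp.Real_Asymp"
begin

text \<open>
  Truncate at \<open>\<kappa> (n / log log n)^(1/2)\<close>. By the tail condition the truncated variables have mean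
  \<open>o((n log log n)^(-1/2))\<close>, variance \<open>\<sigma>^2 (1 + o(1 / log log n))\<close> and third absolute moment
  \<open>o(n^(1/2) (log log n)^(-3/2))\<close>. For such walks the probabilities of deviations of order
  \<open>x = O((log log n)^(1/2))\<close> are asymptotic to Gaussian tails with relative error \<open>o(1)\<close>: the Gaussian
  tail as a function of space and remaining variance solves the heat equation, so along the walk, free
  or stopped on leaving \<open>(-x, x)\<close>, it is a martingale up to Taylor remainders. These are controlled
  by a Gaussian density, hence by an exponential of the walk, with total expectation \<open>o(exp (-x^2/2) / x)\<close>.

  Truncation matters only if some increment is large. A single increment comparable to the threshold is
  excluded by the moment condition; otherwise either the truncated walk deviates almost as far by itself
  or many large increments add up, and both have probabilities small enough to be summable with the
  weights. Hence the total error stays bounded while the prefactor tends to 0, and the Gaussian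
  terms sum to an incomplete Gamma integral.
\<close>

section \<open>The Gaussian tail\<close>

text \<open>The obstacle is the size of the tails: near the critical \<epsilon> they are roughly
  (log n)^(-1-a), so an additive error of normal approximation is useless unless it inherits the
  Gaussian decay. This dictates the scaling: the normalised walk is multiplied by the threshold x,
  which makes variance and threshold both equal to v = x^2. The natural exponential tilt is then 1,
  exp (W - v) has expectation exp (-v/2) up to a constant factor, and shifting threshold or variance
  by O(1) changes the tail by an explicit factor close to 1 for small shifts. Two such shifts occur:
  \<kappa> in the threshold (smoothing and overshoot) and \<delta> in the variance (regularity at
  the final time). They are coupled by \<delta> = \<kappa>^3, so that sqrt \<delta> is small against
  \<kappa>. A second constraint comes from the limit: an error that is not relative to the Gaussian
  term must be summable with the weights independently of \<epsilon>. The jump event is therefore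
  estimated at a fixed multiple g0 < sqrt (1 + a). Only g0^2 > a is asked there, because the large
  increment contributes the rest of the decay.\<close>

lemma cdf_density_deriv:
  fixes f :: "real \<Rightarrow> real"
  assumes f: "integrable lborel f" "\<And>x. 0 \<le> f x" and cont: "continuous_on {a..b} f" and z: "a < z" "z < b"
  shows "(cdf (density lborel f) has_real_derivative f z) (at z)"
proof -
  let ?N = "density lborel f"
  have [measurable]: "f \<in> borel_measurable borel" using f(1) by simp
  have "finite_measure ?N"
  proof (rule finite_measureI)
    have "emeasure ?N (space ?N) = ennreal (\<integral>x. f x \<partial>lborel)"
      using f by (subst emeasure_density) (auto simp: nn_integral_eq_integral)
    then show "emeasure ?N (space ?N) \<noteq> \<infinity>" by simp
  qed
  then interpret N: finite_borel_measure ?N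
    by (intro finite_borel_measure.intro finite_borel_measure_axioms.intro) auto
  have eq: "cdf ?N u = cdf ?N a + (LBINT y=a..u. f y)" if "u \<in> {a<..<b}" for u
  proof -
    have "cdf ?N u - cdf ?N a = measure ?N {a<..u}"
      using that by (intro N.cdf_diff_eq) auto
    also have "\<dots> = (\<integral>x. indicator {a<..u} x \<partial>?N)" by simp
    also have "\<dots> = (\<integral>x. f x *\<^sub>R indicator {a<..u} x \<partial>lborel)"
      using f by (intro integral_density) auto
    also have "\<dots> = (LBINT y=a..u. f y)"
      using that by (subst interval_integral_Ioc) (auto simp: set_lebesgue_integral_def mult.commute)
    finally show ?thesis by simp
  qed
  have "((\<lambda>u. LBINT y=a..u. f y) has_vector_derivative f z) (at z within {a..b})"
    using interval_integral_FTC2[of a a b f z] cont z by auto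
  then have "((\<lambda>u. LBINT y=a..u. f y) has_real_derivative f z) (at z)"
    using z by (subst (asm) at_within_interior) (auto simp: has_real_derivative_iff_has_vector_derivative)
  then have "((\<lambda>u. cdf ?N a + (LBINT y=a..u. f y)) has_real_derivative f z) (at z)"
    by (auto intro!: derivative_eq_intros)
  then show ?thesis
    by (rule has_field_derivative_transform_within_open[of _ _ _ "{a<..<b}"]) (use eq z in auto)
qed

definition gauss_tail :: "real \<Rightarrow> real" where
  "gauss_tail z = 1 - cdf std_normal_distribution z"

lemma gauss_tail_deriv: "(gauss_tail has_real_derivative - std_normal_density z) (at z)"
proof -
  have "continuous_on {z - 1..z + 1} std_normal_density"
    unfolding std_normal_density_def by (intro continuous_intros) auto
  then have "(cdf std_normal_distribution has_real_derivative std_normal_density z) (at z)"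
    by (intro cdf_density_deriv) auto
  then show ?thesis unfolding gauss_tail_def[abs_def] by (auto intro!: derivative_eq_intros)
qed

lemma gauss_tail_deriv_chain [derivative_intros]:
  "(f has_real_derivative f') (at x within A) \<Longrightarrow>
   ((\<lambda>x. gauss_tail (f x)) has_real_derivative - std_normal_density (f x) * f') (at x within A)"
  by (rule DERIV_chain2[OF gauss_tail_deriv])

lemma std_normal_density_deriv_chain [derivative_intros]:
  "(f has_real_derivative f') (at x within A) \<Longrightarrow>
   ((\<lambda>x. std_normal_density (f x)) has_real_derivative - f x * std_normal_density (f x) * f') (at x within A)"
proof -
  assume "(f has_real_derivative f') (at x within A)"
  then have "((\<lambda>x. c * exp (- (f x)\<^sup>2 / 2)) has_real_derivative - f x * (c * exp (- (f x)\<^sup>2 / 2)) * f') (at x within A)" for c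
    by (auto intro!: derivative_eq_intros)
  then show ?thesis unfolding std_normal_density_def .
qed

lemma continuous_on_Q [continuous_intros]:
  "continuous_on A f \<Longrightarrow> continuous_on A (\<lambda>x. gauss_tail (f x))"
  by (rule continuous_on_compose2[of UNIV gauss_tail])
    (auto intro!: DERIV_continuous_on[of UNIV gauss_tail "\<lambda>x. - std_normal_density x"] gauss_tail_deriv)

lemma gauss_tail_measurable [measurable]: "gauss_tail \<in> borel_measurable borel"
  by (intro borel_measurable_continuous_onI continuous_intros)

lemma gauss_tail_nonneg: "0 \<le> gauss_tail z"
proof -
  interpret N: real_distribution std_normal_distribution by (rule real_dist_normal_dist)
  show ?thesis using N.cdf_bounded_prob[of z] by (simp add: gauss_tail_def)
qed

lemma gauss_tail_le_1: "gauss_tail z \<le> 1"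
proof -
  interpret N: real_distribution std_normal_distribution by (rule real_dist_normal_dist)
  show ?thesis using N.cdf_nonneg[of z] by (simp add: gauss_tail_def)
qed

lemma gauss_tail_antimono: "x \<le> y \<Longrightarrow> gauss_tail y \<le> gauss_tail x"
proof -
  interpret N: real_distribution std_normal_distribution by (rule real_dist_normal_dist)
  show "x \<le> y \<Longrightarrow> gauss_tail y \<le> gauss_tail x" using N.cdf_nondecreasing[of x y] by (simp add: gauss_tail_def)
qed

lemma gauss_tail_at_top: "(gauss_tail \<longlongrightarrow> 0) at_top"
proof -
  interpret N: real_distribution std_normal_distribution by (rule real_dist_normal_dist)
  show ?thesis unfolding gauss_tail_def[abs_def] using tendsto_diff[OF tendsto_const N.cdf_lim_at_top_prob, of 1] by simp
qed

lemma gauss_tail_at_bot: "(gauss_tail \<longlongrightarrow> 1) at_bot"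
proof -
  interpret N: real_distribution std_normal_distribution by (rule real_dist_normal_dist)
  show ?thesis unfolding gauss_tail_def[abs_def] using tendsto_diff[OF tendsto_const N.cdf_lim_at_bot, of 1] by simp
qed

text \<open>The density is even, so the sum of the two tails has derivative 0; its constant value is
  read off at infinity.\<close>

lemma gauss_tail_minus: "gauss_tail (- z) = 1 - gauss_tail z"
proof -
  have d: "((\<lambda>z. gauss_tail z + gauss_tail (- z)) has_real_derivative 0) (at x)" for x
    by (auto intro!: derivative_eq_intros simp: std_normal_density_def)
  have const: "gauss_tail z + gauss_tail (- z) = gauss_tail w + gauss_tail (- w)" for w z
    using DERIV_const_ratio_const2[of z w "\<lambda>z. gauss_tail z + gauss_tail (- z)" 0] d
    by (cases "z = w") auto
  have "((\<lambda>z. gauss_tail z + gauss_tail (- z)) \<longlongrightarrow> 0 + 1) at_top"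
    by (intro tendsto_add gauss_tail_at_top filterlim_compose[OF gauss_tail_at_bot filterlim_uminus_at_bot_at_top])
  moreover have "((\<lambda>w. gauss_tail w + gauss_tail (- w)) \<longlongrightarrow> gauss_tail z + gauss_tail (- z)) at_top"
    by (subst const[of _ z]) auto
  ultimately have "gauss_tail z + gauss_tail (- z) = 0 + 1"
    by (intro tendsto_unique[of at_top]) auto
  then show ?thesis by simp
qed

lemma gauss_tail_0: "gauss_tail 0 = 1/2"
  using gauss_tail_minus[of 0] by simp

text \<open>In \<open>gauss_tail_le\<close>, \<open>gauss_tail_ge\<close> and
  \<open>gauss_tail_shift\<close> both sides vanish at infinity, so each inequality reduces to the
  sign of the derivative of a difference.\<close>

lemma nonneg_of_antimono_lim:
  fixes g :: "real \<Rightarrow> real"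
  assumes "\<And>x. a \<le> x \<Longrightarrow> (g has_real_derivative g' x) (at x)"
    and "\<And>x. a \<le> x \<Longrightarrow> g' x \<le> 0"
    and lim: "(g \<longlongrightarrow> 0) at_top" and "a \<le> z"
  shows "0 \<le> g z"
proof -
  have "g y \<le> g z" if "y \<ge> z" for y
    using that assms(1,2) \<open>a \<le> z\<close>
    by (intro DERIV_nonpos_imp_nonincreasing[of z y g]) (auto intro: order_trans)
  then show ?thesis
    by (intro tendsto_upperbound[OF lim]) (auto intro: eventually_at_top_linorderI[of z])
qed

lemma gauss_tail_le:
  assumes "0 < z" shows "gauss_tail z \<le> std_normal_density z / z"
proof -
  have "0 \<le> std_normal_density z / z - gauss_tail z"
  proof (rule nonneg_of_antimono_lim[where a=z and g="\<lambda>z. std_normal_density z / z - gauss_tail z"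
         and g'="\<lambda>x. - std_normal_density x / x\<^sup>2"])
    fix x assume "z \<le> x"
    then have "x > 0" using assms by simp
    then show "((\<lambda>z. std_normal_density z / z - gauss_tail z) has_real_derivative - std_normal_density x / x\<^sup>2) (at x)"
      by (auto intro!: derivative_eq_intros simp: field_simps power2_eq_square)
  next
    have "((\<lambda>z. std_normal_density z / z) \<longlongrightarrow> 0) at_top"
      unfolding std_normal_density_def by real_asymp
    from tendsto_diff[OF this gauss_tail_at_top]
    show "((\<lambda>z. std_normal_density z / z - gauss_tail z) \<longlongrightarrow> 0) at_top" by simp
  qed auto
  then show ?thesis by simp
qed

text \<open>Lower Mills ratio bound. The factor z / (1 + z^2) agrees with 1 / z at infinity, and it
  turns the derivative of the difference into a negative multiple of the density over (1 +
  z^2)^2.\<close>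

lemma gauss_tail_ge:
  assumes "0 < z" shows "z / (1 + z\<^sup>2) * std_normal_density z \<le> gauss_tail z"
proof -
  have "0 \<le> gauss_tail z - z / (1 + z\<^sup>2) * std_normal_density z"
  proof (rule nonneg_of_antimono_lim[where a=z and g="\<lambda>z. gauss_tail z - z / (1 + z\<^sup>2) * std_normal_density z"
         and g'="\<lambda>x. - 2 * std_normal_density x / (1+x\<^sup>2)\<^sup>2"])
    fix x assume "z \<le> x"
    have "1 + x\<^sup>2 \<noteq> 0" by (metis add_nonneg_pos zero_le_power2 zero_less_one less_irrefl add.commute)
    then show "((\<lambda>z. gauss_tail z - z / (1 + z\<^sup>2) * std_normal_density z) has_real_derivative - 2 * std_normal_density x / (1+x\<^sup>2)\<^sup>2) (at x)"
      by - ((rule derivative_eq_intros refl | assumption)+, simp_all add: divide_simps, simp add: algebra_simps power2_eq_square)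
  next
    have "((\<lambda>z. z / (1 + z\<^sup>2) * std_normal_density z) \<longlongrightarrow> 0) at_top"
      unfolding std_normal_density_def by real_asymp
    from tendsto_diff[OF gauss_tail_at_top this]
    show "((\<lambda>z. gauss_tail z - z / (1 + z\<^sup>2) * std_normal_density z) \<longlongrightarrow> 0) at_top" by simp
  qed auto
  then show ?thesis by simp
qed

lemma gauss_tail_pos: "0 < z \<Longrightarrow> 0 < gauss_tail z"
  using gauss_tail_ge[of z] normal_density_pos[of 1 0 z]
  by (smt (verit) divide_pos_pos mult_pos_pos zero_le_power2)

text \<open>Remainders of the heat equation argument come out as exp (-x^2/2) / x; this makes them
  comparable with the tail itself. The 8 is 2 from x / (1 + x^2) >= 1 / (2x) times 4 from sqrt (2
  pi) <= 4.\<close>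

lemma exp_div_le_Q:
  assumes "1 \<le> x"
  shows "exp (- x\<^sup>2 / 2) / x \<le> 8 * gauss_tail x"
proof -
  have "x * x \<ge> 1" using assms by (metis mult_mono' mult_1 zero_le_one)
  then have "1 / (2 * x) \<le> x / (1 + x\<^sup>2)"
    using assms by (simp add: field_simps power2_eq_square)
  moreover have "sqrt (2 * pi) \<le> 4"
    using pi_less_4 by (intro real_le_lsqrt) auto
  then have "exp (- x\<^sup>2 / 2) / 4 \<le> std_normal_density x"
    by (auto simp: std_normal_density_def field_simps)
  ultimately have "1 / (2 * x) * (exp (- x\<^sup>2 / 2) / 4) \<le> x / (1 + x\<^sup>2) * std_normal_density x"
    using assms by (intro mult_mono) auto
  also have "\<dots> \<le> gauss_tail x" using assms by (intro gauss_tail_ge) auto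
  finally show ?thesis by simp
qed

text \<open>Rests on (x + b)^2 >= x^2 + b^2 for nonnegative x and b, which compares the two
  densities.\<close>

lemma gauss_tail_shift:
  assumes "0 \<le> a" "0 \<le> b"
  shows "gauss_tail (a + b) \<le> exp (- b\<^sup>2 / 2) * gauss_tail a"
proof -
  have "0 \<le> exp (- b\<^sup>2 / 2) * gauss_tail a - gauss_tail (a + b)"
  proof (rule nonneg_of_antimono_lim[where a=0 and g="\<lambda>a. exp (- b\<^sup>2 / 2) * gauss_tail a - gauss_tail (a + b)"
         and g'="\<lambda>a. - exp (- b\<^sup>2 / 2) * std_normal_density a + std_normal_density (a + b)"])
    fix x :: real assume x: "0 \<le> x"
    show "((\<lambda>a. exp (- b\<^sup>2 / 2) * gauss_tail a - gauss_tail (a + b)) has_real_derivative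
        - exp (- b\<^sup>2 / 2) * std_normal_density x + std_normal_density (x + b)) (at x)"
      by (auto intro!: derivative_eq_intros)
    have "std_normal_density (x + b) \<le> std_normal_density x * exp (- b\<^sup>2 / 2)"
      using x assms by (simp add: std_normal_density_def flip: exp_add)
        (auto simp: power2_sum field_simps divide_right_mono)
    then show "- exp (- b\<^sup>2 / 2) * std_normal_density x + std_normal_density (x + b) \<le> 0"
      by (simp add: mult.commute)
  next
    have "((\<lambda>a. exp (- b\<^sup>2 / 2) * gauss_tail a - gauss_tail (a + b)) \<longlongrightarrow> exp (- b\<^sup>2 / 2) * 0 - 0) at_top"
      by (intro tendsto_intros gauss_tail_at_top filterlim_compose[OF gauss_tail_at_top] filterlim_tendsto_add_at_top[OF tendsto_const filterlim_ident, of b, simplified add.commute[of b]])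
    then show "((\<lambda>a. exp (- b\<^sup>2 / 2) * gauss_tail a - gauss_tail (a + b)) \<longlongrightarrow> 0) at_top" by simp
  qed (use assms in auto)
  then show ?thesis by simp
qed

lemma gauss_tail_asymp:
  "((\<lambda>z. gauss_tail z * z * exp (z\<^sup>2 / 2) * sqrt (2 * pi)) \<longlongrightarrow> 1) at_top"
proof (rule tendsto_sandwich[of "\<lambda>z. z\<^sup>2 / (1 + z\<^sup>2)" _ _ "\<lambda>z. 1"])
  have e: "std_normal_density z * (exp (z\<^sup>2 / 2) * sqrt (2 * pi)) = 1" for z
    by (simp add: std_normal_density_def exp_minus)
  show "\<forall>\<^sub>F z in at_top. z\<^sup>2 / (1 + z\<^sup>2) \<le> gauss_tail z * z * exp (z\<^sup>2 / 2) * sqrt (2 * pi)"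
    using eventually_gt_at_top[of 0]
  proof eventually_elim
    case (elim z)
    have "(z / (1 + z\<^sup>2) * std_normal_density z) * (z * (exp (z\<^sup>2 / 2) * sqrt (2 * pi))) \<le> gauss_tail z * (z * (exp (z\<^sup>2 / 2) * sqrt (2 * pi)))"
      using elim by (intro mult_right_mono gauss_tail_ge) auto
    moreover have "(z / (1 + z\<^sup>2) * std_normal_density z) * (z * (exp (z\<^sup>2 / 2) * sqrt (2 * pi))) = z\<^sup>2 / (1 + z\<^sup>2) * (std_normal_density z * (exp (z\<^sup>2 / 2) * sqrt (2 * pi)))"
      by (simp add: power2_eq_square)
    ultimately show ?case unfolding e by (simp only: mult.assoc mult_1_right)
  qed
  show "\<forall>\<^sub>F z in at_top. gauss_tail z * z * exp (z\<^sup>2 / 2) * sqrt (2 * pi) \<le> 1"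
    using eventually_gt_at_top[of 0]
  proof eventually_elim
    case (elim z)
    have "gauss_tail z * (z * (exp (z\<^sup>2 / 2) * sqrt (2 * pi))) \<le> (std_normal_density z / z) * (z * (exp (z\<^sup>2 / 2) * sqrt (2 * pi)))"
      using elim by (intro mult_right_mono gauss_tail_le) auto
    also have "\<dots> = std_normal_density z * (exp (z\<^sup>2 / 2) * sqrt (2 * pi))"
      using elim by simp
    finally show ?case unfolding e by (simp add: mult.assoc)
  qed
qed (real_asymp | simp)+

text \<open>For level x^2 + c and variance x^2 + d the squared argument is x^2 + 2c - d + o(1), so
  \<open>gauss_tail_asymp\<close> leaves the constant factor exp (-c + d/2).\<close>

lemma gauss_tail_perturb:
  assumes "0 < d"
  shows "((\<lambda>x. gauss_tail ((x\<^sup>2 + c) / sqrt (x\<^sup>2 + d)) / gauss_tail x) \<longlongrightarrow> exp (- c + d / 2)) at_top"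
proof -
  define y where "y = (\<lambda>x. (x\<^sup>2 + c) / sqrt (x\<^sup>2 + d))"
  define G where "G = (\<lambda>z. gauss_tail z * z * exp (z\<^sup>2 / 2) * sqrt (2 * pi))"
  have ytop: "filterlim y at_top at_top"
    unfolding y_def using assms by real_asymp
  have G: "(G \<longlongrightarrow> 1) at_top" unfolding G_def by (rule gauss_tail_asymp)
  have 1: "((\<lambda>x. x / y x) \<longlongrightarrow> 1) at_top" unfolding y_def using assms by real_asymp
  have "((\<lambda>x. (x\<^sup>2 - (x\<^sup>2 + c)\<^sup>2 / (x\<^sup>2 + d)) / 2) \<longlongrightarrow> - c + d / 2) at_top"
  proof -
    have "((\<lambda>x::real. (x\<^sup>2 - (x\<^sup>2 + c)\<^sup>2 / (x\<^sup>2 + d)) / 2) \<longlongrightarrow> (d - 2 * c) / 2) at_top" by real_asymp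
    then show ?thesis by (simp add: field_simps)
  qed
  moreover have "(y x)\<^sup>2 = (x\<^sup>2 + c)\<^sup>2 / (x\<^sup>2 + d)" for x
    using assms by (simp add: y_def power_divide add_nonneg_pos less_imp_le)
  ultimately have 2: "((\<lambda>x. exp ((x\<^sup>2 - (y x)\<^sup>2) / 2)) \<longlongrightarrow> exp (- c + d / 2)) at_top"
    by (intro tendsto_intros) simp
  have "((\<lambda>x. G (y x) / G x * (x / y x) * exp ((x\<^sup>2 - (y x)\<^sup>2) / 2)) \<longlongrightarrow> 1 / 1 * 1 * exp (- c + d / 2)) at_top"
    by (intro tendsto_mult tendsto_divide filterlim_compose[OF G ytop] G 1 2) auto
  moreover have "\<forall>\<^sub>F x in at_top. G (y x) / G x * (x / y x) * exp ((x\<^sup>2 - (y x)\<^sup>2) / 2) = gauss_tail (y x) / gauss_tail x"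
    using eventually_gt_at_top[of 0] filterlim_at_top_dense[THEN iffD1, OF ytop, rule_format, of 0]
  proof eventually_elim
    case (elim x)
    have "exp ((x\<^sup>2 - (y x)\<^sup>2) / 2) = exp (x\<^sup>2 / 2) / exp ((y x)\<^sup>2 / 2)"
      by (simp add: diff_divide_distrib exp_diff)
    then show ?case using elim by (simp add: G_def)
  qed
  ultimately show ?thesis
    by (simp add: y_def tendsto_cong)
qed

section \<open>The heat equation step\<close>

text \<open>exp (s - T + r/2) solves the same heat equation as the tail, with r as remaining
  variance, so its expectation along the walk stays nearly constant in time. The single factor 1 /
  sqrt r, summed over the steps, produces the 1 / sqrt v of a Gaussian tail.\<close>

definition heat_bound :: "real \<Rightarrow> real \<Rightarrow> real \<Rightarrow> real" where
  "heat_bound T r s = exp (s - T + r / 2) / sqrt r"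

text \<open>Pays for the powers of 1 / sqrt r beyond the first, through r >= \<delta>. The factor
  \<open>exp 5\<close> bounds exp (3 |d| - d^2/2).\<close>

definition heat_const :: "real \<Rightarrow> real" where
  "heat_const \<delta> = exp 5 * (1 + 1 / sqrt \<delta>) ^ 3"

lemma heat_const_pos: "0 < \<delta> \<Longrightarrow> 0 < heat_const \<delta>"
  by (auto simp: heat_const_def intro!: mult_pos_pos zero_less_power add_pos_pos)

text \<open>Completing the square, \<open>\<xi>\<^sup>2 / 2 = (\<xi> - \<surd>r)\<^sup>2 / 2 + (T - s) - r / 2\<close> for \<open>\<xi> = (T - s) / \<surd>r\<close>,
  trades the Gaussian decay for an exponential in \<open>s\<close> whose expectation under a random walk is
  computable; the left-over Gaussian absorbs the Hermite polynomials.\<close>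

lemma gauss_poly_le:
  assumes "0 < \<delta>" "\<delta> \<le> r" "i \<le> 3"
  shows "(1 + \<bar>(T - s) / sqrt r\<bar>) ^ i * std_normal_density ((T - s) / sqrt r) / sqrt r ^ i
           \<le> heat_const \<delta> * exp (s - T + r / 2)"
proof -
  define q where "q = sqrt r"
  define \<xi> where "\<xi> = (T - s) / q"
  define d where "d = \<xi> - q"
  have r: "0 < r" using assms by simp
  have q: "0 < q" "q\<^sup>2 = r" "sqrt \<delta> \<le> q" using r assms by (auto simp: q_def)
  have q0: "0 \<le> 1 / q" using q by simp
  have sd: "0 < sqrt \<delta>" using assms by simp
  have \<xi>q: "\<xi> * q = T - s" using q by (simp add: \<xi>_def)
  have "(1 + \<bar>\<xi>\<bar>) ^ i \<le> ((1 + q) * (1 + \<bar>d\<bar>)) ^ i"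
  proof (intro power_mono)
    have "\<bar>\<xi>\<bar> \<le> q + \<bar>d\<bar>" using q by (simp add: d_def)
    then show "1 + \<bar>\<xi>\<bar> \<le> (1 + q) * (1 + \<bar>d\<bar>)"
      using q by (simp add: distrib_left distrib_right) (smt (verit) mult_nonneg_nonneg abs_ge_zero)
  qed simp
  also have "\<dots> = (1 + q) ^ i * (1 + \<bar>d\<bar>) ^ i" by (rule power_mult_distrib)
  also have "\<dots> \<le> (1 + q) ^ i * exp (3 * \<bar>d\<bar>)"
  proof -
    have "(1 + \<bar>d\<bar>) ^ i \<le> (1 + \<bar>d\<bar>) ^ 3" by (intro power_increasing assms) auto
    also have "\<dots> \<le> exp \<bar>d\<bar> ^ 3" by (intro power_mono) (auto simp: add.commute)
    also have "\<dots> = exp (3 * \<bar>d\<bar>)" by (simp flip: exp_of_nat_mult)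
    finally show ?thesis using q by (intro mult_left_mono) auto
  qed
  finally have 1: "(1 + \<bar>\<xi>\<bar>) ^ i \<le> (1 + q) ^ i * exp (3 * \<bar>d\<bar>)" .
  have "1 \<le> sqrt (2 * pi)"
    using pi_gt3 by simp
  then have 2: "std_normal_density \<xi> \<le> exp (- \<xi>\<^sup>2 / 2)"
    by (simp add: std_normal_density_def divide_le_eq)
  have "\<xi>\<^sup>2 = d\<^sup>2 + 2 * (\<xi> * q) - q\<^sup>2" by (simp add: d_def power2_diff power2_eq_square algebra_simps)
  then have 3: "- \<xi>\<^sup>2 / 2 = - d\<^sup>2 / 2 + (s - T + r / 2)" unfolding \<xi>q q by (simp add: field_simps)
  have "(\<bar>d\<bar> - 3)\<^sup>2 \<ge> 0" by simp
  then have 4: "3 * \<bar>d\<bar> - d\<^sup>2 / 2 \<le> 5" by (simp add: power2_diff)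
  have "(1 + q) ^ i / q ^ i = (1 + 1 / q) ^ i"
    using q by (simp flip: power_divide add: add_divide_distrib add.commute)
  also have "\<dots> \<le> (1 + 1 / sqrt \<delta>) ^ i"
    using sd q(1,3) q0 by (intro power_mono add_left_mono divide_left_mono mult_pos_pos) linarith+
  also have "\<dots> \<le> (1 + 1 / sqrt \<delta>) ^ 3"
    using sd by (intro power_increasing assms) auto
  finally have 5: "(1 + q) ^ i / q ^ i \<le> (1 + 1 / sqrt \<delta>) ^ 3" .
  have "(1 + \<bar>\<xi>\<bar>) ^ i * std_normal_density \<xi> / q ^ i \<le> (1 + q) ^ i * exp (3 * \<bar>d\<bar>) * exp (- \<xi>\<^sup>2 / 2) / q ^ i"
    using q by (intro divide_right_mono mult_mono 1 2) auto
  also have "\<dots> = (1 + q) ^ i / q ^ i * exp (3 * \<bar>d\<bar> - d\<^sup>2 / 2) * exp (s - T + r / 2)"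
  proof -
    have "exp (3 * \<bar>d\<bar>) * exp (- d\<^sup>2 / 2 + (s - T + r / 2)) = exp (3 * \<bar>d\<bar> - d\<^sup>2 / 2) * exp (s - T + r / 2)"
      by (simp flip: exp_add)
    then show ?thesis unfolding 3 by (simp add: mult.assoc)
  qed
  also have "\<dots> \<le> (1 + 1 / sqrt \<delta>) ^ 3 * exp 5 * exp (s - T + r / 2)"
    using 4 5 sd by (intro mult_right_mono mult_mono) auto
  finally show ?thesis by (simp add: \<xi>_def q_def heat_const_def mult.commute mult.assoc)
qed

text \<open>These are the first three derivatives of the tail in s and four times its second
  derivative in r. Each is the Hermite polynomial of degree i at \<xi> times the density over (sqrt
  r)^(i+1), for i from 0 to 3.\<close>

lemma heat_deriv_bounds:
  fixes T s r \<delta> :: real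
  assumes "0 < \<delta>" "\<delta> \<le> r"
  defines "\<xi> \<equiv> (T - s) / sqrt r"
  shows "\<bar>std_normal_density \<xi> / sqrt r\<bar> \<le> heat_const \<delta> * heat_bound T r s" (is ?A)
    and "\<bar>\<xi> * std_normal_density \<xi> / r\<bar> \<le> heat_const \<delta> * heat_bound T r s" (is ?B)
    and "\<bar>(\<xi>\<^sup>2 - 1) * std_normal_density \<xi> / (r * sqrt r)\<bar> \<le> heat_const \<delta> * heat_bound T r s" (is ?C)
    and "\<bar>(\<xi>^3 - 3 * \<xi>) * std_normal_density \<xi> / r\<^sup>2\<bar> \<le> heat_const \<delta> * heat_bound T r s" (is ?D)
proof -
  define q where "q = sqrt r"
  have r: "0 < r" using assms by simp
  have q: "0 < q" "q * q = r" using r assms by (auto simp: q_def)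
  have *: "\<bar>c * std_normal_density \<xi> / q ^ Suc i\<bar> \<le> heat_const \<delta> * heat_bound T r s"
    if "\<bar>c\<bar> \<le> (1 + \<bar>\<xi>\<bar>) ^ i" "i \<le> 3" for c i
  proof -
    have "\<bar>c * std_normal_density \<xi> / q ^ Suc i\<bar> = \<bar>c\<bar> * std_normal_density \<xi> / q ^ i / q"
      using q by (simp add: abs_mult)
    also have "\<dots> \<le> (1 + \<bar>\<xi>\<bar>) ^ i * std_normal_density \<xi> / q ^ i / q"
      using q that by (intro divide_right_mono mult_right_mono) auto
    also have "\<dots> \<le> heat_const \<delta> * exp (s - T + r / 2) / q"
      using gauss_poly_le[OF assms(1,2) that(2), of T s] q
      by (intro divide_right_mono) (auto simp: \<xi>_def q_def)
    finally show ?thesis by (simp add: heat_bound_def q_def)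
  qed
  show ?A using *[of 1 0] by (simp add: q_def)
  show ?B using *[of \<xi> 1] q by simp
  have "\<bar>\<xi>\<^sup>2 - 1\<bar> \<le> (1 + \<bar>\<xi>\<bar>)\<^sup>2"
  proof -
    have "\<bar>\<xi>\<^sup>2 - 1\<bar> \<le> \<xi>\<^sup>2 + 1" by (simp add: abs_le_iff)
    then show ?thesis by (simp add: power2_sum)
  qed
  then show ?C using *[of "\<xi>\<^sup>2 - 1" 2] q unfolding q(2)[symmetric] by (simp add: numeral_eq_Suc q_def mult_ac)
  have "\<bar>\<xi>^3 - 3 * \<xi>\<bar> \<le> \<bar>\<xi>\<bar>^3 + 3 * \<bar>\<xi>\<bar>"
    using abs_triangle_ineq4[of "\<xi>^3" "3 * \<xi>"] by (simp add: power_abs abs_mult)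
  also have "\<dots> \<le> (1 + \<bar>\<xi>\<bar>)^3" by (simp add: power3_eq_cube algebra_simps)
  finally show ?D using *[of "\<xi>^3 - 3 * \<xi>" 3] unfolding q(2)[symmetric]
    by (simp add: numeral_eq_Suc mult_ac)
qed

text \<open>Second-order Taylor expansion with Lagrange remainder. Because |z| <= 1, the
  intermediate point changes the exponential in \<open>heat_bound\<close> by at most a factor e, so
  the bound can be stated at s.\<close>

lemma heat_expansion_space:
  fixes T s r z \<delta> :: real
  assumes "0 < \<delta>" "\<delta> \<le> r" "\<bar>z\<bar> \<le> 1"
  defines "\<xi> \<equiv> (T - s) / sqrt r"
  shows "\<bar>gauss_tail ((T - (s + z)) / sqrt r) - gauss_tail \<xi> - z * (std_normal_density \<xi> / sqrt r)
           - z\<^sup>2 / 2 * (\<xi> * std_normal_density \<xi> / r)\<bar>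
         \<le> \<bar>z\<bar> ^ 3 / 6 * (exp 1 * heat_const \<delta> * heat_bound T r s)"
proof -
  have r: "0 < r" using assms by simp
  define X where "X = (\<lambda>y. (T - (s + y)) / sqrt r)"
  define dif where "dif = (\<lambda>(m::nat) y. if m = 0 then gauss_tail (X y) else if m = 1 then std_normal_density (X y) / sqrt r
     else if m = 2 then X y * std_normal_density (X y) / r
     else ((X y)\<^sup>2 - 1) * std_normal_density (X y) / (r * sqrt r))"
  have X': "(X has_real_derivative - 1 / sqrt r) (at y)" for y
    unfolding X_def using r by (auto intro!: derivative_eq_intros simp: field_simps)
  have "\<exists>t. \<bar>t\<bar> \<le> \<bar>z\<bar> \<and> gauss_tail (X z) = (\<Sum>m<3. dif m 0 / fact m * z ^ m) + dif 3 t / fact 3 * z ^ 3"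
  proof (rule Maclaurin_bi_le)
    show "\<forall>m t. m < 3 \<and> \<bar>t\<bar> \<le> \<bar>z\<bar> \<longrightarrow> DERIV (dif m) t :> dif (Suc m) t"
    proof safe
      fix m :: nat and t assume "m < 3"
      then consider "m = 0" | "m = 1" | "m = 2" by linarith
      then show "DERIV (dif m) t :> dif (Suc m) t"
      proof cases
        case 1 then show ?thesis unfolding dif_def
          by (auto intro!: derivative_eq_intros X')
      next
        case 2 then show ?thesis using r unfolding dif_def
          by (auto intro!: derivative_eq_intros X' simp: field_simps)
      next
        case 3 then show ?thesis using r unfolding dif_def
          by (auto intro!: derivative_eq_intros X' simp: field_simps power2_eq_square)
      qed
    qed
  qed (simp add: dif_def fun_eq_iff)
  then obtain t where t: "\<bar>t\<bar> \<le> \<bar>z\<bar>" and eq: "gauss_tail (X z) = (\<Sum>m<3. dif m 0 / fact m * z ^ m) + dif 3 t / fact 3 * z ^ 3"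
    by blast
  have X0: "X 0 = \<xi>" by (simp add: X_def \<xi>_def)
  have "gauss_tail (X z) - gauss_tail \<xi> - z * (std_normal_density \<xi> / sqrt r) - z\<^sup>2 / 2 * (\<xi> * std_normal_density \<xi> / r)
     = dif 3 t / 6 * z ^ 3"
    unfolding eq by (simp add: dif_def X0 numeral_eq_Suc)
  moreover have "\<bar>dif 3 t\<bar> \<le> exp 1 * heat_const \<delta> * heat_bound T r s"
  proof -
    have "\<bar>dif 3 t\<bar> \<le> heat_const \<delta> * heat_bound T r (s + t)"
      using heat_deriv_bounds(3)[OF assms(1,2), of T "s + t"] by (simp add: dif_def X_def)
    also have "heat_bound T r (s + t) \<le> exp 1 * heat_bound T r s"
    proof -
      have "exp (s + t - T + r / 2) \<le> exp (1 + (s - T + r / 2))" using t assms by simp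
      also have "\<dots> = exp 1 * exp (s - T + r / 2)" by (rule exp_add)
      finally show ?thesis using r by (simp add: heat_bound_def divide_right_mono)
    qed
    finally show ?thesis using heat_const_pos[OF assms(1)] by (simp add: mult_ac)
  qed
  moreover have "\<bar>dif 3 t / 6 * z ^ 3\<bar> = \<bar>z\<bar> ^ 3 / 6 * \<bar>dif 3 t\<bar>" by (simp add: abs_mult power_abs)
  moreover have "\<bar>z\<bar> ^ 3 / 6 * \<bar>dif 3 t\<bar> \<le> \<bar>z\<bar> ^ 3 / 6 * (exp 1 * heat_const \<delta> * heat_bound T r s)"
    using calculation(2) by (intro mult_left_mono) auto
  ultimately show ?thesis unfolding X_def by linarith
qed

text \<open>First order in time matches second order in space: the coefficient of h/2 here is the
  coefficient of z^2/2 in \<open>heat_expansion_space\<close>, which is the heat equation.\<close>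

lemma heat_expansion_time:
  fixes T s r h \<delta> :: real
  assumes "0 < \<delta>" "\<delta> \<le> r" "0 \<le> h" "h \<le> 1"
  defines "\<xi> \<equiv> (T - s) / sqrt r"
  shows "\<bar>gauss_tail ((T - s) / sqrt (r + h)) - gauss_tail \<xi> - h / 2 * (\<xi> * std_normal_density \<xi> / r)\<bar>
         \<le> h\<^sup>2 * (exp 1 * heat_const \<delta> * heat_bound T r s)"
proof (cases "h = 0")
  case True
  then show ?thesis by (simp add: \<xi>_def)
next
  case False
  then have h: "0 < h" using assms by simp
  have r: "0 < r" using assms by simp
  define X where "X = (\<lambda>y. (T - s) / sqrt (r + y))"
  define dif where "dif = (\<lambda>(m::nat) y. if m = 0 then gauss_tail (X y)
     else if m = 1 then X y * std_normal_density (X y) / (2 * (r + y))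
     else ((X y) ^ 3 - 3 * X y) * std_normal_density (X y) / (4 * (r + y)\<^sup>2))"
  have X': "(X has_real_derivative - X y / (2 * (r + y))) (at y)" if "0 \<le> y" for y :: real
  proof -
    have "0 < r + y" using that r by simp
    then show ?thesis
    unfolding X_def by (auto intro!: derivative_eq_intros simp: field_simps)
  qed
  have "\<exists>t>0. t < h \<and> gauss_tail (X h) = (\<Sum>m<2. dif m 0 / fact m * h ^ m) + dif 2 t / fact 2 * h ^ 2"
  proof (rule Maclaurin[OF h])
    show "\<forall>m t. m < 2 \<and> 0 \<le> t \<and> t \<le> h \<longrightarrow> DERIV (dif m) t :> dif (Suc m) t"
    proof safe
      fix m :: nat and t :: real assume "m < 2" and t: "0 \<le> t"
      then have rt: "0 < r + t" using r by simp
      consider "m = 0" | "m = 1" using \<open>m < 2\<close> by linarith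
      then show "DERIV (dif m) t :> dif (Suc m) t"
      proof cases
        case 1 then show ?thesis using rt unfolding dif_def
          by (auto intro!: derivative_eq_intros X'[OF t])
      next
        case 2
        have "((\<lambda>a. X a * std_normal_density (X a) / (2 * (r + a))) has_real_derivative
          ((X t)^3 - 3 * X t) * std_normal_density (X t) / (4 * (r + t)\<^sup>2)) (at t)"
          using rt
          by (auto intro!: derivative_eq_intros X'[OF t] simp: divide_simps power2_eq_square power3_eq_cube)
            (simp add: algebra_simps)
        then show ?thesis using 2 unfolding dif_def
          by simp
      qed
    qed
  qed (simp_all add: dif_def fun_eq_iff)
  then obtain t where t: "0 < t" "t < h" and eq: "gauss_tail (X h) = (\<Sum>m<2. dif m 0 / fact m * h ^ m) + dif 2 t / fact 2 * h ^ 2"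
    by blast
  have X0: "X 0 = \<xi>" by (simp add: X_def \<xi>_def)
  have "gauss_tail (X h) - gauss_tail \<xi> - h / 2 * (\<xi> * std_normal_density \<xi> / r) = dif 2 t / 2 * h\<^sup>2"
    unfolding eq by (simp add: dif_def X0 numeral_eq_Suc)
  moreover have "\<bar>dif 2 t\<bar> \<le> exp 1 * heat_const \<delta> * heat_bound T r s"
  proof -
    have quarter: "y / 4 \<le> y" if "0 \<le> y" for y :: real using that by simp
    have "\<bar>dif 2 t\<bar> = \<bar>((X t) ^ 3 - 3 * X t) * std_normal_density (X t) / (r + t)\<^sup>2\<bar> / 4"
      by (simp add: dif_def abs_mult)
    also have "\<dots> \<le> \<bar>((X t) ^ 3 - 3 * X t) * std_normal_density (X t) / (r + t)\<^sup>2\<bar>"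
      by (rule quarter) simp
    also have "\<dots> \<le> heat_const \<delta> * heat_bound T (r + t) s"
      using heat_deriv_bounds(4)[of \<delta> "r + t" T s] assms t by (simp add: X_def)
    also have "heat_bound T (r + t) s \<le> exp 1 * heat_bound T r s"
    proof -
      have "exp (s - T + (r + t) / 2) \<le> exp (1 + (s - T + r / 2))" using t assms by simp
      also have "\<dots> = exp 1 * exp (s - T + r / 2)" by (rule exp_add)
      finally have "exp (s - T + (r + t) / 2) / sqrt (r + t) \<le> exp 1 * exp (s - T + r / 2) / sqrt r"
        using r t by (intro frac_le) auto
      then show ?thesis by (simp add: heat_bound_def)
    qed
    finally show ?thesis using heat_const_pos[OF assms(1)] by (simp add: mult_ac)
  qed
  moreover have "\<bar>dif 2 t / 2 * h\<^sup>2\<bar> = h\<^sup>2 / 2 * \<bar>dif 2 t\<bar>" by (simp add: abs_mult)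
  moreover have "h\<^sup>2 / 2 * \<bar>dif 2 t\<bar> \<le> h\<^sup>2 * \<bar>dif 2 t\<bar>" by (intro mult_right_mono) auto
  ultimately show ?thesis unfolding X_def
    by (smt (verit) mult_left_mono zero_le_power2)
qed

text \<open>The second-order space term and the first-order time term share the coefficient
  \<open>u2\<close> and cancel up to the mismatch between E Z^2 and h. What survives is the drift,
  this variance defect and the two Taylor remainders.\<close>

lemma (in prob_space) heat_step:
  assumes \<delta>: "0 < \<delta>" "\<delta> \<le> r" and h: "0 \<le> h" "h \<le> 1"
    and Z [measurable]: "Z \<in> borel_measurable M" and Z1: "\<And>\<omega>. \<bar>Z \<omega>\<bar> \<le> 1"
  shows "\<bar>expectation (\<lambda>\<omega>. gauss_tail ((T - (s + Z \<omega>)) / sqrt r)) - gauss_tail ((T - s) / sqrt (r + h))\<bar>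
    \<le> exp 1 * heat_const \<delta> * heat_bound T r s *
       (\<bar>expectation Z\<bar> + \<bar>expectation (\<lambda>\<omega>. (Z \<omega>)\<^sup>2) - h\<bar> + expectation (\<lambda>\<omega>. \<bar>Z \<omega>\<bar> ^ 3) + h\<^sup>2)"
proof -
  define \<xi> where "\<xi> = (T - s) / sqrt r"
  define u1 where "u1 = std_normal_density \<xi> / sqrt r"
  define u2 where "u2 = \<xi> * std_normal_density \<xi> / r"
  define K where "K = exp 1 * heat_const \<delta> * heat_bound T r s"
  have r: "0 < r" using assms by simp
  have HB: "0 < heat_const \<delta> * heat_bound T r s"
    using heat_const_pos[OF \<delta>(1)] r by (simp add: heat_bound_def)
  then have K0: "0 \<le> K" "heat_const \<delta> * heat_bound T r s \<le> K"
    using mult_right_mono[of 1 "exp 1" "heat_const \<delta> * heat_bound T r s"] by (simp_all add: K_def mult.assoc)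
  have u1: "\<bar>u1\<bar> \<le> K" and u2: "\<bar>u2\<bar> \<le> K"
    using heat_deriv_bounds(1,2)[OF \<delta>, of T s] K0 by (simp_all add: u1_def u2_def \<xi>_def)
  have b: "integrable M (\<lambda>\<omega>. f (Z \<omega>))" if [measurable]: "f \<in> borel_measurable borel" and "\<And>z. \<bar>z\<bar> \<le> 1 \<Longrightarrow> \<bar>f z\<bar> \<le> B"
    for f :: "real \<Rightarrow> real" and B
    using that Z1 by (intro integrable_const_bound[where B=B]) auto
  have iZ: "integrable M Z" using b[of "\<lambda>z. z" 1] by simp
  have iZ2: "integrable M (\<lambda>\<omega>. (Z \<omega>)\<^sup>2)" using b[of "\<lambda>z. z\<^sup>2" 1] by (simp add: abs_square_le_1)
  have iZ3: "integrable M (\<lambda>\<omega>. \<bar>Z \<omega>\<bar> ^ 3)" using b[of "\<lambda>z. \<bar>z\<bar>^3" 1] by (simp add: power_le_one)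
  have iQ: "integrable M (\<lambda>\<omega>. gauss_tail ((T - (s + Z \<omega>)) / sqrt r))"
    using b[of "\<lambda>z. gauss_tail ((T - (s + z)) / sqrt r)" 1] gauss_tail_nonneg gauss_tail_le_1 by simp
  define R where "R = (\<lambda>\<omega>. gauss_tail ((T - (s + Z \<omega>)) / sqrt r) - gauss_tail \<xi> - Z \<omega> * u1 - (Z \<omega>)\<^sup>2 / 2 * u2)"
  have iR: "integrable M R" unfolding R_def using iZ iZ2 iQ by simp
  have Rb: "\<bar>R \<omega>\<bar> \<le> \<bar>Z \<omega>\<bar> ^ 3 / 6 * K" for \<omega>
    using heat_expansion_space[OF \<delta> Z1, of T s \<omega>] unfolding R_def u1_def u2_def \<xi>_def K_def .
  have "\<bar>expectation R\<bar> \<le> expectation (\<lambda>\<omega>. \<bar>R \<omega>\<bar>)" by (rule integral_abs_bound)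
  also have "\<dots> \<le> expectation (\<lambda>\<omega>. \<bar>Z \<omega>\<bar> ^ 3 / 6 * K)"
    using iR iZ3 Rb by (intro integral_mono) auto
  also have "\<dots> = expectation (\<lambda>\<omega>. \<bar>Z \<omega>\<bar> ^ 3) / 6 * K" by simp
  also have "\<dots> \<le> expectation (\<lambda>\<omega>. \<bar>Z \<omega>\<bar> ^ 3) * K"
    using K0 by (intro mult_right_mono) (auto simp: integral_nonneg)
  finally have 1: "\<bar>expectation R\<bar> \<le> expectation (\<lambda>\<omega>. \<bar>Z \<omega>\<bar> ^ 3) * K" .
  have 2: "expectation (\<lambda>\<omega>. gauss_tail ((T - (s + Z \<omega>)) / sqrt r)) = gauss_tail \<xi> + expectation Z * u1 + expectation (\<lambda>\<omega>. (Z \<omega>)\<^sup>2) / 2 * u2 + expectation R"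
  proof -
    have "expectation R = expectation (\<lambda>\<omega>. gauss_tail ((T - (s + Z \<omega>)) / sqrt r)) - gauss_tail \<xi> - expectation Z * u1 - expectation (\<lambda>\<omega>. (Z \<omega>)\<^sup>2) / 2 * u2"
      unfolding R_def using iZ iZ2 iQ by (simp add: prob_space)
    then show ?thesis by simp
  qed
  have 3: "\<bar>gauss_tail ((T - s) / sqrt (r + h)) - gauss_tail \<xi> - h / 2 * u2\<bar> \<le> h\<^sup>2 * K"
    using heat_expansion_time[OF \<delta> h, of T s] unfolding u2_def \<xi>_def K_def .
  have 4: "\<bar>expectation Z * u1\<bar> \<le> \<bar>expectation Z\<bar> * K"
    using u1 by (simp add: abs_mult mult_left_mono)
  have "\<bar>(expectation (\<lambda>\<omega>. (Z \<omega>)\<^sup>2) - h) / 2 * u2\<bar> \<le> \<bar>expectation (\<lambda>\<omega>. (Z \<omega>)\<^sup>2) - h\<bar> * K"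
    using u2 unfolding abs_mult by (intro mult_mono) auto
  then have 5: "\<bar>expectation (\<lambda>\<omega>. (Z \<omega>)\<^sup>2) / 2 * u2 - h / 2 * u2\<bar> \<le> \<bar>expectation (\<lambda>\<omega>. (Z \<omega>)\<^sup>2) - h\<bar> * K"
    by (simp add: diff_divide_distrib left_diff_distrib)
  have "\<bar>expectation (\<lambda>\<omega>. gauss_tail ((T - (s + Z \<omega>)) / sqrt r)) - gauss_tail ((T - s) / sqrt (r + h))\<bar>
    \<le> \<bar>expectation Z\<bar> * K + \<bar>expectation (\<lambda>\<omega>. (Z \<omega>)\<^sup>2) - h\<bar> * K + expectation (\<lambda>\<omega>. \<bar>Z \<omega>\<bar> ^ 3) * K + h\<^sup>2 * K"
    unfolding 2 using 1 3 4 5 by linarith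
  then show ?thesis by (simp add: K_def algebra_simps)
qed

section \<open>Optional stopping\<close>

text \<open>Freezing of the past, by Fubini on the product law. It takes the place of conditional
  expectations in \<open>stopped_expectation_le\<close>.\<close>

lemma (in prob_space) indep_var_expectation:
  fixes F :: "'b \<times> 'b \<Rightarrow> real"
  assumes ind: "indep_var S X T Y" and F [measurable]: "F \<in> borel_measurable (S \<Otimes>\<^sub>M T)"
    and int: "integrable M (\<lambda>\<omega>. F (X \<omega>, Y \<omega>))"
  shows "expectation (\<lambda>\<omega>. F (X \<omega>, Y \<omega>)) = expectation (\<lambda>\<omega>. expectation (\<lambda>\<omega>'. F (X \<omega>, Y \<omega>')))" (is ?eq)
    and "integrable M (\<lambda>\<omega>. expectation (\<lambda>\<omega>'. F (X \<omega>, Y \<omega>')))" (is ?int)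
proof -
  have X [measurable]: "X \<in> measurable M S" and Y [measurable]: "Y \<in> measurable M T"
    using indep_var_rv1[OF ind] indep_var_rv2[OF ind] by auto
  have eq: "distr M S X \<Otimes>\<^sub>M distr M T Y = distr M (S \<Otimes>\<^sub>M T) (\<lambda>x. (X x, Y x))"
    using ind by (simp add: indep_var_distribution_eq)
  interpret A: prob_space "distr M S X" by (rule prob_space_distr) simp
  interpret B: prob_space "distr M T Y" by (rule prob_space_distr) simp
  interpret P: pair_sigma_finite "distr M S X" "distr M T Y" ..
  have int': "integrable (distr M S X \<Otimes>\<^sub>M distr M T Y) F"
    unfolding eq using int by (simp add: integrable_distr_eq)
  have inner: "(\<integral>y. F (x, y) \<partial>distr M T Y) = expectation (\<lambda>\<omega>'. F (x, Y \<omega>'))" if "x \<in> space S" for x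
    using that by (intro integral_distr) auto
  have "expectation (\<lambda>\<omega>. F (X \<omega>, Y \<omega>)) = (\<integral>z. F z \<partial>(distr M S X \<Otimes>\<^sub>M distr M T Y))"
    unfolding eq by (subst integral_distr) auto
  also have "\<dots> = (\<integral>x. (\<integral>y. F (x, y) \<partial>distr M T Y) \<partial>distr M S X)"
    by (rule P.integral_fst'[OF int', symmetric])
  also have "\<dots> = expectation (\<lambda>\<omega>. (\<integral>y. F (X \<omega>, y) \<partial>distr M T Y))"
    by (subst integral_distr) auto
  also have "\<dots> = expectation (\<lambda>\<omega>. expectation (\<lambda>\<omega>'. F (X \<omega>, Y \<omega>')))"
    by (intro Bochner_Integration.integral_cong inner measurable_space[OF X]) auto
  finally show ?eq .
  have "integrable (distr M S X) (\<lambda>x. \<integral>y. F (x, y) \<partial>distr M T Y)"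
    using P.integrable_fst'[OF int'] by simp
  then have "integrable M (\<lambda>\<omega>. (\<integral>y. F (X \<omega>, y) \<partial>distr M T Y))"
    by (subst (asm) integrable_distr_eq) auto
  moreover have "integrable M (\<lambda>\<omega>. (\<integral>y. F (X \<omega>, y) \<partial>distr M T Y)) \<longleftrightarrow>
      integrable M (\<lambda>\<omega>. expectation (\<lambda>\<omega>'. F (X \<omega>, Y \<omega>')))"
    by (intro Bochner_Integration.integrable_cong refl inner measurable_space[OF X])
  ultimately show ?int by simp
qed

definition stays :: "real set \<Rightarrow> (nat \<Rightarrow> 'a \<Rightarrow> real) \<Rightarrow> nat \<Rightarrow> 'a \<Rightarrow> bool" where
  "stays D Z k \<omega> \<longleftrightarrow> (\<forall>j\<le>k. partial_sum Z j \<omega> \<in> D)"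

text \<open>The values of \<open>F\<close> along the walk stopped at its first exit from
  \<open>D\<close>, by recursion instead of a stopping time. The exit value is taken at the position
  after the exiting step, overshoot included; \<open>D = UNIV\<close> gives the free walk.\<close>

primrec stopped :: "(nat \<Rightarrow> real \<Rightarrow> real) \<Rightarrow> real set \<Rightarrow> (nat \<Rightarrow> 'a \<Rightarrow> real) \<Rightarrow> nat \<Rightarrow> 'a \<Rightarrow> real" where
  "stopped F D Z 0 \<omega> = F 0 0"
| "stopped F D Z (Suc k) \<omega> =
    (if stays D Z k \<omega> then F (Suc k) (partial_sum Z (Suc k) \<omega>) else stopped F D Z k \<omega>)"

lemma partial_sum_0 [simp]: "partial_sum Z 0 \<omega> = 0"
  by (simp add: partial_sum_def)

lemma partial_sum_Suc: "partial_sum Z (Suc k) \<omega> = partial_sum Z k \<omega> + Z (Suc k) \<omega>"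
  by (simp add: partial_sum_def)

lemma partial_sum_measurable [measurable (raw)]:
  "(\<And>i. Z i \<in> borel_measurable M) \<Longrightarrow> partial_sum Z k \<in> borel_measurable M"
  unfolding partial_sum_def[abs_def] by simp

lemma stays_measurable [measurable]:
  assumes [measurable]: "\<And>i. Z i \<in> borel_measurable M" "D \<in> sets borel"
  shows "Measurable.pred M (stays D Z k)"
  unfolding stays_def by measurable

lemma stays_Suc: "stays D Z (Suc k) \<omega> \<longleftrightarrow> stays D Z k \<omega> \<and> partial_sum Z (Suc k) \<omega> \<in> D"
  by (auto simp: stays_def le_Suc_eq)

lemma stopped_stays: "stays D Z k \<omega> \<Longrightarrow> stopped F D Z k \<omega> = F k (partial_sum Z k \<omega>)"
  by (cases k) (auto simp: stays_Suc)

lemma stopped_UNIV: "stopped F UNIV Z k \<omega> = F k (partial_sum Z k \<omega>)"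
  by (rule stopped_stays) (simp add: stays_def)

lemma stopped_exit:
  assumes "\<not> stays D Z n \<omega>" "0 \<in> D"
  obtains k where "k < n" "stays D Z k \<omega>" "partial_sum Z (Suc k) \<omega> \<notin> D"
    "stopped F D Z n \<omega> = F (Suc k) (partial_sum Z (Suc k) \<omega>)"
proof -
  have "\<exists>k<n. stays D Z k \<omega> \<and> partial_sum Z (Suc k) \<omega> \<notin> D \<and>
    stopped F D Z n \<omega> = F (Suc k) (partial_sum Z (Suc k) \<omega>)"
    using assms(1)
  proof (induction n)
    case 0
    then show ?case using assms(2) by (simp add: stays_def)
  next
    case (Suc n)
    show ?case
    proof (cases "stays D Z n \<omega>")
      case True
      then show ?thesis using Suc.prems by (intro exI[of _ n]) (simp add: stays_Suc)
    next
      case False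
      then show ?thesis using Suc.IH by (auto intro: less_SucI)
    qed
  qed
  then show ?thesis using that by blast
qed

lemma stopped_measurable:
  assumes [measurable]: "\<And>i. Z i \<in> borel_measurable M" "D \<in> sets borel" "\<And>k. F k \<in> borel_measurable borel"
  shows "stopped F D Z k \<in> borel_measurable M"
  by (induction k) (auto simp: measurable_If[of _ M _ _ "stays D Z k" for k])

lemma (in prob_space) stopped_integrable:
  assumes [measurable]: "\<And>i. Z i \<in> borel_measurable M" "D \<in> sets borel" "\<And>k. F k \<in> borel_measurable borel"
    and "\<And>k. k \<le> n \<Longrightarrow> integrable M (\<lambda>\<omega>. F k (partial_sum Z k \<omega>))"
  shows "integrable M (stopped F D Z n)"
  using assms(4)
proof (induction n)
  case 0
  then show ?case by simp
next
  case (Suc n)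
  have 1: "integrable M (stopped F D Z n)" using Suc by simp
  have 2: "integrable M (\<lambda>\<omega>. F (Suc n) (partial_sum Z (Suc n) \<omega>))" using Suc by simp
  show ?case
  proof (rule Bochner_Integration.integrable_bound[OF Bochner_Integration.integrable_add[OF integrable_abs[OF 1] integrable_abs[OF 2]]])
    show "stopped F D Z (Suc n) \<in> borel_measurable M" by (intro stopped_measurable) auto
  qed auto
qed

text \<open>Optional stopping for a supermartingale up to errors \<open>E\<close>. As the errors are
  nonnegative, they may be summed over all times, also after the exit. Applied to \<open>F\<close>
  and to \<open>-F\<close> it gives two-sided bounds.\<close>

lemma (in prob_space) stopped_expectation_le:
  assumes ind: "indep_vars (\<lambda>_. borel) Z UNIV"
    and D [measurable]: "D \<in> sets borel" and F [measurable]: "\<And>k. F k \<in> borel_measurable borel"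
    and iF: "\<And>k. k \<le> n \<Longrightarrow> integrable M (\<lambda>\<omega>. F k (partial_sum Z k \<omega>))"
    and iE: "\<And>k. k < n \<Longrightarrow> integrable M (\<lambda>\<omega>. E k (partial_sum Z k \<omega>))"
    and E0: "\<And>k s. k < n \<Longrightarrow> 0 \<le> E k s"
    and step: "\<And>k s. k < n \<Longrightarrow> expectation (\<lambda>\<omega>. F (Suc k) (s + Z (Suc k) \<omega>)) \<le> F k s + E k s"
  shows "expectation (stopped F D Z n) \<le> F 0 0 + (\<Sum>k<n. expectation (\<lambda>\<omega>. E k (partial_sum Z k \<omega>)))"
  using iF iE E0 step
proof (induction n)
  case 0
  then show ?case by (simp add: prob_space)
next
  case (Suc n)
  have Z [measurable]: "Z i \<in> borel_measurable M" for i using ind by (auto simp: indep_vars_def2)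
  have 1: "integrable M (stopped F D Z n)" by (intro stopped_integrable Suc.prems) auto
  have 2: "integrable M (\<lambda>\<omega>. F (Suc n) (partial_sum Z (Suc n) \<omega>))" using Suc.prems by simp
  have 3: "integrable M (\<lambda>\<omega>. F n (partial_sum Z n \<omega>))" using Suc.prems by simp
  have 4: "integrable M (\<lambda>\<omega>. E n (partial_sum Z n \<omega>))" using Suc.prems by simp
  have [measurable]: "(\<lambda>\<omega>. E n (partial_sum Z n \<omega>)) \<in> borel_measurable M" using 4 by simp
  define I where "I = (\<lambda>\<omega>. if stays D Z n \<omega> then 1 else 0 :: real)"
  have [measurable]: "I \<in> borel_measurable M" unfolding I_def by measurable
  have int: "integrable M (\<lambda>\<omega>. I \<omega> * f \<omega>)" if "integrable M f" for f
  proof (rule Bochner_Integration.integrable_bound[OF that])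
    have [measurable]: "f \<in> borel_measurable M" using that by simp
    show "(\<lambda>\<omega>. I \<omega> * f \<omega>) \<in> borel_measurable M" by measurable
  qed (auto simp: I_def)
  \<comment> \<open>Only paths that have not left \<open>D\<close> move in this step, and on them
    the stopped value is \<open>F n\<close> at the current position.\<close>
  have "expectation (stopped F D Z (Suc n)) = expectation (\<lambda>\<omega>. stopped F D Z n \<omega> +
      (I \<omega> * F (Suc n) (partial_sum Z (Suc n) \<omega>) - I \<omega> * F n (partial_sum Z n \<omega>)))"
    by (intro Bochner_Integration.integral_cong) (auto simp: I_def stopped_stays)
  also have "\<dots> = expectation (stopped F D Z n) +
     (expectation (\<lambda>\<omega>. I \<omega> * F (Suc n) (partial_sum Z (Suc n) \<omega>)) - expectation (\<lambda>\<omega>. I \<omega> * F n (partial_sum Z n \<omega>)))"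
    using 1 int[OF 2] int[OF 3] by simp
  also have "expectation (\<lambda>\<omega>. I \<omega> * F (Suc n) (partial_sum Z (Suc n) \<omega>)) \<le>
     expectation (\<lambda>\<omega>. I \<omega> * F n (partial_sum Z n \<omega>)) + expectation (\<lambda>\<omega>. E n (partial_sum Z n \<omega>))"
  proof -
    \<comment> \<open>\<open>P\<close> and \<open>G\<close> express survival and the next value
      through the first \<open>n\<close> coordinates and the coordinate \<open>Suc n\<close>, two
      independent blocks.\<close>
    define P where "P = (\<lambda>x::nat \<Rightarrow> real. \<forall>j\<in>{..n}. (\<Sum>i\<in>{1..j}. x i) \<in> D)"
    define G where "G = (\<lambda>(x, y). (if P x then 1 else 0) * F (Suc n) ((\<Sum>i\<in>{1..n}. x i) + y (Suc n)))"
    have [measurable]: "(\<lambda>x. \<Sum>i\<in>{1..j}. x i) \<in> borel_measurable (PiM {1..n} (\<lambda>_. borel :: real measure))" if "j \<le> n" for j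
      using that by (intro borel_measurable_sum measurable_component_singleton) auto
    have P: "Measurable.pred (PiM {1..n} (\<lambda>_. borel)) P"
      unfolding P_def by (intro pred_intros_finite pred_sets2[OF D]) auto
    have [measurable]: "(\<lambda>z. P (fst z)) \<in> measurable (PiM {1..n} (\<lambda>_. borel) \<Otimes>\<^sub>M PiM {Suc n} (\<lambda>_. borel :: real measure)) (count_space UNIV)"
      using measurable_compose[OF measurable_fst P] .
    have [measurable]: "(\<lambda>z. \<Sum>i\<in>{1..n}. fst z i) \<in> borel_measurable (PiM {1..n} (\<lambda>_. borel :: real measure) \<Otimes>\<^sub>M PiM {Suc n} (\<lambda>_. borel :: real measure))"
      by (rule measurable_compose[OF measurable_fst]) auto
    have [measurable]: "(\<lambda>z. snd z (Suc n)) \<in> borel_measurable (PiM {1..n} (\<lambda>_. borel :: real measure) \<Otimes>\<^sub>M PiM {Suc n} (\<lambda>_. borel :: real measure))"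
      by (rule measurable_compose[OF measurable_snd]) auto
    have Gm: "G \<in> borel_measurable (PiM {1..n} (\<lambda>_. borel) \<Otimes>\<^sub>M PiM {Suc n} (\<lambda>_. borel))"
      unfolding G_def split_beta by measurable
    have iv: "indep_var (PiM {1..n} (\<lambda>_. borel)) (\<lambda>\<omega>. restrict (\<lambda>i. Z i \<omega>) {1..n})
        (PiM {Suc n} (\<lambda>_. borel)) (\<lambda>\<omega>. restrict (\<lambda>i. Z i \<omega>) {Suc n})"
      by (rule indep_var_restrict[OF ind]) auto
    have Geq: "G (restrict (\<lambda>i. Z i \<omega>) {1..n}, restrict (\<lambda>i. Z i \<omega>') {Suc n}) = I \<omega> * F (Suc n) (partial_sum Z n \<omega> + Z (Suc n) \<omega>')" for \<omega> \<omega>'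

    proof -
      have "(\<Sum>i\<in>{1..j}. restrict (\<lambda>i. Z i \<omega>) {1..n} i) = partial_sum Z j \<omega>" if "j \<le> n" for j
        unfolding partial_sum_def using that by (intro sum.cong) auto
      then show ?thesis unfolding G_def P_def I_def stays_def by auto
    qed
    have "integrable M (\<lambda>\<omega>. G (restrict (\<lambda>i. Z i \<omega>) {1..n}, restrict (\<lambda>i. Z i \<omega>) {Suc n}))"
      unfolding Geq using int[OF 2] by (simp add: partial_sum_Suc)
    note fub = indep_var_expectation[OF iv Gm this, unfolded Geq]
    have "expectation (\<lambda>\<omega>. I \<omega> * F (Suc n) (partial_sum Z (Suc n) \<omega>))
       = expectation (\<lambda>\<omega>. I \<omega> * expectation (\<lambda>\<omega>'. F (Suc n) (partial_sum Z n \<omega> + Z (Suc n) \<omega>')))"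
      using fub(1) by (simp add: partial_sum_Suc)
    also have "\<dots> \<le> expectation (\<lambda>\<omega>. I \<omega> * F n (partial_sum Z n \<omega>) + E n (partial_sum Z n \<omega>))"
    proof (rule integral_mono)
      show "integrable M (\<lambda>\<omega>. I \<omega> * expectation (\<lambda>\<omega>'. F (Suc n) (partial_sum Z n \<omega> + Z (Suc n) \<omega>')))"
        using fub(2) by simp
      show "I \<omega> * expectation (\<lambda>\<omega>'. F (Suc n) (partial_sum Z n \<omega> + Z (Suc n) \<omega>'))
         \<le> I \<omega> * F n (partial_sum Z n \<omega>) + E n (partial_sum Z n \<omega>)" for \<omega>
        using Suc.prems(3,4)[of n "partial_sum Z n \<omega>"] by (auto simp: I_def)
    qed (use int[OF 3] 4 in simp)
    finally show ?thesis using int[OF 3] 4 by simp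
  qed
  finally show ?case using Suc by (simp del: stopped.simps)
qed

section \<open>Walks with small increments\<close>

lemma exp_le_cubic:
  fixes z :: real
  assumes "\<bar>z\<bar> \<le> 1"
  shows "exp z \<le> 1 + z + z\<^sup>2 / 2 + \<bar>z\<bar> ^ 3"
proof -
  obtain t where t: "\<bar>t\<bar> \<le> \<bar>z\<bar>" "exp z = (\<Sum>m<3. z ^ m / fact m) + exp t / fact 3 * z ^ 3"
    using Maclaurin_exp_le[of z 3] by blast
  have "exp t \<le> exp 1" using t assms by simp
  also have "\<dots> \<le> 3" by (rule exp_le)
  finally have "exp t / 6 \<le> 1" by simp
  have "exp t / 6 * z ^ 3 \<le> \<bar>exp t / 6 * z ^ 3\<bar>" by (rule abs_ge_self)
  also have "\<dots> = exp t / 6 * \<bar>z\<bar> ^ 3" by (simp add: abs_mult power_abs)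
  also have "\<dots> \<le> 1 * \<bar>z\<bar> ^ 3" using \<open>exp t / 6 \<le> 1\<close> by (intro mult_right_mono) auto
  finally show ?thesis using t by (simp add: numeral_eq_Suc)
qed

lemma (in prob_space) bounded_integrable:
  fixes Z :: "'a \<Rightarrow> real" and f :: "real \<Rightarrow> real"
  assumes [measurable]: "Z \<in> borel_measurable M" "f \<in> borel_measurable borel"
    and "\<And>\<omega>. \<bar>Z \<omega>\<bar> \<le> c" "\<And>z. \<bar>z\<bar> \<le> c \<Longrightarrow> \<bar>f z\<bar> \<le> B"
  shows "integrable M (\<lambda>\<omega>. f (Z \<omega>))"
  using assms(3,4) by (intro integrable_const_bound[where B=B]) auto

lemma (in prob_space) exp_moment_le:
  fixes Z :: "'a \<Rightarrow> real"
  assumes [measurable]: "Z \<in> borel_measurable M" and Z1: "\<And>\<omega>. \<bar>Z \<omega>\<bar> \<le> 1"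
    and "\<bar>expectation Z\<bar> \<le> m" "expectation (\<lambda>\<omega>. (Z \<omega>)\<^sup>2) \<le> h + m" "expectation (\<lambda>\<omega>. \<bar>Z \<omega>\<bar> ^ 3) \<le> m"
  shows "expectation (\<lambda>\<omega>. exp (Z \<omega>)) \<le> exp (h / 2 + 3 * m)"
proof -
  have iZ: "integrable M Z" by (rule bounded_integrable[of Z "\<lambda>z. z" 1 1]) (simp_all add: Z1)
  have iZ2: "integrable M (\<lambda>\<omega>. (Z \<omega>)\<^sup>2)" by (rule bounded_integrable[of Z "\<lambda>z. z\<^sup>2" 1 1]) (simp_all add: Z1 abs_square_le_1)
  have iZ3: "integrable M (\<lambda>\<omega>. \<bar>Z \<omega>\<bar> ^ 3)" by (rule bounded_integrable[of Z "\<lambda>z. \<bar>z\<bar>^3" 1 1]) (simp_all add: Z1 power_le_one)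
  have iE: "integrable M (\<lambda>\<omega>. exp (Z \<omega>))" by (rule bounded_integrable[of Z "\<lambda>z. exp z" 1 "exp 1"]) (simp_all add: Z1)
  have "expectation (\<lambda>\<omega>. exp (Z \<omega>)) \<le> expectation (\<lambda>\<omega>. 1 + Z \<omega> + (Z \<omega>)\<^sup>2 / 2 + \<bar>Z \<omega>\<bar> ^ 3)"
    using iZ iZ2 iZ3 iE exp_le_cubic[OF Z1] by (intro integral_mono) auto
  also have "\<dots> = 1 + expectation Z + expectation (\<lambda>\<omega>. (Z \<omega>)\<^sup>2) / 2 + expectation (\<lambda>\<omega>. \<bar>Z \<omega>\<bar> ^ 3)"
    using iZ iZ2 iZ3 by (simp add: prob_space)
  \<comment> \<open>The three defects contribute at most m + m/2 + m.\<close>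
  also have "\<dots> \<le> 1 + (h / 2 + 3 * m)" using assms by simp
  also have "\<dots> \<le> exp (h / 2 + 3 * m)" by (rule exp_ge_add_one_self)
  finally show ?thesis .
qed

lemma (in prob_space) walk_mgf:
  assumes ind: "indep_vars (\<lambda>_. borel) Z UNIV" and Z1: "\<And>i \<omega>. \<bar>Z i \<omega>\<bar> \<le> 1"
    and le: "\<And>i. expectation (\<lambda>\<omega>. exp (Z i \<omega>)) \<le> \<Lambda>"
  shows "expectation (\<lambda>\<omega>. exp (partial_sum Z k \<omega>)) \<le> \<Lambda> ^ k"
    and "integrable M (\<lambda>\<omega>. exp (partial_sum Z k \<omega>))"
proof -
  have [measurable]: "Z i \<in> borel_measurable M" for i using ind by (auto simp: indep_vars_def2)
  have ind': "indep_vars (\<lambda>_. borel) (\<lambda>i \<omega>. exp (Z i \<omega>)) {1..k}"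
    by (rule indep_vars_compose2[OF indep_vars_subset[OF ind]]) auto
  have int: "integrable M (\<lambda>\<omega>. exp (Z i \<omega>))" for i
    by (rule bounded_integrable[of "Z i" "\<lambda>z. exp z" 1 "exp 1"]) (simp_all add: Z1)
  have eq: "exp (partial_sum Z k \<omega>) = (\<Prod>i\<in>{1..k}. exp (Z i \<omega>))" for \<omega>
    by (simp add: partial_sum_def exp_sum)
  show "integrable M (\<lambda>\<omega>. exp (partial_sum Z k \<omega>))"
    unfolding eq by (rule indep_vars_integrable[OF _ ind' int]) auto
  have "expectation (\<lambda>\<omega>. exp (partial_sum Z k \<omega>)) = (\<Prod>i\<in>{1..k}. expectation (\<lambda>\<omega>. exp (Z i \<omega>)))"
    unfolding eq by (rule indep_vars_lebesgue_integral[OF _ ind' int]) auto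
  also have "\<dots> \<le> (\<Prod>i\<in>{1..k}. \<Lambda>)"
    by (intro prod_mono conjI le) (auto intro!: integral_nonneg)
  finally show "expectation (\<lambda>\<omega>. exp (partial_sum Z k \<omega>)) \<le> \<Lambda> ^ k" by simp
qed

text \<open>The factors 1 / sqrt r in \<open>heat_bound\<close>, summed over time, reduce to this
  sum; each term is at most twice an increment of the square root.\<close>

lemma sum_inverse_sqrt_le: "(\<Sum>j<n. 1 / sqrt (real (Suc j))) \<le> 2 * sqrt (real n)"
proof (induction n)
  case (Suc n)
  have "1 / sqrt (real (Suc n)) \<le> 2 * (sqrt (real (Suc n)) - sqrt (real n))"
  proof -
    have "sqrt (real (Suc n)) * (sqrt (real (Suc n)) - sqrt (real n)) * 2 = 2 * real (Suc n) - 2 * (sqrt (real (Suc n)) * sqrt (real n))"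
      by (simp add: algebra_simps)
    moreover have "2 * (sqrt (real (Suc n)) * sqrt (real n)) \<le> real (Suc n) + real n"
      using sum_squares_bound[of "sqrt (real (Suc n))" "sqrt (real n)"] by simp
    ultimately show ?thesis by (simp add: field_simps)
  qed
  then show ?case using Suc by simp
qed simp

text \<open>The probability that a Brownian motion, started from \<open>s\<close> at time \<open>k\<close> and run for the variance
  \<open>v (n - k) / n\<close> left plus an extra \<open>\<delta>\<close>, ends outside \<open>[-T, T]\<close>. The extra variance keeps
  all derivatives bounded up to the final time. On leaving \<open>(-T, T)\<close> the value is about \<open>1/2\<close>, which
  is the reflection principle behind the factor 2 between the two limits.\<close>

definition symm_tail :: "nat \<Rightarrow> real \<Rightarrow> real \<Rightarrow> real \<Rightarrow> nat \<Rightarrow> real \<Rightarrow> real" where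
  "symm_tail n v \<delta> T k s = gauss_tail ((T - s) / sqrt (\<delta> + v * (real n - real k) / real n))
     + gauss_tail ((T + s) / sqrt (\<delta> + v * (real n - real k) / real n))"

lemma symm_tail_measurable [measurable]: "symm_tail n v \<delta> T k \<in> borel_measurable borel"
  unfolding symm_tail_def[abs_def] by measurable

lemma symm_tail_bounds: "0 \<le> symm_tail n v \<delta> T k s" "symm_tail n v \<delta> T k s \<le> 2"
  unfolding symm_tail_def by (auto intro!: add_nonneg_nonneg gauss_tail_nonneg) (smt (verit) gauss_tail_le_1)

text \<open>The 16 is 4 (errors per step) times 2 (both barriers) times 2 (from
  \<open>sum_inverse_sqrt_le\<close>); \<open>exp 5\<close> is the \<open>exp 1\<close> of
  \<open>heat_step\<close> times the \<open>exp 4\<close> of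
  \<open>heat_bound_expectation\<close>.\<close>

definition md_const :: "real \<Rightarrow> real" where
  "md_const \<delta> = 16 * exp 5 * heat_const \<delta>"

lemma md_const_pos: "0 < \<delta> \<Longrightarrow> 0 < md_const \<delta>"
  by (simp add: md_const_def heat_const_pos)

lemma stopped_uminus: "stopped (\<lambda>k s. - F k s) D Z n \<omega> = - stopped F D Z n \<omega>"
  by (induction n) auto

text \<open>The increments are scaled so that \<open>v\<close> is the total variance and, in the
  estimates below, also the threshold. \<open>m\<close> is a common budget for the four errors of
  \<open>heat_step\<close>, already multiplied by the number \<open>n\<close> of steps.\<close>

locale small_walk = prob_space +
  fixes Z :: "nat \<Rightarrow> 'a \<Rightarrow> real" and n :: nat and v m :: real
  assumes ind: "indep_vars (\<lambda>_. borel) Z UNIV"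
    and Z1: "\<And>i \<omega>. \<bar>Z i \<omega>\<bar> \<le> 1"
    and v: "0 < v" and n: "0 < n" and m: "0 \<le> m" "m \<le> 1"
    and mean: "\<And>i. \<bar>expectation (Z i)\<bar> \<le> m / n"
    and var: "\<And>i. \<bar>expectation (\<lambda>\<omega>. (Z i \<omega>)\<^sup>2) - v / n\<bar> \<le> m / n"
    and third: "\<And>i. expectation (\<lambda>\<omega>. \<bar>Z i \<omega>\<bar> ^ 3) \<le> m / n"
    and vn: "(v / n)\<^sup>2 \<le> m / n"
begin

lemma Z_measurable [measurable]: "Z i \<in> borel_measurable M"
  using ind by (auto simp: indep_vars_def2)

lemma uminus_walk: "small_walk M (\<lambda>i \<omega>. - Z i \<omega>) n v m"
proof unfold_locales
  show "indep_vars (\<lambda>_. borel) (\<lambda>i \<omega>. - Z i \<omega>) UNIV"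
    by (rule indep_vars_compose2[OF ind]) auto
qed (use Z1 v n m mean var third vn in auto)

lemma mgf: "expectation (\<lambda>\<omega>. exp (partial_sum Z k \<omega>)) \<le> exp (k * (v / (2 * n) + 3 * m / n))"
  and mgf_integrable: "integrable M (\<lambda>\<omega>. exp (partial_sum Z k \<omega>))"
proof -
  have "expectation (\<lambda>\<omega>. exp (Z i \<omega>)) \<le> exp ((v / n) / 2 + 3 * (m / n))" for i
    using mean[of i] var[of i] third[of i] by (intro exp_moment_le Z1) (auto simp: abs_le_iff)
  from walk_mgf[OF ind Z1 this, of k]
  show "expectation (\<lambda>\<omega>. exp (partial_sum Z k \<omega>)) \<le> exp (k * (v / (2 * n) + 3 * m / n))"
    "integrable M (\<lambda>\<omega>. exp (partial_sum Z k \<omega>))"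
    by (simp_all add: mult.commute flip: exp_of_nat_mult)
qed

lemma partial_sum_uminus: "partial_sum (\<lambda>i \<omega>. - Z i \<omega>) k \<omega> = - partial_sum Z k \<omega>"
  by (simp add: partial_sum_def sum_negf)

lemma mgf_uminus: "expectation (\<lambda>\<omega>. exp (- partial_sum Z k \<omega>)) \<le> exp (k * (v / (2 * n) + 3 * m / n))"
  and mgf_uminus_integrable: "integrable M (\<lambda>\<omega>. exp (- partial_sum Z k \<omega>))"
  using small_walk.mgf[OF uminus_walk, of k] small_walk.mgf_integrable[OF uminus_walk, of k]
  by (simp_all add: partial_sum_uminus)

text \<open>The second summand of \<open>symm_tail\<close> is the first one at -s, so
  \<open>heat_step\<close> is applied to the walk and to its reflection. The 4 counts the four
  errors, each at most m / n.\<close>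

lemma symm_tail_step:
  assumes \<delta>: "0 < \<delta>" and vn1: "v / n \<le> 1" and k: "k < n"
  defines "r \<equiv> \<delta> + v * (real n - real (Suc k)) / real n"
  shows "\<bar>expectation (\<lambda>\<omega>. symm_tail n v \<delta> T (Suc k) (s + Z (Suc k) \<omega>)) - symm_tail n v \<delta> T k s\<bar>
    \<le> exp 1 * heat_const \<delta> * (4 * m / n) * (heat_bound T r s + heat_bound T r (- s))"
proof -
  have r: "\<delta> \<le> r" using k v n unfolding r_def by (auto intro!: divide_nonneg_nonneg mult_nonneg_nonneg)
  have r0: "0 < r" using r \<delta> by simp
  have rh: "r + v / n = \<delta> + v * (real n - real k) / real n"
    using n by (simp add: r_def field_simps)
  interpret N: small_walk M "\<lambda>i \<omega>. - Z i \<omega>" n v m by (rule uminus_walk)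
  have step: "\<bar>expectation (\<lambda>\<omega>. gauss_tail ((T - (s + Y \<omega>)) / sqrt r)) - gauss_tail ((T - s) / sqrt (r + v / n))\<bar>
    \<le> exp 1 * heat_const \<delta> * heat_bound T r s * (4 * m / n)"
    if [measurable]: "Y \<in> borel_measurable M" and Y: "\<And>\<omega>. \<bar>Y \<omega>\<bar> \<le> 1" "\<bar>expectation Y\<bar> \<le> m / n"
      "\<bar>expectation (\<lambda>\<omega>. (Y \<omega>)\<^sup>2) - v / n\<bar> \<le> m / n" "expectation (\<lambda>\<omega>. \<bar>Y \<omega>\<bar> ^ 3) \<le> m / n" for Y s
  proof -
    have "\<bar>expectation (\<lambda>\<omega>. gauss_tail ((T - (s + Y \<omega>)) / sqrt r)) - gauss_tail ((T - s) / sqrt (r + v / n))\<bar>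
      \<le> exp 1 * heat_const \<delta> * heat_bound T r s *
       (\<bar>expectation Y\<bar> + \<bar>expectation (\<lambda>\<omega>. (Y \<omega>)\<^sup>2) - v / n\<bar> + expectation (\<lambda>\<omega>. \<bar>Y \<omega>\<bar> ^ 3) + (v / n)\<^sup>2)"
      using \<delta> r v n vn1 Y by (intro heat_step) auto
    also have "\<dots> \<le> exp 1 * heat_const \<delta> * heat_bound T r s * (4 * m / n)"
      using heat_const_pos[OF \<delta>] r0 Y vn by (intro mult_left_mono) (auto simp: heat_bound_def)
    finally show ?thesis .
  qed
  have 1: "\<bar>expectation (\<lambda>\<omega>. gauss_tail ((T - (s + Z (Suc k) \<omega>)) / sqrt r)) - gauss_tail ((T - s) / sqrt (r + v / n))\<bar>
    \<le> exp 1 * heat_const \<delta> * heat_bound T r s * (4 * m / n)"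
    by (intro step Z1 mean var third) auto
  have 2: "\<bar>expectation (\<lambda>\<omega>. gauss_tail ((T + (s + Z (Suc k) \<omega>)) / sqrt r)) - gauss_tail ((T + s) / sqrt (r + v / n))\<bar>
    \<le> exp 1 * heat_const \<delta> * heat_bound T r (- s) * (4 * m / n)"
    using step[of "\<lambda>\<omega>. - Z (Suc k) \<omega>" "- s", OF _ N.Z1 N.mean N.var N.third] by (simp add: algebra_simps)
  have int: "integrable M (\<lambda>\<omega>. gauss_tail ((T - (s + Z (Suc k) \<omega>)) / sqrt r))"
     "integrable M (\<lambda>\<omega>. gauss_tail ((T + (s + Z (Suc k) \<omega>)) / sqrt r))"
    using gauss_tail_nonneg gauss_tail_le_1 by (auto intro!: integrable_const_bound[where B=1])
  have "expectation (\<lambda>\<omega>. symm_tail n v \<delta> T (Suc k) (s + Z (Suc k) \<omega>)) =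
    expectation (\<lambda>\<omega>. gauss_tail ((T - (s + Z (Suc k) \<omega>)) / sqrt r)) + expectation (\<lambda>\<omega>. gauss_tail ((T + (s + Z (Suc k) \<omega>)) / sqrt r))"
    unfolding symm_tail_def r_def[symmetric] using int by simp
  moreover have "symm_tail n v \<delta> T k s = gauss_tail ((T - s) / sqrt (r + v / n)) + gauss_tail ((T + s) / sqrt (r + v / n))"
    unfolding symm_tail_def rh ..
  moreover have "exp 1 * heat_const \<delta> * (4 * m / n) * (heat_bound T r s + heat_bound T r (- s)) =
    exp 1 * heat_const \<delta> * heat_bound T r s * (4 * m / n) + exp 1 * heat_const \<delta> * heat_bound T r (- s) * (4 * m / n)"
    by (simp only: distrib_left mult_ac)
  ultimately show ?thesis using 1 2 by linarith
qed

text \<open>Per step the exponent r/2 drops by v / (2n) while the exponential moment of the walk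
  gains that much, so the exponent remains v/2 - T at all times up to \<delta>/2 + 3m, which
  \<open>exp 4\<close> covers.\<close>

lemma heat_bound_expectation:
  assumes \<delta>: "0 < \<delta>" "\<delta> \<le> 1" and vn1: "v / n \<le> \<delta>" and k: "k < n"
  defines "r \<equiv> \<delta> + v * (real n - real (Suc k)) / real n"
  shows "expectation (\<lambda>\<omega>. heat_bound T r (partial_sum Z k \<omega>) + heat_bound T r (- partial_sum Z k \<omega>))
     \<le> 2 * exp 4 * exp (v / 2 - T) * sqrt (n / v) * (1 / sqrt (real (n - k)))"
   and "integrable M (\<lambda>\<omega>. heat_bound T r (partial_sum Z k \<omega>) + heat_bound T r (- partial_sum Z k \<omega>))"
proof -
  define A where "A = exp (k * (v / (2 * n) + 3 * m / n))"
  have r: "\<delta> \<le> r" using k v n unfolding r_def by (auto intro!: divide_nonneg_nonneg mult_nonneg_nonneg)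
  have r0: "0 < r" using r \<delta> by simp
  have hb: "heat_bound T r s = exp (r / 2 - T) / sqrt r * exp s" for s
    unfolding heat_bound_def by (simp flip: exp_add add: algebra_simps)
  show "integrable M (\<lambda>\<omega>. heat_bound T r (partial_sum Z k \<omega>) + heat_bound T r (- partial_sum Z k \<omega>))"
    unfolding hb using mgf_integrable[of k] mgf_uminus_integrable[of k] by simp
  have "expectation (\<lambda>\<omega>. heat_bound T r (partial_sum Z k \<omega>) + heat_bound T r (- partial_sum Z k \<omega>))
    = exp (r / 2 - T) / sqrt r * (expectation (\<lambda>\<omega>. exp (partial_sum Z k \<omega>)) + expectation (\<lambda>\<omega>. exp (- partial_sum Z k \<omega>)))"
    unfolding hb using mgf_integrable[of k] mgf_uminus_integrable[of k]
    by (subst Bochner_Integration.integral_add) (simp_all add: add_divide_distrib distrib_left)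
  also have "\<dots> \<le> exp (r / 2 - T) / sqrt r * (A + A)"
    unfolding A_def using mgf[of k] mgf_uminus[of k] r0 by (intro mult_left_mono add_mono) auto
  also have "\<dots> = 2 * (exp (r / 2 - T) * A) * (1 / sqrt r)" by simp
  also have "\<dots> \<le> 2 * (exp 4 * exp (v / 2 - T)) * (sqrt (n / v) * (1 / sqrt (real (n - k))))"
  proof -
    define a1 where "a1 = v * (real n - real (Suc k)) / real n"
    define a2 where "a2 = real k * v / n"
    define a3 where "a3 = real k * m / n"
    have "a3 \<le> 1"
      using k m n mult_mono[of "real k" "real n" m 1] by (simp add: a3_def divide_le_eq)
    moreover have "a1 + a2 = v - v / n"
      using n by (simp add: a1_def a2_def field_simps)
    moreover have "0 \<le> v / n" using v by simp
    moreover have "k * (v / (2 * n) + 3 * m / n) = a2 / 2 + 3 * a3"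
      by (simp add: a2_def a3_def distrib_left)
    moreover have "r = \<delta> + a1" by (simp add: r_def a1_def)
    ultimately have "(r / 2 - T) + k * (v / (2 * n) + 3 * m / n) \<le> 4 + (v / 2 - T)"
      using \<delta> by linarith
    then have f1: "exp (r / 2 - T) * A \<le> exp 4 * exp (v / 2 - T)"
      unfolding A_def exp_add[symmetric] by simp
    have "v * real (n - k) / n = v * (real n - real (Suc k)) / real n + v / n"
      using n k by (simp add: field_simps of_nat_diff)
    \<comment> \<open>\<delta> >= v / n makes up for the fact that \<open>r\<close> belongs to time
      \<open>Suc k\<close> and not to \<open>k\<close>.\<close>
    then have le: "v * real (n - k) / n \<le> r" using vn1 by (simp add: r_def)
    have pos: "0 < v * real (n - k) / n" using v n k by simp
    have "1 / sqrt r \<le> 1 / sqrt (v * real (n - k) / n)"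
      by (intro divide_left_mono mult_pos_pos real_sqrt_gt_zero real_sqrt_le_mono le pos r0) auto
    also have "\<dots> = sqrt (n / v) * (1 / sqrt (real (n - k)))"
      using v n k by (simp add: real_sqrt_divide real_sqrt_mult)
    finally have f2: "1 / sqrt r \<le> sqrt (n / v) * (1 / sqrt (real (n - k)))" .
    show ?thesis
      using r0 by (intro f1 f2 mult_mono order_refl) (auto simp: A_def)
  qed
  finally show "expectation (\<lambda>\<omega>. heat_bound T r (partial_sum Z k \<omega>) + heat_bound T r (- partial_sum Z k \<omega>))
     \<le> 2 * exp 4 * exp (v / 2 - T) * sqrt (n / v) * (1 / sqrt (real (n - k)))" by (simp add: mult.assoc)
qed

text \<open>The main term is the value at time 0 and position 0; the rest is the sum of the one-step
  errors. \<open>D\<close> is arbitrary, so the same estimate serves sums (\<open>UNIV\<close>) and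
  maxima (an open interval).\<close>

lemma symm_tail_expectation:
  assumes \<delta>: "0 < \<delta>" "\<delta> \<le> 1" and vn1: "v / n \<le> \<delta>" and D [measurable]: "D \<in> sets borel"
  shows "\<bar>expectation (stopped (symm_tail n v \<delta> T) D Z n) - 2 * gauss_tail (T / sqrt (v + \<delta>))\<bar>
     \<le> md_const \<delta> * m * (exp (v / 2 - T) / sqrt v)"
proof -
  define r where "r = (\<lambda>k. \<delta> + v * (real n - real (Suc k)) / real n)"
  define E where "E = (\<lambda>k s. exp 1 * heat_const \<delta> * (4 * m / n) * (heat_bound T (r k) s + heat_bound T (r k) (- s)))"
  define c where "c = exp 1 * heat_const \<delta> * (4 * m / n) * (2 * exp 4 * exp (v / 2 - T) * sqrt (n / v))"
  have r0: "\<delta> \<le> r k" if "k < n" for k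
    using that v n unfolding r_def by (auto intro!: divide_nonneg_nonneg mult_nonneg_nonneg)
  have E0: "0 \<le> E k s" if "k < n" for k s
    using r0[OF that] \<delta> m heat_const_pos[OF \<delta>(1)] unfolding E_def heat_bound_def
    by (intro mult_nonneg_nonneg add_nonneg_nonneg divide_nonneg_nonneg) auto
  have iE: "integrable M (\<lambda>\<omega>. E k (partial_sum Z k \<omega>))" if "k < n" for k
    unfolding E_def using heat_bound_expectation(2)[OF \<delta> vn1 that, of T] unfolding r_def by (intro integrable_mult_right)
  have EE: "expectation (\<lambda>\<omega>. E k (partial_sum Z k \<omega>)) \<le> c * (1 / sqrt (real (n - k)))" if "k < n" for k
  proof -
    have "expectation (\<lambda>\<omega>. E k (partial_sum Z k \<omega>)) = exp 1 * heat_const \<delta> * (4 * m / n) *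
        expectation (\<lambda>\<omega>. heat_bound T (r k) (partial_sum Z k \<omega>) + heat_bound T (r k) (- partial_sum Z k \<omega>))"
      unfolding E_def by (rule integral_mult_right_zero)
    also have "\<dots> \<le> exp 1 * heat_const \<delta> * (4 * m / n) * (2 * exp 4 * exp (v / 2 - T) * sqrt (n / v) * (1 / sqrt (real (n - k))))"
      using heat_bound_expectation(1)[OF \<delta> vn1 that, of T] heat_const_pos[OF \<delta>(1)] m unfolding r_def
      by (intro mult_left_mono) auto
    finally show ?thesis by (simp only: c_def mult.assoc)
  qed
  have c0: "0 \<le> c" using heat_const_pos[OF \<delta>(1)] m v unfolding c_def by auto
  have "(\<Sum>k<n. expectation (\<lambda>\<omega>. E k (partial_sum Z k \<omega>))) \<le> (\<Sum>k<n. c * (1 / sqrt (real (n - k))))"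
    by (intro sum_mono EE) auto
  also have "\<dots> = c * (\<Sum>k<n. 1 / sqrt (real (n - k)))" by (simp only: sum_distrib_left)
  also have "(\<Sum>k<n. 1 / sqrt (real (n - k))) = (\<Sum>j<n. 1 / sqrt (real (Suc j)))"
    by (rule sum.reindex_bij_witness[of _ "\<lambda>j. n - Suc j" "\<lambda>k. n - Suc k"]) auto
  also have "c * \<dots> \<le> c * (2 * sqrt n)" by (intro mult_left_mono sum_inverse_sqrt_le c0)
  also have "\<dots> = md_const \<delta> * m * (exp (v / 2 - T) / sqrt v)"
  proof -
    have S: "sqrt (n / v) * sqrt n = n / sqrt v" using v n by (simp add: real_sqrt_divide)
    have "c * (2 * sqrt n) = exp 1 * heat_const \<delta> * (4 * m / n) * (2 * exp 4 * exp (v / 2 - T)) * (2 * (n / sqrt v))"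
      unfolding c_def S[symmetric] by (simp only: mult_ac)
    also have "\<dots> = 16 * (exp 1 * exp 4) * heat_const \<delta> * m * (exp (v / 2 - T) / sqrt v)"
    proof -
      have "(4 * m / n) * a * (2 * (n / sqrt v)) = 8 * m * a / sqrt v" for a using n by simp
      from this[of "2 * exp 4 * exp (v / 2 - T)"] n show ?thesis by (simp add: mult.assoc)
    qed
    finally show ?thesis by (simp add: md_const_def flip: exp_add)
  qed
  finally have tot: "(\<Sum>k<n. expectation (\<lambda>\<omega>. E k (partial_sum Z k \<omega>))) \<le> md_const \<delta> * m * (exp (v / 2 - T) / sqrt v)" .
  have iF: "integrable M (\<lambda>\<omega>. symm_tail n v \<delta> T k (partial_sum Z k \<omega>))" for k
    using symm_tail_bounds[of n v \<delta> T k] by (intro integrable_const_bound[where B=2]) auto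
  have F0: "symm_tail n v \<delta> T 0 0 = 2 * gauss_tail (T / sqrt (v + \<delta>))"
    using n by (simp add: symm_tail_def add.commute)
  have vn1': "v / n \<le> 1" using vn1 \<delta> by simp
  have st: "\<bar>expectation (\<lambda>\<omega>. symm_tail n v \<delta> T (Suc k) (s + Z (Suc k) \<omega>)) - symm_tail n v \<delta> T k s\<bar> \<le> E k s" if "k < n" for k s
    using symm_tail_step[OF \<delta>(1) vn1' that, of T s] unfolding E_def r_def .
  have st1: "expectation (\<lambda>\<omega>. symm_tail n v \<delta> T (Suc k) (s + Z (Suc k) \<omega>)) \<le> symm_tail n v \<delta> T k s + E k s"
    and st2: "expectation (\<lambda>\<omega>. - symm_tail n v \<delta> T (Suc k) (s + Z (Suc k) \<omega>)) \<le> - symm_tail n v \<delta> T k s + E k s"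
    if "k < n" for k s using st[OF that, of s] by (simp_all add: abs_le_iff)
  have iF': "integrable M (\<lambda>\<omega>. - symm_tail n v \<delta> T k (partial_sum Z k \<omega>))" for k using iF by simp
  have "expectation (stopped (symm_tail n v \<delta> T) D Z n) \<le> symm_tail n v \<delta> T 0 0 + (\<Sum>k<n. expectation (\<lambda>\<omega>. E k (partial_sum Z k \<omega>)))"
    by (rule stopped_expectation_le[OF ind D _ iF iE E0 st1]) auto
  moreover have "expectation (stopped (\<lambda>k s. - symm_tail n v \<delta> T k s) D Z n) \<le> - symm_tail n v \<delta> T 0 0 + (\<Sum>k<n. expectation (\<lambda>\<omega>. E k (partial_sum Z k \<omega>)))"
    by (rule stopped_expectation_le[OF ind D _ iF' iE E0 st2]) auto
  moreover have "expectation (stopped (\<lambda>k s. - symm_tail n v \<delta> T k s) D Z n) = - expectation (stopped (symm_tail n v \<delta> T) D Z n)"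
    unfolding stopped_uminus[abs_def] by simp
  ultimately show ?thesis using tot unfolding F0 by linarith
qed

end

section \<open>Moderate deviations\<close>

lemma (in prob_space) integrable_indicator_event:
  "A \<in> events \<Longrightarrow> integrable M (indicator A :: 'a \<Rightarrow> real)"
  by (simp add: emeasure_eq_measure)

context small_walk
begin

abbreviation W :: "nat \<Rightarrow> 'a \<Rightarrow> real" where "W \<equiv> partial_sum Z"

lemma W_measurable: "W k \<in> borel_measurable M"
  by (rule partial_sum_measurable) simp

lemma sum_event_integrable: "integrable M (indicator {\<omega>\<in>space M. v \<le> \<bar>W n \<omega>\<bar>} :: 'a \<Rightarrow> real)"
  using W_measurable[of n] by (intro integrable_indicator_event) measurable

lemma exit_event_integrable: "integrable M (indicator {\<omega>\<in>space M. \<not> stays {-v<..<v} Z n \<omega>} :: 'a \<Rightarrow> real)"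
  by (intro integrable_indicator_event) measurable

lemma symm_tail_ge:
  assumes "0 < \<delta>" "T \<le> \<bar>s\<bar> + c" "k \<le> n" "0 \<le> c"
  shows "gauss_tail (c / sqrt \<delta>) \<le> symm_tail n v \<delta> T k s"
proof -
  define r where "r = \<delta> + v * (real n - real k) / real n"
  have r: "\<delta> \<le> r" using assms v n unfolding r_def by (auto intro!: divide_nonneg_nonneg mult_nonneg_nonneg)
  have "gauss_tail (c / sqrt \<delta>) \<le> gauss_tail ((T - \<bar>s\<bar>) / sqrt r)"
  proof (rule gauss_tail_antimono)
    have "(T - \<bar>s\<bar>) / sqrt r \<le> c / sqrt r"
      using assms r by (intro divide_right_mono) auto
    also have "\<dots> \<le> c / sqrt \<delta>" using assms r by (intro divide_left_mono mult_pos_pos) auto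
    finally show "(T - \<bar>s\<bar>) / sqrt r \<le> c / sqrt \<delta>" .
  qed
  also have "\<dots> \<le> symm_tail n v \<delta> T k s"
    unfolding symm_tail_def r_def[symmetric] using gauss_tail_nonneg by (cases "s \<ge> 0") auto
  finally show ?thesis .
qed

lemma final_symm_tail_ge:
  assumes "0 < \<delta>" "T + c \<le> \<bar>s\<bar>"
  shows "gauss_tail (- c / sqrt \<delta>) \<le> symm_tail n v \<delta> T n s"
proof -
  have "gauss_tail (- c / sqrt \<delta>) \<le> gauss_tail ((T - \<bar>s\<bar>) / sqrt \<delta>)"
    using assms by (intro gauss_tail_antimono divide_right_mono) auto
  also have "\<dots> \<le> symm_tail n v \<delta> T n s"
    unfolding symm_tail_def using gauss_tail_nonneg by (cases "s \<ge> 0") auto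
  finally show ?thesis .
qed

text \<open>At the final time only the variance \<delta> is left, while a point of (-v, v) lies at
  least \<kappa> below the raised barrier. \<open>gauss_tail_shift\<close> turns this into a small
  factor in front of the same function with barrier v and extra variance 1, whose expectation is
  under control as well.\<close>

lemma final_symm_tail_le:
  assumes \<kappa>: "0 < \<kappa>" "0 < \<delta>" "\<delta> \<le> 1" and s: "\<bar>s\<bar> < v"
  shows "symm_tail n v \<delta> (v + \<kappa>) n s \<le> exp (- \<kappa>\<^sup>2 / (2 * \<delta>)) * symm_tail n v 1 v n s"
proof -
  have *: "gauss_tail ((z + \<kappa>) / sqrt \<delta>) \<le> exp (- \<kappa>\<^sup>2 / (2 * \<delta>)) * gauss_tail z" if "0 \<le> z" for z
  proof -
    have "gauss_tail ((z + \<kappa>) / sqrt \<delta>) = gauss_tail (z / sqrt \<delta> + \<kappa> / sqrt \<delta>)" by (simp add: add_divide_distrib)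
    also have "\<dots> \<le> exp (- (\<kappa> / sqrt \<delta>)\<^sup>2 / 2) * gauss_tail (z / sqrt \<delta>)" using that \<kappa> by (intro gauss_tail_shift) auto
    also have "(\<kappa> / sqrt \<delta>)\<^sup>2 = \<kappa>\<^sup>2 / \<delta>" using \<kappa> by (simp add: power_divide)
    also have "exp (- (\<kappa>\<^sup>2 / \<delta>) / 2) * gauss_tail (z / sqrt \<delta>) \<le> exp (- (\<kappa>\<^sup>2 / \<delta>) / 2) * gauss_tail z"
    proof (intro mult_left_mono gauss_tail_antimono)
      show "z \<le> z / sqrt \<delta>" using \<kappa> that mult_left_mono[of "sqrt \<delta>" 1 z] by (simp add: le_divide_eq)
    qed auto
    finally show ?thesis by (simp add: mult.commute)
  qed
  show ?thesis using *[of "v - s"] *[of "v + s"] s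
    by (simp add: symm_tail_def abs_less_iff algebra_simps)
qed

text \<open>At the exit the near barrier v + \<kappa> has not been passed, which gives at most Q(0)
  = 1/2; the far barrier is at distance at least 2v.\<close>

lemma symm_tail_exit_le:
  assumes \<kappa>: "0 < \<kappa>" "0 < \<delta>" and s: "v \<le> \<bar>s\<bar>" "\<bar>s\<bar> \<le> v + \<kappa>" and k: "k \<le> n"
  shows "symm_tail n v \<delta> (v + \<kappa>) k s \<le> 1 / 2 + gauss_tail (2 * v / sqrt (v + \<delta>))"
proof -
  define r where "r = \<delta> + v * (real n - real k) / real n"
  have r: "\<delta> \<le> r" using k v n unfolding r_def by (auto intro!: divide_nonneg_nonneg mult_nonneg_nonneg)
  have "v * (real n - real k) / real n \<le> v" using v n k by (simp add: divide_le_eq)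
  then have r': "r \<le> v + \<delta>" by (simp add: r_def)
  have 1: "gauss_tail ((v + \<kappa> - \<bar>s\<bar>) / sqrt r) \<le> 1 / 2"
    unfolding gauss_tail_0[symmetric] using s r \<kappa> by (intro gauss_tail_antimono) auto
  have 2: "gauss_tail ((v + \<kappa> + \<bar>s\<bar>) / sqrt r) \<le> gauss_tail (2 * v / sqrt (v + \<delta>))"
    using s r r' \<kappa> v by (intro gauss_tail_antimono frac_le) auto
  show ?thesis using 1 2 unfolding symm_tail_def r_def[symmetric] by (cases "0 \<le> s") auto
qed

text \<open>The barrier is lowered by \<kappa>: on the event the final value is at least Q(-\<kappa>
  / sqrt \<delta>), which is near 1 once sqrt \<delta> is small against \<kappa>.\<close>

lemma sum_tail_upper:
  assumes \<kappa>: "0 < \<kappa>" and \<delta>: "0 < \<delta>" "\<delta> \<le> 1" "v / n \<le> \<delta>"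
  shows "gauss_tail (- \<kappa> / sqrt \<delta>) * prob {\<omega>\<in>space M. v \<le> \<bar>W n \<omega>\<bar>}
    \<le> 2 * gauss_tail ((v - \<kappa>) / sqrt (v + \<delta>)) + md_const \<delta> * m * (exp (\<kappa> - v / 2) / sqrt v)"
proof -
  note [measurable] = W_measurable
  have "gauss_tail (- \<kappa> / sqrt \<delta>) * prob {\<omega>\<in>space M. v \<le> \<bar>W n \<omega>\<bar>}
     = expectation (\<lambda>\<omega>. gauss_tail (- \<kappa> / sqrt \<delta>) * indicator {\<omega>\<in>space M. v \<le> \<bar>W n \<omega>\<bar>} \<omega>)"
    using sum_event_integrable exit_event_integrable by simp
  also have "\<dots> \<le> expectation (stopped (symm_tail n v \<delta> (v - \<kappa>)) UNIV Z n)"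
    unfolding stopped_UNIV[abs_def]
  proof (rule integral_mono)
    show "integrable M (\<lambda>\<omega>. symm_tail n v \<delta> (v - \<kappa>) n (W n \<omega>))"
      using symm_tail_bounds by (intro integrable_const_bound[where B=2]) auto
  next
    fix \<omega>
    show "gauss_tail (- \<kappa> / sqrt \<delta>) * indicator {\<omega>\<in>space M. v \<le> \<bar>W n \<omega>\<bar>} \<omega> \<le> symm_tail n v \<delta> (v - \<kappa>) n (W n \<omega>)"
      using final_symm_tail_ge[OF \<delta>(1), of "v - \<kappa>" \<kappa> "W n \<omega>"] symm_tail_bounds[of n v \<delta> "v - \<kappa>" n "W n \<omega>"]
      by (auto simp: indicator_def)
  qed (auto intro!: sum_event_integrable exit_event_integrable integrable_mult_right)
  finally show ?thesis using symm_tail_expectation[OF \<delta>, of UNIV "v - \<kappa>"] by simp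
qed

text \<open>After the exit the path is on or beyond the barrier v, where the value is at least Q(0)
  = 1/2 whatever time remains. Dividing by this 1/2 produces 4 in place of 2.\<close>

lemma max_tail_upper:
  assumes \<delta>: "0 < \<delta>" "\<delta> \<le> 1" "v / n \<le> \<delta>"
  shows "prob {\<omega>\<in>space M. \<not> stays {-v<..<v} Z n \<omega>}
    \<le> 4 * gauss_tail (v / sqrt (v + \<delta>)) + 2 * md_const \<delta> * m * (exp (- v / 2) / sqrt v)"
proof -
  note [measurable] = W_measurable
  let ?D = "{-v<..<v}"
  have "1 / 2 * prob {\<omega>\<in>space M. \<not> stays ?D Z n \<omega>}
     = expectation (\<lambda>\<omega>. 1 / 2 * indicator {\<omega>\<in>space M. \<not> stays ?D Z n \<omega>} \<omega>)"
    using sum_event_integrable exit_event_integrable by simp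
  also have "\<dots> \<le> expectation (stopped (symm_tail n v \<delta> v) ?D Z n)"
  proof (rule integral_mono)
    show "integrable M (stopped (symm_tail n v \<delta> v) ?D Z n)"
      using symm_tail_bounds by (intro stopped_integrable integrable_const_bound[where B=2]) auto
  next
    fix \<omega>
    show "1 / 2 * indicator {\<omega>\<in>space M. \<not> stays ?D Z n \<omega>} \<omega> \<le> stopped (symm_tail n v \<delta> v) ?D Z n \<omega>"
    proof (cases "stays ?D Z n \<omega>")
      case True
      then show ?thesis using symm_tail_bounds by (auto simp: stopped_stays)
    next
      case False
      then obtain k where k: "k < n" "partial_sum Z (Suc k) \<omega> \<notin> ?D"
        "stopped (symm_tail n v \<delta> v) ?D Z n \<omega> = symm_tail n v \<delta> v (Suc k) (partial_sum Z (Suc k) \<omega>)"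
        using stopped_exit[OF False, of "symm_tail n v \<delta> v"] v by (metis greaterThanLessThan_iff neg_less_0_iff_less)
      have "gauss_tail (0 / sqrt \<delta>) \<le> symm_tail n v \<delta> v (Suc k) (partial_sum Z (Suc k) \<omega>)"
        using k \<delta> by (intro symm_tail_ge) auto
      then show ?thesis unfolding k(3) by (auto simp: gauss_tail_0 indicator_def)
    qed
  qed (auto intro!: sum_event_integrable exit_event_integrable integrable_mult_right)
  finally show ?thesis using symm_tail_expectation[OF \<delta>, of ?D v] by simp
qed

text \<open>The barrier is raised by \<kappa>: paths ending in (-v, v) contribute only the small
  fraction of \<open>final_symm_tail_le\<close>, all others at most 1 + Q(v).\<close>

lemma sum_tail_lower:
  assumes \<kappa>: "0 < \<kappa>" and \<delta>: "0 < \<delta>" "\<delta> \<le> 1" "v / n \<le> \<delta>"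
  shows "2 * gauss_tail ((v + \<kappa>) / sqrt (v + \<delta>)) \<le> (1 + gauss_tail v) * prob {\<omega>\<in>space M. v \<le> \<bar>W n \<omega>\<bar>}
    + exp (- \<kappa>\<^sup>2 / (2 * \<delta>)) * (2 * gauss_tail (v / sqrt (v + 1)) + md_const 1 * m * (exp (- v / 2) / sqrt v))
    + md_const \<delta> * m * (exp (- \<kappa> - v / 2) / sqrt v)"
proof -
  note [measurable] = W_measurable
  have diff_add_self: "v / 2 - (v + \<kappa>) = - \<kappa> - v / 2" by simp
  define \<rho> where "\<rho> = exp (- \<kappa>\<^sup>2 / (2 * \<delta>))"
  have \<rho>: "0 \<le> \<rho>" by (simp add: \<rho>_def)
  have i: "integrable M (\<lambda>\<omega>. symm_tail n v d T n (W n \<omega>))" for d T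
    using symm_tail_bounds by (intro integrable_const_bound[where B=2]) auto
  have "expectation (stopped (symm_tail n v \<delta> (v + \<kappa>)) UNIV Z n) \<le>
    expectation (\<lambda>\<omega>. (1 + gauss_tail v) * indicator {\<omega>\<in>space M. v \<le> \<bar>W n \<omega>\<bar>} \<omega> + \<rho> * symm_tail n v 1 v n (W n \<omega>))"
    unfolding stopped_UNIV[abs_def]
  proof (rule integral_mono)
    fix \<omega> assume \<omega>: "\<omega> \<in> space M"
    show "symm_tail n v \<delta> (v + \<kappa>) n (W n \<omega>) \<le> (1 + gauss_tail v) * indicator {\<omega>\<in>space M. v \<le> \<bar>W n \<omega>\<bar>} \<omega> + \<rho> * symm_tail n v 1 v n (W n \<omega>)"
    proof (cases "v \<le> \<bar>W n \<omega>\<bar>")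
      case True
      have le: "gauss_tail ((v + \<kappa> + \<bar>W n \<omega>\<bar>) / sqrt \<delta>) \<le> gauss_tail v"
      proof (rule gauss_tail_antimono)
        have "v \<le> v + \<kappa> + \<bar>W n \<omega>\<bar>" using \<kappa> by simp
        also have "\<dots> \<le> (v + \<kappa> + \<bar>W n \<omega>\<bar>) / sqrt \<delta>"
          using \<delta> \<kappa> v mult_left_mono[of "sqrt \<delta>" 1 "v + \<kappa> + \<bar>W n \<omega>\<bar>"] by (simp add: le_divide_eq)
        finally show "v \<le> (v + \<kappa> + \<bar>W n \<omega>\<bar>) / sqrt \<delta>" .
      qed
      have "symm_tail n v \<delta> (v + \<kappa>) n (W n \<omega>) = gauss_tail ((v + \<kappa> - \<bar>W n \<omega>\<bar>) / sqrt \<delta>) + gauss_tail ((v + \<kappa> + \<bar>W n \<omega>\<bar>) / sqrt \<delta>)"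
        by (cases "0 \<le> W n \<omega>") (simp_all add: symm_tail_def)
      also have "\<dots> \<le> 1 + gauss_tail v" by (intro add_mono le gauss_tail_le_1)
      finally show ?thesis using True \<omega> \<rho> symm_tail_bounds[of n v 1 v n "W n \<omega>"] by (simp add: add_increasing2)
    next
      case False
      then show ?thesis using final_symm_tail_le[OF \<kappa> \<delta>(1,2), of "W n \<omega>"] by (simp add: \<rho>_def)
    qed
  qed (auto intro!: i sum_event_integrable exit_event_integrable Bochner_Integration.integrable_add integrable_mult_right)
  also have "\<dots> = (1 + gauss_tail v) * prob {\<omega>\<in>space M. v \<le> \<bar>W n \<omega>\<bar>} + \<rho> * expectation (\<lambda>\<omega>. symm_tail n v 1 v n (W n \<omega>))"
    using i sum_event_integrable exit_event_integrable by (subst Bochner_Integration.integral_add) (auto intro!: sum_event_integrable exit_event_integrable integrable_mult_right)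
  also have "expectation (\<lambda>\<omega>. symm_tail n v 1 v n (W n \<omega>)) \<le> 2 * gauss_tail (v / sqrt (v + 1)) + md_const 1 * m * (exp (- v / 2) / sqrt v)"
    using symm_tail_expectation[of 1 UNIV v] \<delta> by (simp add: stopped_UNIV[abs_def])
  finally have "expectation (stopped (symm_tail n v \<delta> (v + \<kappa>)) UNIV Z n) \<le> (1 + gauss_tail v) * prob {\<omega>\<in>space M. v \<le> \<bar>W n \<omega>\<bar>} +
      \<rho> * (2 * gauss_tail (v / sqrt (v + 1)) + md_const 1 * m * (exp (- v / 2) / sqrt v))"
    using \<rho> by (simp add: mult_left_mono)
  then show ?thesis using symm_tail_expectation[OF \<delta>, of UNIV "v + \<kappa>", unfolded diff_add_self] by (simp add: \<rho>_def)
qed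

text \<open>The shift \<kappa> also bounds the overshoot of a single step, so an exiting path has
  not passed v + \<kappa> and its value exceeds 1/2 by at most the far tail.\<close>

lemma max_tail_lower:
  assumes \<kappa>: "0 < \<kappa>" "\<And>i \<omega>. \<bar>Z i \<omega>\<bar> \<le> \<kappa>" and \<delta>: "0 < \<delta>" "\<delta> \<le> 1" "v / n \<le> \<delta>"
  shows "2 * gauss_tail ((v + \<kappa>) / sqrt (v + \<delta>)) \<le> (1 / 2 + gauss_tail (2 * v / sqrt (v + \<delta>))) * prob {\<omega>\<in>space M. \<not> stays {-v<..<v} Z n \<omega>}
    + exp (- \<kappa>\<^sup>2 / (2 * \<delta>)) * (2 * gauss_tail (v / sqrt (v + 1)) + md_const 1 * m * (exp (- v / 2) / sqrt v))
    + md_const \<delta> * m * (exp (- \<kappa> - v / 2) / sqrt v)"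
proof -
  note [measurable] = W_measurable
  let ?D = "{-v<..<v}"
  have diff_add_self: "v / 2 - (v + \<kappa>) = - \<kappa> - v / 2" by simp
  define \<rho> where "\<rho> = exp (- \<kappa>\<^sup>2 / (2 * \<delta>))"
  define c where "c = 1 / 2 + gauss_tail (2 * v / sqrt (v + \<delta>))"
  have \<rho>: "0 \<le> \<rho>" by (simp add: \<rho>_def)
  have i: "integrable M (\<lambda>\<omega>. symm_tail n v d T k (W k \<omega>))" for d T k
    using symm_tail_bounds by (intro integrable_const_bound[where B=2]) auto
  have "expectation (stopped (symm_tail n v \<delta> (v + \<kappa>)) ?D Z n) \<le>
    expectation (\<lambda>\<omega>. c * indicator {\<omega>\<in>space M. \<not> stays ?D Z n \<omega>} \<omega> + \<rho> * symm_tail n v 1 v n (W n \<omega>))"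
  proof (rule integral_mono)
    fix \<omega> assume \<omega>: "\<omega> \<in> space M"
    show "stopped (symm_tail n v \<delta> (v + \<kappa>)) ?D Z n \<omega> \<le> c * indicator {\<omega>\<in>space M. \<not> stays ?D Z n \<omega>} \<omega> + \<rho> * symm_tail n v 1 v n (W n \<omega>)"
    proof (cases "stays ?D Z n \<omega>")
      case True
      then have "\<bar>W n \<omega>\<bar> < v" by (auto simp: stays_def abs_less_iff)
      with True show ?thesis using final_symm_tail_le[OF \<kappa>(1) \<delta>(1,2), of "W n \<omega>"] by (simp add: \<rho>_def stopped_stays)
    next
      case False
      then obtain k where k: "k < n" "stays ?D Z k \<omega>" "W (Suc k) \<omega> \<notin> ?D"
        "stopped (symm_tail n v \<delta> (v + \<kappa>)) ?D Z n \<omega> = symm_tail n v \<delta> (v + \<kappa>) (Suc k) (W (Suc k) \<omega>)"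
        using stopped_exit[OF False, of "symm_tail n v \<delta> (v + \<kappa>)"] v by (metis greaterThanLessThan_iff neg_less_0_iff_less)
      have "\<bar>W k \<omega>\<bar> < v" using k(2) by (auto simp: stays_def abs_less_iff)
      moreover have "W (Suc k) \<omega> = W k \<omega> + Z (Suc k) \<omega>" by (rule partial_sum_Suc)
      ultimately have "\<bar>W (Suc k) \<omega>\<bar> \<le> v + \<kappa>" using \<kappa>(2)[of "Suc k" \<omega>] by linarith
      moreover have "v \<le> \<bar>W (Suc k) \<omega>\<bar>" using k(3) by (auto simp: abs_if)
      ultimately have "symm_tail n v \<delta> (v + \<kappa>) (Suc k) (W (Suc k) \<omega>) \<le> c"
        unfolding c_def using k(1) by (intro symm_tail_exit_le \<kappa> \<delta>) auto
      then show ?thesis unfolding k(4) using False \<omega> \<rho> symm_tail_bounds[of n v 1 v n "W n \<omega>"] by (simp add: add_increasing2)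
    qed
  qed (auto intro!: i sum_event_integrable exit_event_integrable stopped_integrable Bochner_Integration.integrable_add integrable_mult_right)
  also have "\<dots> = c * prob {\<omega>\<in>space M. \<not> stays ?D Z n \<omega>} + \<rho> * expectation (\<lambda>\<omega>. symm_tail n v 1 v n (W n \<omega>))"
    using i sum_event_integrable exit_event_integrable by (subst Bochner_Integration.integral_add) (auto intro!: sum_event_integrable exit_event_integrable integrable_mult_right)
  also have "expectation (\<lambda>\<omega>. symm_tail n v 1 v n (W n \<omega>)) \<le> 2 * gauss_tail (v / sqrt (v + 1)) + md_const 1 * m * (exp (- v / 2) / sqrt v)"
    using symm_tail_expectation[of 1 UNIV v] \<delta> by (simp add: stopped_UNIV[abs_def])
  finally have "expectation (stopped (symm_tail n v \<delta> (v + \<kappa>)) ?D Z n) \<le> c * prob {\<omega>\<in>space M. \<not> stays ?D Z n \<omega>} +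
      \<rho> * (2 * gauss_tail (v / sqrt (v + 1)) + md_const 1 * m * (exp (- v / 2) / sqrt v))"
    using \<rho> by (simp add: mult_left_mono)
  then show ?thesis using symm_tail_expectation[OF \<delta>, of ?D "v + \<kappa>", unfolded diff_add_self] by (simp add: \<rho>_def c_def)
qed

end


text \<open>Relative to Q(x), each of the four estimates has a limit as x tends to infinity; it
  depends on \<kappa> and tends to 2 or 4 as \<kappa> tends to 0. Hence \<kappa> is fixed first, and
  then x0 and m0 in terms of \<kappa>, uniformly over all walks.\<close>

lemma moderate_deviation:
  assumes \<rho>: "0 < \<rho>"
  shows "\<exists>\<kappa> m0 x0. 0 < \<kappa> \<and> \<kappa> \<le> 1 \<and> 0 < m0 \<and> m0 \<le> 1 \<and> 1 \<le> x0 \<and>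
    (\<forall>(M :: 'a measure) Z n v m. small_walk M Z n v m \<longrightarrow> (\<forall>i \<omega>. \<bar>Z i \<omega>\<bar> \<le> \<kappa>) \<longrightarrow> m \<le> m0 \<longrightarrow> v / n \<le> m0 \<longrightarrow> x0 \<le> sqrt v \<longrightarrow>
      \<bar>measure M {\<omega>\<in>space M. v \<le> \<bar>partial_sum Z n \<omega>\<bar>} - 2 * gauss_tail (sqrt v)\<bar> \<le> \<rho> * gauss_tail (sqrt v) \<and>
      \<bar>measure M {\<omega>\<in>space M. \<not> stays {-v<..<v} Z n \<omega>} - 4 * gauss_tail (sqrt v)\<bar> \<le> \<rho> * gauss_tail (sqrt v))"
proof -
  \<comment> \<open>Throughout \<delta> = \<kappa>^3: the quotient \<kappa> / sqrt \<delta> =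
    \<kappa>^(-1/2) tends to infinity, so the smoothing factor \<open>s\<close> tends to 1 and the
    leakage factor \<open>\<rho>2\<close> to 0, although both shifts vanish.\<close>
  define s where "s = (\<lambda>\<kappa>. gauss_tail (- \<kappa> / sqrt (\<kappa> ^ 3)))"
  define \<rho>2 where "\<rho>2 = (\<lambda>\<kappa>::real. exp (- \<kappa>\<^sup>2 / (2 * \<kappa> ^ 3)))"
  \<comment> \<open>The limit of \<open>num\<close> below, in the form delivered by
    \<open>gauss_tail_perturb\<close>; the subtracted term is the leakage, with c = 0 and d =
    1.\<close>
  define L2 where "L2 = (\<lambda>\<kappa>. 2 * exp (- \<kappa> + \<kappa> ^ 3 / 2) - \<rho>2 \<kappa> * (2 * exp (- 0 + 1 / 2)))"
  have s_lim: "(s \<longlongrightarrow> 1) (at_right 0)"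
    unfolding s_def by (rule filterlim_compose[OF gauss_tail_at_bot]) real_asymp
  have \<rho>2_lim: "(\<rho>2 \<longlongrightarrow> 0) (at_right 0)"
    unfolding \<rho>2_def by real_asymp
  have e1: "((\<lambda>\<kappa>::real. exp (c * \<kappa> + \<kappa> ^ 3 / 2)) \<longlongrightarrow> exp (c * 0 + 0 ^ 3 / 2)) (at_right 0)" for c
    by (intro tendsto_intros) auto
  have l1: "((\<lambda>\<kappa>. 2 * exp (\<kappa> + \<kappa> ^ 3 / 2) / s \<kappa>) \<longlongrightarrow> 2 * 1 / 1) (at_right 0)"
    using e1[of 1] by (intro tendsto_intros s_lim) auto
  have l2: "(L2 \<longlongrightarrow> 2 * 1 - 0 * (2 * exp (- 0 + 1 / 2))) (at_right 0)"
    unfolding L2_def using e1[of "-1"] by (intro tendsto_intros \<rho>2_lim) auto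
  have l3: "((\<lambda>\<kappa>. 4 * exp (- 0 + \<kappa> ^ 3 / 2) :: real) \<longlongrightarrow> 4 * 1) (at_right 0)"
    using e1[of 0] by (intro tendsto_intros) auto
  \<comment> \<open>\<open>L2\<close> must come within \<rho>/4 of 2 because the estimate for the
    maximum divides it by 1/2.\<close>
  have "\<forall>\<^sub>F \<kappa> in at_right 0. 0 < \<kappa> \<and> \<kappa> < 1 \<and> 2 * exp (\<kappa> + \<kappa> ^ 3 / 2) / s \<kappa> < 2 + \<rho> / 2 \<and> L2 \<kappa> > 2 - \<rho> / 4 \<and>
      4 * exp (- 0 + \<kappa> ^ 3 / 2) < 4 + \<rho> / 2 \<and> 1 / 2 < s \<kappa>"
    using \<rho> by (intro eventually_conj order_tendstoD[OF l1] order_tendstoD[OF l2] order_tendstoD[OF l3] order_tendstoD[OF s_lim])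
      (auto simp: eventually_at_right_less eventually_at_right_field intro: exI[of _ 1])
  then obtain \<kappa> where \<kappa>: "0 < \<kappa>" "\<kappa> < 1" and
    L1: "2 * exp (\<kappa> + \<kappa> ^ 3 / 2) / s \<kappa> < 2 + \<rho> / 2" and L2: "L2 \<kappa> > 2 - \<rho> / 4" and L3: "4 * exp (- 0 + \<kappa> ^ 3 / 2) < 4 + \<rho> / 2"
    and s: "1 / 2 < s \<kappa>"
    by (auto dest: eventually_happens)
  define \<delta> where "\<delta> = \<kappa> ^ 3"
  have \<delta>: "0 < \<delta>" "\<delta> \<le> 1" using \<kappa> by (auto simp: \<delta>_def intro!: power_le_one)
  define num where "num = (\<lambda>x. 2 * (gauss_tail ((x\<^sup>2 + \<kappa>) / sqrt (x\<^sup>2 + \<delta>)) / gauss_tail x) - \<rho>2 \<kappa> * (2 * (gauss_tail ((x\<^sup>2 + 0) / sqrt (x\<^sup>2 + 1)) / gauss_tail x)))"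
  have num: "(num \<longlongrightarrow> L2 \<kappa>) at_top"
    unfolding num_def L2_def \<delta>_def[symmetric] using \<delta> by (intro tendsto_intros gauss_tail_perturb) auto
  have f1: "((\<lambda>x. 2 * (gauss_tail ((x\<^sup>2 + - \<kappa>) / sqrt (x\<^sup>2 + \<delta>)) / gauss_tail x) / s \<kappa>) \<longlongrightarrow> 2 * exp (- (- \<kappa>) + \<delta> / 2) / s \<kappa>) at_top"
    using \<delta> s by (intro tendsto_intros gauss_tail_perturb) auto
  have f2: "((\<lambda>x. num x / (1 + gauss_tail (x\<^sup>2))) \<longlongrightarrow> L2 \<kappa> / (1 + 0)) at_top"
    by (intro tendsto_intros num filterlim_compose[OF gauss_tail_at_top]) (real_asymp | simp)+
  have f3: "((\<lambda>x. 4 * (gauss_tail ((x\<^sup>2 + 0) / sqrt (x\<^sup>2 + \<delta>)) / gauss_tail x)) \<longlongrightarrow> 4 * exp (- 0 + \<delta> / 2)) at_top"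
    using \<delta> by (intro tendsto_intros gauss_tail_perturb) auto
  have f4: "((\<lambda>x. num x / (1 / 2 + gauss_tail (2 * x\<^sup>2 / sqrt (x\<^sup>2 + \<delta>)))) \<longlongrightarrow> L2 \<kappa> / (1 / 2 + 0)) at_top"
    using \<delta> by (intro tendsto_intros num filterlim_compose[OF gauss_tail_at_top]) (real_asymp | simp)+
  have "\<forall>\<^sub>F x in at_top. 1 \<le> x \<and> 2 * (gauss_tail ((x\<^sup>2 + - \<kappa>) / sqrt (x\<^sup>2 + \<delta>)) / gauss_tail x) / s \<kappa> < 2 + \<rho> / 2 \<and>
    2 - \<rho> / 2 < num x / (1 + gauss_tail (x\<^sup>2)) \<and> 4 * (gauss_tail ((x\<^sup>2 + 0) / sqrt (x\<^sup>2 + \<delta>)) / gauss_tail x) < 4 + \<rho> / 2 \<and>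
    4 - \<rho> / 2 < num x / (1 / 2 + gauss_tail (2 * x\<^sup>2 / sqrt (x\<^sup>2 + \<delta>)))"
    using L1 L2 L3 \<rho> unfolding \<delta>_def[symmetric]
    by (intro eventually_conj order_tendstoD[OF f1] order_tendstoD[OF f2] order_tendstoD[OF f3] order_tendstoD[OF f4] eventually_ge_at_top)
      auto
  then obtain x0 where x0: "\<And>x. x0 \<le> x \<Longrightarrow> 1 \<le> x \<and> 2 * (gauss_tail ((x\<^sup>2 + - \<kappa>) / sqrt (x\<^sup>2 + \<delta>)) / gauss_tail x) / s \<kappa> < 2 + \<rho> / 2 \<and>
    2 - \<rho> / 2 < num x / (1 + gauss_tail (x\<^sup>2)) \<and> 4 * (gauss_tail ((x\<^sup>2 + 0) / sqrt (x\<^sup>2 + \<delta>)) / gauss_tail x) < 4 + \<rho> / 2 \<and>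
    4 - \<rho> / 2 < num x / (1 / 2 + gauss_tail (2 * x\<^sup>2 / sqrt (x\<^sup>2 + \<delta>)))"
    by (auto simp: eventually_at_top_linorder)
  define B where "B = md_const 1 + exp 1 * md_const \<delta>"
  have md: "0 < md_const 1" "0 < md_const \<delta>" using md_const_pos \<delta> by auto
  have B: "0 < B" using md by (auto simp: B_def intro: add_pos_pos)
  \<comment> \<open>m0 <= \<delta> turns the hypothesis on v / n into v / n <= \<delta>. With the 8
    of \<open>exp_div_le_Q\<close>, the 32 B brings a remainder with constant B down to \<rho>/4
    times Q(x).\<close>
  define m0 where "m0 = min \<delta> (\<rho> / (32 * B))"
  have m0: "0 < m0" "m0 \<le> 1" "m0 \<le> \<delta>" using \<delta> \<rho> B by (auto simp: m0_def)
  have m0B: "16 * B * m0 \<le> \<rho> / 2"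
  proof -
    have "16 * B * m0 \<le> 16 * B * (\<rho> / (32 * B))" using B by (intro mult_left_mono) (auto simp: m0_def)
    then show ?thesis using B by simp
  qed
  show ?thesis
  proof (intro exI conjI allI impI)
    show "0 < \<kappa>" "\<kappa> \<le> 1" "0 < m0" "m0 \<le> 1" "1 \<le> max x0 1" using \<kappa> m0 by auto
    fix M :: "'a measure" and Z n v m
    assume "small_walk M Z n v m" and Z: "\<forall>i \<omega>. \<bar>Z i \<omega>\<bar> \<le> \<kappa>" and hm: "m \<le> m0" and hvn: "v / real n \<le> m0"
      and x0v: "max x0 1 \<le> sqrt v"
    interpret small_walk M Z n v m by fact
    define x where "x = sqrt v"
    have vx: "v = x\<^sup>2" using v by (simp add: x_def)
    have x: "1 \<le> x" "x0 \<le> x" using x0v by (auto simp: x_def)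
    define q where "q = gauss_tail x"
    have q: "0 < q" using x by (simp add: q_def gauss_tail_pos)
    define e where "e = exp (- v / 2) / sqrt v"
    have e: "0 \<le> e" "e \<le> 8 * q" using exp_div_le_Q[OF x(1)] v x by (auto simp: e_def q_def vx)
    have vn': "v / n \<le> \<delta>" using hvn m0 by simp
    note X = x0[OF x(2), folded vx q_def]
    have e1: "exp (\<kappa> - v / 2) / sqrt v \<le> exp 1 * e"
    proof -
      have "exp (\<kappa> - v / 2) \<le> exp (1 + - v / 2)" using \<kappa> by simp
      also have "\<dots> = exp 1 * exp (- v / 2)" by (rule exp_add)
      finally show ?thesis using v by (simp add: e_def divide_right_mono)
    qed
    have e2: "exp (- \<kappa> - v / 2) / sqrt v \<le> e"
      using \<kappa> v by (simp add: e_def divide_right_mono)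
    have err1: "md_const \<delta> * m * (exp (\<kappa> - v / 2) / sqrt v) \<le> \<rho> / 4 * q"
    proof -
      have "md_const \<delta> * m * (exp (\<kappa> - v / 2) / sqrt v) \<le> md_const \<delta> * m0 * (exp 1 * (8 * q))"
        using md hm m0 e1 e m(1) v by (intro mult_mono) (auto intro: order_trans[OF e1])
      also have "\<dots> = 8 * (exp 1 * md_const \<delta>) * m0 * q" by simp
      also have "\<dots> \<le> 8 * B * m0 * q" using md m0 q by (intro mult_right_mono) (auto simp: B_def)
      also have "\<dots> \<le> \<rho> / 4 * q" using m0B q by (intro mult_right_mono) auto
      finally show ?thesis .
    qed
    have exp1: "1 \<le> exp (1::real)" by simp
    have err2: "\<rho>2 \<kappa> * (md_const 1 * m * (exp (- v / 2) / sqrt v)) + md_const \<delta> * m * (exp (- \<kappa> - v / 2) / sqrt v) \<le> \<rho> / 4 * q"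
    proof -
      have "\<rho>2 \<kappa> * (md_const 1 * m * (exp (- v / 2) / sqrt v)) \<le> 1 * (md_const 1 * m * e)"
        unfolding e_def using md m(1) v \<kappa> by (intro mult_mono) (auto simp: \<rho>2_def)
      moreover have "md_const \<delta> * m * (exp (- \<kappa> - v / 2) / sqrt v) \<le> md_const \<delta> * m * e"
        using md m(1) e2 by (intro mult_left_mono) auto
      ultimately have "\<rho>2 \<kappa> * (md_const 1 * m * (exp (- v / 2) / sqrt v)) + md_const \<delta> * m * (exp (- \<kappa> - v / 2) / sqrt v) \<le> (md_const 1 + md_const \<delta>) * (m * e)"
        by (simp add: algebra_simps)
      also have "\<dots> \<le> B * (m0 * (8 * q))"
        using md hm m0 e m(1) B mult_right_mono[OF exp1, of "md_const \<delta>"] by (intro mult_mono) (auto simp: B_def)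
      also have "\<dots> = 8 * B * m0 * q" by simp
      also have "\<dots> \<le> \<rho> / 4 * q" using m0B q by (intro mult_right_mono) auto
      finally show ?thesis .
    qed
    let ?P1 = "measure M {\<omega>\<in>space M. v \<le> \<bar>W n \<omega>\<bar>}" and ?P2 = "measure M {\<omega>\<in>space M. \<not> stays {-v<..<v} Z n \<omega>}"
    have su: "s \<kappa> = gauss_tail (- \<kappa> / sqrt \<delta>)" and \<rho>2u: "\<rho>2 \<kappa> = exp (- \<kappa>\<^sup>2 / (2 * \<delta>))"
      by (simp_all add: s_def \<rho>2_def \<delta>_def)
    have numq: "num x * q = 2 * gauss_tail ((v + \<kappa>) / sqrt (v + \<delta>)) - \<rho>2 \<kappa> * (2 * gauss_tail (v / sqrt (v + 1)))"
      using q by (simp add: num_def q_def vx field_simps)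
    have a: "?P1 \<le> (2 + \<rho>) * q"
    proof -
      have "s \<kappa> * ?P1 \<le> 2 * gauss_tail ((v - \<kappa>) / sqrt (v + \<delta>)) + \<rho> / 4 * q"
        using sum_tail_upper[OF \<kappa>(1) \<delta> vn'] err1 unfolding su by linarith
      also have "2 * gauss_tail ((v - \<kappa>) / sqrt (v + \<delta>)) \<le> (2 + \<rho> / 2) * q * s \<kappa>"
        using X q s by (simp add: field_simps)
      also have "\<rho> / 4 * q \<le> \<rho> / 2 * q * s \<kappa>"
        using mult_left_mono[of "1 / 2" "s \<kappa>" "\<rho> / 2 * q"] s \<rho> q by simp
      finally have "s \<kappa> * ?P1 \<le> s \<kappa> * ((2 + \<rho>) * q)" by (simp add: algebra_simps)
      then show ?thesis using s by simp
    qed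
    have b: "(2 - \<rho>) * q \<le> ?P1"
    proof -
      have 1: "num x * q \<le> (1 + gauss_tail v) * ?P1 + \<rho> / 4 * q"
        using sum_tail_lower[OF \<kappa>(1) \<delta> vn'] err2 unfolding numq \<rho>2u distrib_left[of "exp (- \<kappa>\<^sup>2 / (2 * \<delta>))"] by linarith
      have c: "1 \<le> 1 + gauss_tail v" using gauss_tail_nonneg by simp
      have "(2 - \<rho> / 2) * (1 + gauss_tail v) * q \<le> num x * q"
        using X q c by (intro mult_right_mono) (simp_all add: pos_less_divide_eq)
      with 1 have "(2 - \<rho> / 2) * (1 + gauss_tail v) * q \<le> (1 + gauss_tail v) * ?P1 + \<rho> / 4 * q" by simp
      also have "\<rho> / 4 * q \<le> (1 + gauss_tail v) * (\<rho> / 2 * q)"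
        using mult_right_mono[OF c, of "\<rho> / 2 * q"] \<rho> q by simp
      finally have "(1 + gauss_tail v) * ((2 - \<rho>) * q) \<le> (1 + gauss_tail v) * ?P1" by (simp add: algebra_simps)
      then show ?thesis using c by simp
    qed
    have cc: "?P2 \<le> (4 + \<rho>) * q"
    proof -
      have "2 * md_const \<delta> * m * (exp (- v / 2) / sqrt v) \<le> \<rho> / 2 * q"
      proof -
        have "exp (- v / 2) / sqrt v \<le> exp (\<kappa> - v / 2) / sqrt v" using \<kappa> v by (intro divide_right_mono) auto
        then have "md_const \<delta> * m * (exp (- v / 2) / sqrt v) \<le> md_const \<delta> * m * (exp (\<kappa> - v / 2) / sqrt v)"
          using md m(1) by (intro mult_left_mono) auto
        then have "md_const \<delta> * m * (exp (- v / 2) / sqrt v) \<le> \<rho> / 4 * q" using err1 by (rule order_trans)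
        then have "2 * (md_const \<delta> * m * (exp (- v / 2) / sqrt v)) \<le> 2 * (\<rho> / 4 * q)" by (rule mult_left_mono) simp
        then show ?thesis by (simp add: mult.assoc)
      qed
      then have "?P2 \<le> 4 * gauss_tail (v / sqrt (v + \<delta>)) + \<rho> / 2 * q"
        using max_tail_upper[OF \<delta> vn'] by simp
      also have "4 * gauss_tail (v / sqrt (v + \<delta>)) \<le> (4 + \<rho> / 2) * q"
        using X q by (simp add: field_simps)
      finally show ?thesis by (simp add: algebra_simps)
    qed
    have d: "(4 - \<rho>) * q \<le> ?P2"
    proof -
      define c where "c = 1 / 2 + gauss_tail (2 * v / sqrt (v + \<delta>))"
      have 1: "num x * q \<le> c * ?P2 + \<rho> / 4 * q"
        using max_tail_lower[OF \<kappa>(1) Z[rule_format] \<delta> vn'] err2 unfolding numq \<rho>2u c_def distrib_left[of "exp (- \<kappa>\<^sup>2 / (2 * \<delta>))"] by linarith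
      have c: "1 / 2 \<le> c" using gauss_tail_nonneg by (simp add: c_def)
      have "(4 - \<rho> / 2) * c * q \<le> num x * q"
        using X q c unfolding c_def[symmetric] by (intro mult_right_mono) (simp_all add: pos_less_divide_eq)
      with 1 have "(4 - \<rho> / 2) * c * q \<le> c * ?P2 + \<rho> / 4 * q" by simp
      also have "\<rho> / 4 * q \<le> c * (\<rho> / 2 * q)"
        using mult_right_mono[OF c, of "\<rho> / 2 * q"] \<rho> q by simp
      finally have "c * ((4 - \<rho>) * q) \<le> c * ?P2" by (simp add: algebra_simps)
      then show ?thesis using c by simp
    qed
    show "\<bar>?P1 - 2 * gauss_tail (sqrt v)\<bar> \<le> \<rho> * gauss_tail (sqrt v)" "\<bar>?P2 - 4 * gauss_tail (sqrt v)\<bar> \<le> \<rho> * gauss_tail (sqrt v)"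
      using a b cc d unfolding x_def[symmetric] q_def[symmetric] by (simp_all add: abs_le_iff algebra_simps)
  qed
qed

section \<open>Truncation\<close>

lemma Lg_ge_1: "1 \<le> Lg x"
  unfolding Lg_def by (subst ln_ge_iff) (auto simp: less_max_iff_disj)

lemma LgLg_ge_1: "1 \<le> LgLg x"
  unfolding LgLg_def by (rule Lg_ge_1)

lemma Lg_pos [simp]: "0 < Lg x" using Lg_ge_1[of x] by simp
lemma LgLg_pos [simp]: "0 < LgLg x" using LgLg_ge_1[of x] by simp

lemma Lg_nonneg [simp]: "0 \<le> Lg x" using Lg_pos[of x] by linarith
lemma LgLg_nonneg [simp]: "0 \<le> LgLg x" using LgLg_pos[of x] by linarith

lemma Lg_mono: "x \<le> y \<Longrightarrow> Lg x \<le> Lg y"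
  unfolding Lg_def by (subst ln_le_cancel_iff) (auto simp: less_max_iff_disj intro: max.coboundedI1 max.coboundedI2)

lemma LgLg_mono: "x \<le> y \<Longrightarrow> LgLg x \<le> LgLg y"
  unfolding LgLg_def by (intro Lg_mono)

lemma Lg_measurable [measurable]: "Lg \<in> borel_measurable borel"
  unfolding Lg_def[abs_def] by measurable

lemma LgLg_measurable [measurable]: "LgLg \<in> borel_measurable borel"
  unfolding LgLg_def[abs_def] by measurable

lemma Lg_eq: "exp 1 \<le> x \<Longrightarrow> Lg x = ln x"
  by (simp add: Lg_def max_def)

lemma eventually_Lg_eq: "\<forall>\<^sub>F x in at_top. Lg x = ln x"
  using eventually_ge_at_top[of "exp 1"] by eventually_elim (rule Lg_eq)

lemma eventually_LgLg_eq: "\<forall>\<^sub>F x in at_top. LgLg x = ln (ln x)"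
proof -
  have "\<forall>\<^sub>F x::real in at_top. exp 1 \<le> ln x" by real_asymp
  then show ?thesis using eventually_Lg_eq
    by eventually_elim (simp add: LgLg_def Lg_eq)
qed

lemma eventually_Lg_nat: "\<forall>\<^sub>F n in sequentially. Lg (real n) = ln (real n)"
  by (rule eventually_compose_filterlim[OF eventually_Lg_eq filterlim_real_sequentially])

lemma eventually_LgLg_nat: "\<forall>\<^sub>F n in sequentially. LgLg (real n) = ln (ln (real n))"
  by (rule eventually_compose_filterlim[OF eventually_LgLg_eq filterlim_real_sequentially])

text \<open>A fixed power is hardly visible to log log: ln (ln (x^(1/4))) = ln (ln x) - ln 4. Tail
  moments can thus be evaluated at n^(1/4), which is eventually below every truncation
  level.\<close>

lemma eventually_LgLg_root: "\<forall>\<^sub>F x in at_top. LgLg x \<le> 2 * LgLg (x powr (1/4))"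
proof -
  have "filterlim (\<lambda>x::real. x powr (1/4)) at_top at_top" by real_asymp
  from eventually_compose_filterlim[OF eventually_LgLg_eq this]
  have "\<forall>\<^sub>F x::real in at_top. LgLg (x powr (1/4)) = ln (ln (x powr (1/4)))" .
  moreover have "\<forall>\<^sub>F x::real in at_top. ln (ln x) \<le> 2 * ln (ln (x powr (1/4)))" by real_asymp
  ultimately show ?thesis using eventually_LgLg_eq by eventually_elim simp
qed

definition trunc :: "real \<Rightarrow> real \<Rightarrow> real" where
  "trunc c x = (if \<bar>x\<bar> < c then x else 0)"

lemma trunc_measurable [measurable]: "trunc c \<in> borel_measurable borel"
  unfolding trunc_def[abs_def] by measurable

lemma abs_trunc_le: "0 \<le> c \<Longrightarrow> \<bar>trunc c x\<bar> \<le> c"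
  by (simp add: trunc_def)

definition level :: "real \<Rightarrow> nat \<Rightarrow> real" where
  "level \<kappa> n = \<kappa> * sqrt (real n / LgLg (real n))"

lemma level_nonneg: "0 \<le> \<kappa> \<Longrightarrow> 0 \<le> level \<kappa> n"
  using LgLg_pos[of "real n"] unfolding level_def
  by (intro mult_nonneg_nonneg real_sqrt_ge_zero divide_nonneg_nonneg) (auto intro: less_imp_le)

lemma level_pos: "0 < \<kappa> \<Longrightarrow> 0 < n \<Longrightarrow> 0 < level \<kappa> n"
  by (simp add: level_def)

lemma eventually_level_ge:
  assumes "0 < \<kappa>" shows "\<forall>\<^sub>F n in sequentially. real n powr (1/4) \<le> level \<kappa> n"
proof -
  have "\<forall>\<^sub>F n in sequentially. real n powr (1/4) \<le> \<kappa> * sqrt (real n / ln (ln (real n)))"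
    using assms by real_asymp
  then show ?thesis using eventually_LgLg_nat by eventually_elim (simp add: level_def)
qed

text \<open>An exponential maximal inequality from the stopping lemma. The factor \<Lambda>^(n-k) in
  \<open>F\<close> allows for the growth still to come and makes \<open>F\<close> a supermartingale;
  since \<Lambda> >= 1, \<open>F\<close> is at least 1 at the first passage of t.\<close>

lemma (in prob_space) max_chernoff:
  assumes ind: "indep_vars (\<lambda>_. borel) Z UNIV" and Z1: "\<And>i \<omega>. \<bar>Z i \<omega>\<bar> \<le> 1"
    and le: "\<And>i. expectation (\<lambda>\<omega>. exp (Z i \<omega>)) \<le> \<Lambda>" and \<Lambda>: "1 \<le> \<Lambda>" and t: "0 < t"
  shows "prob {\<omega>\<in>space M. \<exists>k\<le>n. t \<le> partial_sum Z k \<omega>} \<le> exp (- t) * \<Lambda> ^ n"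
proof -
  have [measurable]: "Z i \<in> borel_measurable M" for i using ind by (auto simp: indep_vars_def2)
  define F where "F = (\<lambda>k s. exp (s - t) * \<Lambda> ^ (n - k))"
  have [measurable]: "F k \<in> borel_measurable borel" for k unfolding F_def by measurable
  have F_eq: "F k s = exp (- t) * \<Lambda> ^ (n - k) * exp s" for k s
    by (simp add: F_def exp_diff exp_minus field_simps)
  have iF: "integrable M (\<lambda>\<omega>. F k (partial_sum Z k \<omega>))" for k
    unfolding F_eq by (intro integrable_mult_right walk_mgf(2)[OF ind Z1 le])
  let ?D = "{..<t}"
  have "prob {\<omega>\<in>space M. \<exists>k\<le>n. t \<le> partial_sum Z k \<omega>} = expectation (indicator {\<omega>\<in>space M. \<exists>k\<le>n. t \<le> partial_sum Z k \<omega>})"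
    by simp
  also have "\<dots> \<le> expectation (stopped F ?D Z n)"
  proof (rule integral_mono)
    have [measurable]: "partial_sum Z k \<in> borel_measurable M" for k by measurable
    show "integrable M (indicator {\<omega>\<in>space M. \<exists>k\<le>n. t \<le> partial_sum Z k \<omega>} :: 'a \<Rightarrow> real)"
      by (intro integrable_indicator_event) measurable
    show "integrable M (stopped F ?D Z n)" by (intro stopped_integrable iF) auto
    fix \<omega>
    show "indicator {\<omega>\<in>space M. \<exists>k\<le>n. t \<le> partial_sum Z k \<omega>} \<omega> \<le> stopped F ?D Z n \<omega>"
    proof (cases "stays ?D Z n \<omega>")
      case True
      then have "\<not> (\<exists>k\<le>n. t \<le> partial_sum Z k \<omega>)" by (auto simp: stays_def not_le)
      moreover have "0 \<le> F n s" for s using \<Lambda> by (simp add: F_def)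
      ultimately show ?thesis using True by (simp add: stopped_stays)
    next
      case False
      moreover have "0 \<in> ?D" using t by simp
      ultimately obtain k where k: "k < n" "partial_sum Z (Suc k) \<omega> \<notin> ?D"
        "stopped F ?D Z n \<omega> = F (Suc k) (partial_sum Z (Suc k) \<omega>)"
        using stopped_exit[of ?D Z n \<omega> F] by metis
      have "1 * 1 \<le> F (Suc k) (partial_sum Z (Suc k) \<omega>)"
        unfolding F_def using k(2) \<Lambda> by (intro mult_mono one_le_power) auto
      then show ?thesis unfolding k(3) by (simp add: indicator_def)
    qed
  qed
  also have "\<dots> \<le> F 0 0 + (\<Sum>k<n. expectation (\<lambda>\<omega>. (\<lambda>_ _. 0) k (partial_sum Z k \<omega>)))"
  proof (rule stopped_expectation_le[OF ind])
    fix k s assume k: "k < n"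
    have "expectation (\<lambda>\<omega>. F (Suc k) (s + Z (Suc k) \<omega>)) = F (Suc k) s * expectation (\<lambda>\<omega>. exp (Z (Suc k) \<omega>))"
      unfolding F_def by (subst integral_mult_right_zero[symmetric]) (simp add: exp_add exp_diff mult_ac)
    also have "\<dots> \<le> F (Suc k) s * \<Lambda>" using le[of "Suc k"] \<Lambda> by (intro mult_left_mono) (auto simp: F_def)
    also have "\<dots> = F k s" using k Suc_diff_Suc[of k n] by (simp add: F_def flip: power_Suc2)
    finally show "expectation (\<lambda>\<omega>. F (Suc k) (s + Z (Suc k) \<omega>)) \<le> F k s + 0" by simp
  qed (use iF in auto)
  finally show ?thesis by (simp add: F_def)
qed

lemma (in small_walk) mgf1: "expectation (\<lambda>\<omega>. exp (Z i \<omega>)) \<le> exp (v / (2 * n) + 3 * m / n)"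
proof -
  have "expectation (\<lambda>\<omega>. exp (Z i \<omega>)) \<le> exp ((v / n) / 2 + 3 * (m / n))"
    using mean[of i] var[of i] third[of i] by (intro exp_moment_le Z1) (auto simp: abs_le_iff)
  then show ?thesis by (simp add: mult.commute)
qed

text \<open>Partial sums start at index 1; \<open>X 0\<close> is the reference copy on which all
  moment conditions are stated.\<close>

locale iid_walk = prob_space +
  fixes X :: "nat \<Rightarrow> 'a \<Rightarrow> real" and \<sigma> :: real
  assumes meas [measurable]: "\<And>n. X n \<in> borel_measurable M"
    and indep: "indep_vars (\<lambda>_. borel) X UNIV"
    and ident: "\<And>n. distr M borel (X n) = distr M borel (X 0)"
    and int2: "integrable M (\<lambda>\<omega>. (X 0 \<omega>)\<^sup>2)"
    and mean0: "(\<integral>\<omega>. X 0 \<omega> \<partial>M) = 0"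
    and sigma: "\<sigma> = sqrt (\<integral>\<omega>. (X 0 \<omega>)\<^sup>2 \<partial>M)"
    and sigma_pos: "0 < \<sigma>"
    and tail: "((\<lambda>t. (\<integral>\<omega>. (if t \<le> \<bar>X 0 \<omega>\<bar> then (X 0 \<omega>)\<^sup>2 else 0) \<partial>M) * LgLg t) \<longlongrightarrow> 0) at_top"
begin

definition tail_moment :: "real \<Rightarrow> real" where
  "tail_moment t = (\<integral>\<omega>. (if t \<le> \<bar>X 0 \<omega>\<bar> then (X 0 \<omega>)\<^sup>2 else 0) \<partial>M)"

lemma expectation_ident:
  fixes f :: "real \<Rightarrow> real"
  assumes [measurable]: "f \<in> borel_measurable borel"
  shows "expectation (\<lambda>\<omega>. f (X i \<omega>)) = expectation (\<lambda>\<omega>. f (X 0 \<omega>))"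
proof -
  have "expectation (\<lambda>\<omega>. f (X j \<omega>)) = (\<integral>x. f x \<partial>distr M borel (X j))" for j
    by (subst integral_distr) auto
  then show ?thesis using ident[of i] by simp
qed

lemma prob_ident:
  assumes [measurable]: "A \<in> sets borel"
  shows "prob {\<omega>\<in>space M. X i \<omega> \<in> A} = prob {\<omega>\<in>space M. X 0 \<omega> \<in> A}"
proof -
  have "prob {\<omega>\<in>space M. X j \<omega> \<in> A} = measure (distr M borel (X j)) A" for j
    by (subst measure_distr) (auto intro!: arg_cong[where f=prob])
  then show ?thesis using ident[of i] by simp
qed

lemma second_moment: "expectation (\<lambda>\<omega>. (X 0 \<omega>)\<^sup>2) = \<sigma>\<^sup>2"
  unfolding sigma by (simp add: integral_nonneg)

lemma integrable_le_square:
  fixes f :: "real \<Rightarrow> real"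
  assumes [measurable]: "f \<in> borel_measurable borel" and "\<And>x. \<bar>f x\<bar> \<le> C * x\<^sup>2"
  shows "integrable M (\<lambda>\<omega>. f (X 0 \<omega>))"
proof (rule Bochner_Integration.integrable_bound)
  show "integrable M (\<lambda>\<omega>. C * (X 0 \<omega>)\<^sup>2)" using int2 by simp
  show "AE \<omega> in M. norm (f (X 0 \<omega>)) \<le> norm (C * (X 0 \<omega>)\<^sup>2)"
    using assms(2) by (intro AE_I2) (metis abs_ge_self order_trans real_norm_def)
qed simp

lemma integrable_X: "integrable M (X 0)"
proof (rule Bochner_Integration.integrable_bound)
  show "integrable M (\<lambda>\<omega>. 1 + (X 0 \<omega>)\<^sup>2)" using int2 by simp
  have "\<bar>x\<bar> \<le> 1 + x\<^sup>2" for x :: real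
  proof -
    have "0 \<le> (\<bar>x\<bar> - 1)\<^sup>2" by simp
    then show ?thesis by (simp add: power2_diff)
  qed
  then show "AE \<omega> in M. norm (X 0 \<omega>) \<le> norm (1 + (X 0 \<omega>)\<^sup>2)"
    by (intro AE_I2) (auto intro: order_trans)
qed simp

lemma tail_moment_integrable: "integrable M (\<lambda>\<omega>. if t \<le> \<bar>X 0 \<omega>\<bar> then (X 0 \<omega>)\<^sup>2 else 0)"
  by (rule integrable_le_square[of _ 1]) auto

lemma tail_moment_nonneg: "0 \<le> tail_moment t"
  unfolding tail_moment_def by (rule Bochner_Integration.integral_nonneg) auto

lemma tail_moment_antimono: "s \<le> t \<Longrightarrow> tail_moment t \<le> tail_moment s"
  unfolding tail_moment_def by (intro integral_mono tail_moment_integrable) auto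

lemma tail_moment_LgLg_lim: "(\<lambda>n. tail_moment (real n powr (1/4)) * LgLg (real n)) \<longlonglongrightarrow> 0"
proof -
  have top: "filterlim (\<lambda>n. real n powr (1/4)) at_top sequentially" by real_asymp
  have "(\<lambda>n. tail_moment (real n powr (1/4)) * LgLg (real n powr (1/4))) \<longlonglongrightarrow> 0"
    using filterlim_compose[OF tail top] by (simp add: tail_moment_def)
  from tendsto_mult_right_zero[OF this, of 2]
  have lim: "(\<lambda>n. 2 * (tail_moment (real n powr (1/4)) * LgLg (real n powr (1/4)))) \<longlonglongrightarrow> 0" .
  show ?thesis
  proof (rule Lim_null_comparison[OF _ lim])
    show "\<forall>\<^sub>F n in sequentially. norm (tail_moment (real n powr (1/4)) * LgLg (real n)) \<le> 2 * (tail_moment (real n powr (1/4)) * LgLg (real n powr (1/4)))"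
      using eventually_compose_filterlim[OF eventually_LgLg_root filterlim_real_sequentially]
    proof eventually_elim
      case (elim n)
      then have "tail_moment (real n powr (1/4)) * LgLg (real n) \<le> tail_moment (real n powr (1/4)) * (2 * LgLg (real n powr (1/4)))"
        by (intro mult_left_mono tail_moment_nonneg)
      then show ?case using tail_moment_nonneg LgLg_pos[of "real n"] by (simp add: abs_mult abs_of_pos mult_ac)
    qed
  qed
qed

text \<open>As the mean is 0, the truncated mean is minus the mean of the part beyond c, where |X|
  <= X^2 / c.\<close>

lemma trunc_mean: "0 < c \<Longrightarrow> \<bar>expectation (\<lambda>\<omega>. trunc c (X i \<omega>))\<bar> \<le> tail_moment c / c"
proof -
  assume c: "0 < c"
  have "expectation (\<lambda>\<omega>. trunc c (X i \<omega>)) = expectation (\<lambda>\<omega>. trunc c (X 0 \<omega>))"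
    by (rule expectation_ident) simp
  also have "\<dots> = expectation (\<lambda>\<omega>. X 0 \<omega> - (if c \<le> \<bar>X 0 \<omega>\<bar> then X 0 \<omega> else 0))"
    by (intro Bochner_Integration.integral_cong) (auto simp: trunc_def)
  also have "\<dots> = - expectation (\<lambda>\<omega>. if c \<le> \<bar>X 0 \<omega>\<bar> then X 0 \<omega> else 0)"
    using integrable_X mean0 by (subst Bochner_Integration.integral_diff)
      (auto intro!: Bochner_Integration.integrable_bound[OF integrable_X])
  finally have "\<bar>expectation (\<lambda>\<omega>. trunc c (X i \<omega>))\<bar> \<le> expectation (\<lambda>\<omega>. \<bar>if c \<le> \<bar>X 0 \<omega>\<bar> then X 0 \<omega> else 0\<bar>)"
    using integral_abs_bound[of M "\<lambda>\<omega>. if c \<le> \<bar>X 0 \<omega>\<bar> then X 0 \<omega> else 0"] by simp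
  also have "\<dots> \<le> expectation (\<lambda>\<omega>. (if c \<le> \<bar>X 0 \<omega>\<bar> then (X 0 \<omega>)\<^sup>2 else 0) / c)"
  proof (rule integral_mono)
    show "integrable M (\<lambda>\<omega>. \<bar>if c \<le> \<bar>X 0 \<omega>\<bar> then X 0 \<omega> else 0\<bar>)"
      by (intro integrable_abs) (auto intro!: Bochner_Integration.integrable_bound[OF integrable_X])
    show "integrable M (\<lambda>\<omega>. (if c \<le> \<bar>X 0 \<omega>\<bar> then (X 0 \<omega>)\<^sup>2 else 0) / c)" using tail_moment_integrable by simp
    fix \<omega>
    show "\<bar>if c \<le> \<bar>X 0 \<omega>\<bar> then X 0 \<omega> else 0\<bar> \<le> (if c \<le> \<bar>X 0 \<omega>\<bar> then (X 0 \<omega>)\<^sup>2 else 0) / c"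
    proof (cases "c \<le> \<bar>X 0 \<omega>\<bar>")
      case True
      then have "\<bar>X 0 \<omega>\<bar> * c \<le> \<bar>X 0 \<omega>\<bar> * \<bar>X 0 \<omega>\<bar>" by (intro mult_left_mono) auto
      then show ?thesis using True c by (simp add: pos_le_divide_eq power2_eq_square)
    qed simp
  qed
  finally show ?thesis by (simp add: tail_moment_def)
qed

lemma trunc_second: "expectation (\<lambda>\<omega>. (trunc c (X i \<omega>))\<^sup>2) = \<sigma>\<^sup>2 - tail_moment c"
proof -
  have "expectation (\<lambda>\<omega>. (trunc c (X i \<omega>))\<^sup>2) = expectation (\<lambda>\<omega>. (trunc c (X 0 \<omega>))\<^sup>2)"
    by (rule expectation_ident) simp
  also have "\<dots> = expectation (\<lambda>\<omega>. (X 0 \<omega>)\<^sup>2 - (if c \<le> \<bar>X 0 \<omega>\<bar> then (X 0 \<omega>)\<^sup>2 else 0))"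
    by (intro Bochner_Integration.integral_cong) (auto simp: trunc_def)
  also have "\<dots> = \<sigma>\<^sup>2 - tail_moment c"
    unfolding tail_moment_def using tail_moment_integrable int2 second_moment by (subst Bochner_Integration.integral_diff) auto
  finally show ?thesis .
qed

text \<open>A second cut at d: below it |X|^3 <= d X^2, above it the truncated variable is at most c
  and only the tail moment enters. The plain bound c \<sigma>^2 would, after scaling and over n
  steps, leave an error of order log log n.\<close>

lemma trunc_third:
  assumes "0 \<le> c" "0 \<le> d"
  shows "expectation (\<lambda>\<omega>. \<bar>trunc c (X i \<omega>)\<bar> ^ 3) \<le> d * \<sigma>\<^sup>2 + c * tail_moment d"
proof -
  have "expectation (\<lambda>\<omega>. \<bar>trunc c (X i \<omega>)\<bar> ^ 3) = expectation (\<lambda>\<omega>. \<bar>trunc c (X 0 \<omega>)\<bar> ^ 3)"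
    by (rule expectation_ident) simp
  also have "\<dots> \<le> expectation (\<lambda>\<omega>. d * (X 0 \<omega>)\<^sup>2 + c * (if d \<le> \<bar>X 0 \<omega>\<bar> then (X 0 \<omega>)\<^sup>2 else 0))"
  proof (rule integral_mono)
    have *: "\<bar>trunc c x\<bar> ^ 3 \<le> c * x\<^sup>2" for x
    proof -
      have "\<bar>trunc c x\<bar> ^ 3 = \<bar>trunc c x\<bar> * (trunc c x)\<^sup>2" by (simp add: power3_eq_cube power2_eq_square abs_mult)
      also have "\<dots> \<le> c * x\<^sup>2" using assms by (intro mult_mono abs_trunc_le) (auto simp: trunc_def)
      finally show ?thesis .
    qed
    then show "integrable M (\<lambda>\<omega>. \<bar>trunc c (X 0 \<omega>)\<bar> ^ 3)" by (intro integrable_le_square[of _ c]) auto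
    show "integrable M (\<lambda>\<omega>. d * (X 0 \<omega>)\<^sup>2 + c * (if d \<le> \<bar>X 0 \<omega>\<bar> then (X 0 \<omega>)\<^sup>2 else 0))"
      using int2 tail_moment_integrable by simp
    fix \<omega>
    show "\<bar>trunc c (X 0 \<omega>)\<bar> ^ 3 \<le> d * (X 0 \<omega>)\<^sup>2 + c * (if d \<le> \<bar>X 0 \<omega>\<bar> then (X 0 \<omega>)\<^sup>2 else 0)"
    proof (cases "d \<le> \<bar>X 0 \<omega>\<bar>")
      case True
      then show ?thesis using *[of "X 0 \<omega>"] assms by (simp add: add_increasing)
    next
      case False
      have "\<bar>trunc c (X 0 \<omega>)\<bar> ^ 3 \<le> \<bar>X 0 \<omega>\<bar> ^ 3" by (intro power_mono) (auto simp: trunc_def)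
      also have "\<dots> = \<bar>X 0 \<omega>\<bar> * (X 0 \<omega>)\<^sup>2" by (simp add: power3_eq_cube power2_eq_square abs_mult)
      also have "\<dots> \<le> d * (X 0 \<omega>)\<^sup>2" using False by (intro mult_right_mono) auto
      finally show ?thesis using False by simp
    qed
  qed
  also have "\<dots> = d * \<sigma>\<^sup>2 + c * tail_moment d"
    using int2 tail_moment_integrable by (simp add: tail_moment_def second_moment)
  finally show ?thesis .
qed

text \<open>The factor x turns the event |sum| >= \<sigma> sqrt n x into |walk| >= x^2 and makes x^2
  the variance. For x of order sqrt (log log n) the truncation level becomes a bound of order
  \<kappa> on the increments.\<close>

definition scaled :: "real \<Rightarrow> nat \<Rightarrow> real \<Rightarrow> nat \<Rightarrow> 'a \<Rightarrow> real" where
  "scaled \<kappa> n x i \<omega> = x / (\<sigma> * sqrt n) * trunc (level \<kappa> n) (X i \<omega>)"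

text \<open>The budget of \<open>small_walk\<close> for x <= c sqrt (log log n). The bracket
  collects mean, variance and the third moment above n^(1/4); the other two summands are the third
  moment below n^(1/4) and the term (v / n)^2.\<close>

definition err :: "real \<Rightarrow> real \<Rightarrow> nat \<Rightarrow> real" where
  "err \<kappa> c n = (c / (\<sigma> * \<kappa>) + c\<^sup>2 / \<sigma>\<^sup>2 + c ^ 3 * \<kappa> / \<sigma> ^ 3) * (tail_moment (real n powr (1/4)) * LgLg (real n))
      + c ^ 3 / \<sigma> * (LgLg (real n) * sqrt (LgLg (real n)) * real n powr (-1/4)) + c ^ 4 * ((LgLg (real n))\<^sup>2 / n)"

lemma err_lim: "err \<kappa> c \<longlonglongrightarrow> 0"
proof -
  have "(\<lambda>n. LgLg (real n) * sqrt (LgLg (real n)) * real n powr (-1/4)) \<longlonglongrightarrow> 0"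
  proof (rule Lim_transform_eventually)
    show "(\<lambda>n. ln (ln (real n)) * sqrt (ln (ln (real n))) * real n powr (-1/4)) \<longlonglongrightarrow> 0" by real_asymp
    show "\<forall>\<^sub>F n in sequentially. ln (ln (real n)) * sqrt (ln (ln (real n))) * real n powr (-1/4) = LgLg (real n) * sqrt (LgLg (real n)) * real n powr (-1/4)"
      using eventually_LgLg_nat by eventually_elim simp
  qed
  moreover have "(\<lambda>n. (LgLg (real n))\<^sup>2 / n) \<longlonglongrightarrow> 0"
  proof (rule Lim_transform_eventually)
    show "(\<lambda>n. (ln (ln (real n)))\<^sup>2 / n) \<longlonglongrightarrow> 0" by real_asymp
    show "\<forall>\<^sub>F n in sequentially. (ln (ln (real n)))\<^sup>2 / n = (LgLg (real n))\<^sup>2 / n"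
      using eventually_LgLg_nat by eventually_elim simp
  qed
  ultimately have "(\<lambda>n. err \<kappa> c n) \<longlonglongrightarrow> (c / (\<sigma> * \<kappa>) + c\<^sup>2 / \<sigma>\<^sup>2 + c ^ 3 * \<kappa> / \<sigma> ^ 3) * 0 + c ^ 3 / \<sigma> * 0 + c ^ 4 * 0"
    unfolding err_def by (intro tendsto_intros tail_moment_LgLg_lim)
  then show ?thesis by simp
qed

lemma scaled_bound:
  assumes "0 < \<kappa>" "0 < n" "0 < x" "x \<le> c * sqrt (LgLg (real n))"
  shows "\<bar>scaled \<kappa> n x i \<omega>\<bar> \<le> c * \<kappa> / \<sigma>"
proof -
  have "\<bar>scaled \<kappa> n x i \<omega>\<bar> = x / (\<sigma> * sqrt n) * \<bar>trunc (level \<kappa> n) (X i \<omega>)\<bar>"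
    using assms sigma_pos by (simp add: scaled_def abs_mult)
  also have "\<dots> \<le> (c * sqrt (LgLg (real n))) / (\<sigma> * sqrt n) * level \<kappa> n"
    using assms sigma_pos by (intro mult_mono divide_right_mono abs_trunc_le level_nonneg) auto
  also have "\<dots> = c * \<kappa> / \<sigma>"
    using assms less_imp_neq[OF LgLg_pos[of "real n"]] by (simp add: level_def real_sqrt_divide)
  finally show ?thesis .
qed

text \<open>Uniformity in x is the point, since later x depends on \<epsilon> as well as on n. Every
  error is bounded at the largest admissible x, which gives \<open>err\<close>.\<close>

lemma scaled_small_walk:
  assumes \<kappa>: "0 < \<kappa>" "c * \<kappa> / \<sigma> \<le> 1" and c: "0 < c"
  shows "\<forall>\<^sub>F n in sequentially. \<forall>x. 0 < x \<and> x \<le> c * sqrt (LgLg (real n)) \<longrightarrow> small_walk M (scaled \<kappa> n x) n (x\<^sup>2) (err \<kappa> c n)"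
proof -
  have "\<forall>\<^sub>F n in sequentially. err \<kappa> c n < 1" using order_tendstoD(2)[OF err_lim] by auto
  then show ?thesis using eventually_level_ge[OF \<kappa>(1)] eventually_gt_at_top[of 0]
  proof eventually_elim
    case (elim n)
    define L where "L = LgLg (real n)"
    define h where "h x = x / (\<sigma> * sqrt n)" for x
    define lv where "lv = level \<kappa> n"
    define r where "r = real n powr (1/4)"
    have L: "0 < L" by (simp add: L_def)
    have n: "0 < real n" using elim by simp
    have lv: "0 < lv" "r \<le> lv" using elim level_pos[OF \<kappa>(1)] by (auto simp: lv_def r_def)
    have Vlv: "tail_moment lv \<le> tail_moment r" using lv by (intro tail_moment_antimono)
    have V0: "0 \<le> tail_moment r" "0 \<le> tail_moment lv" by (rule tail_moment_nonneg)+
    define e1 where "e1 = tail_moment r * L"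
    define e2 where "e2 = L * sqrt L * real n powr (-1/4)"
    define e3 where "e3 = L\<^sup>2 / n"
    have e0: "0 \<le> e1" "0 \<le> e2" "0 \<le> e3" using L V0 n by (auto simp: e1_def e2_def e3_def)
    have coef: "0 \<le> c / (\<sigma> * \<kappa>)" "0 \<le> c\<^sup>2 / \<sigma>\<^sup>2" "0 \<le> c ^ 3 * \<kappa> / \<sigma> ^ 3" "0 \<le> c ^ 3 / \<sigma>" "0 \<le> c ^ 4"
      using c \<kappa> sigma_pos by auto
    have err: "err \<kappa> c n = c / (\<sigma> * \<kappa>) * e1 + c\<^sup>2 / \<sigma>\<^sup>2 * e1 + c ^ 3 * \<kappa> / \<sigma> ^ 3 * e1 + c ^ 3 / \<sigma> * e2 + c ^ 4 * e3"
      by (simp add: err_def e1_def e2_def e3_def L_def r_def algebra_simps)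
    note nn = mult_nonneg_nonneg[OF coef(1) e0(1)] mult_nonneg_nonneg[OF coef(2) e0(1)] mult_nonneg_nonneg[OF coef(3) e0(1)]
      mult_nonneg_nonneg[OF coef(4) e0(2)] mult_nonneg_nonneg[OF coef(5) e0(3)]
    show ?case
    proof (intro allI impI)
      fix x assume x: "0 < x \<and> x \<le> c * sqrt (LgLg (real n))"
      then have x: "0 < x" "x \<le> c * sqrt L" by (auto simp: L_def)
      have h: "0 < h x" "h x \<le> c * sqrt L / (\<sigma> * sqrt n)"
        using x sigma_pos n by (auto simp: h_def divide_right_mono)
      have cu: "(sqrt u) ^ 3 = u * sqrt u" if "0 \<le> u" for u using that by (simp add: power3_eq_cube)
      have sq: "(sqrt L)\<^sup>2 = L" "(sqrt n)\<^sup>2 = n" using L by auto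
      have h2: "(h x)\<^sup>2 \<le> c\<^sup>2 / \<sigma>\<^sup>2 * (L / n)"
      proof -
        have "(h x)\<^sup>2 \<le> (c * sqrt L / (\<sigma> * sqrt n))\<^sup>2" using h by (intro power_mono) auto
        also have "\<dots> = c\<^sup>2 / \<sigma>\<^sup>2 * (L / n)" by (simp add: power_divide power_mult_distrib sq)
        finally show ?thesis .
      qed
      have hlv: "h x * lv \<le> c * \<kappa> / \<sigma>"
      proof -
        have "h x * lv \<le> c * sqrt L / (\<sigma> * sqrt n) * lv" using h lv by (intro mult_right_mono) auto
        also have "\<dots> = c * \<kappa> / \<sigma>" using n L by (simp add: lv_def level_def L_def[symmetric] real_sqrt_divide)
        finally show ?thesis .
      qed
      have sc: "scaled \<kappa> n x i = (\<lambda>\<omega>. h x * trunc lv (X i \<omega>))" for i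
        by (simp add: fun_eq_iff scaled_def h_def lv_def)
      show "small_walk M (scaled \<kappa> n x) n (x\<^sup>2) (err \<kappa> c n)"
      proof unfold_locales
        show "indep_vars (\<lambda>_. borel) (scaled \<kappa> n x) UNIV"
          unfolding scaled_def[abs_def] by (rule indep_vars_compose2[OF indep]) auto
        show "\<bar>scaled \<kappa> n x i \<omega>\<bar> \<le> 1" for i \<omega>
          using scaled_bound[OF \<kappa>(1) _ x(1), of n c i \<omega>] x n \<kappa>(2) by (simp add: L_def)
        show "0 < x\<^sup>2" "0 < n" "0 \<le> err \<kappa> c n" "err \<kappa> c n \<le> 1" using x n elim err nn by auto
        have "\<bar>expectation (scaled \<kappa> n x i)\<bar> = h x * \<bar>expectation (\<lambda>\<omega>. trunc lv (X i \<omega>))\<bar>" for i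
          using h unfolding sc by (simp add: abs_mult)
        moreover have "\<dots> i \<le> (c * sqrt L / (\<sigma> * sqrt n)) * (tail_moment r / lv)" for i
          using h lv Vlv V0 by (intro mult_mono order_trans[OF trunc_mean] divide_right_mono) auto
        moreover have "(c * sqrt L / (\<sigma> * sqrt n)) * (tail_moment r / lv) = c / (\<sigma> * \<kappa>) * e1 / n"
          using n L by (simp add: lv_def level_def L_def[symmetric] e1_def real_sqrt_divide field_simps)
        ultimately have "\<bar>expectation (scaled \<kappa> n x i)\<bar> \<le> c / (\<sigma> * \<kappa>) * e1 / n" for i by metis
        moreover have "c / (\<sigma> * \<kappa>) * e1 / n \<le> err \<kappa> c n / n" using n nn by (intro divide_right_mono) (auto simp: err)
        ultimately show "\<bar>expectation (scaled \<kappa> n x i)\<bar> \<le> err \<kappa> c n / n" for i by (meson order_trans)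
        have xn: "x\<^sup>2 / n = (h x)\<^sup>2 * \<sigma>\<^sup>2" using sigma_pos by (simp add: h_def power_divide power_mult_distrib)
        have "expectation (\<lambda>\<omega>. (scaled \<kappa> n x i \<omega>)\<^sup>2) = (h x)\<^sup>2 * (\<sigma>\<^sup>2 - tail_moment lv)" for i
          unfolding scaled_def h_def[symmetric] power_mult_distrib lv_def[symmetric] by (simp add: trunc_second)
        then have "\<bar>expectation (\<lambda>\<omega>. (scaled \<kappa> n x i \<omega>)\<^sup>2) - x\<^sup>2 / n\<bar> = (h x)\<^sup>2 * tail_moment lv" for i
          unfolding xn using V0 by (simp add: right_diff_distrib)
        also have "(h x)\<^sup>2 * tail_moment lv \<le> c\<^sup>2 / \<sigma>\<^sup>2 * (L / n) * tail_moment r" using h2 Vlv V0 L n by (intro mult_mono) auto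
        also have "\<dots> = c\<^sup>2 / \<sigma>\<^sup>2 * e1 / n" by (simp add: e1_def)
        also have "\<dots> \<le> err \<kappa> c n / n" using n nn by (intro divide_right_mono) (auto simp: err)
        finally show "\<bar>expectation (\<lambda>\<omega>. (scaled \<kappa> n x i \<omega>)\<^sup>2) - x\<^sup>2 / n\<bar> \<le> err \<kappa> c n / n" for i .
        have "expectation (\<lambda>\<omega>. \<bar>scaled \<kappa> n x i \<omega>\<bar> ^ 3) = (h x) ^ 3 * expectation (\<lambda>\<omega>. \<bar>trunc lv (X i \<omega>)\<bar> ^ 3)" for i
          unfolding scaled_def h_def[symmetric] lv_def[symmetric] abs_mult power_mult_distrib using h by simp
        \<comment> \<open>The inner cut is n^(1/4): so far below sqrt n that the first part vanishes
          after scaling, yet a power of n, so that the tail condition controls the second.\<close>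
        also have "\<dots> i \<le> (h x) ^ 3 * (r * \<sigma>\<^sup>2 + lv * tail_moment r)" for i
          using h lv by (intro mult_left_mono trunc_third) (auto simp: r_def)
        also have "\<dots> = (h x) ^ 3 * r * \<sigma>\<^sup>2 + ((h x)\<^sup>2 * tail_moment r) * (h x * lv)"
          by (simp add: algebra_simps power3_eq_cube power2_eq_square)
        also have "\<dots> \<le> c ^ 3 / \<sigma> * e2 / n + (c\<^sup>2 / \<sigma>\<^sup>2 * (L / n) * tail_moment r) * (c * \<kappa> / \<sigma>)"
        proof (intro add_mono mult_mono h2 hlv order_refl V0)
          have "(h x) ^ 3 * r * \<sigma>\<^sup>2 \<le> (c * sqrt L / (\<sigma> * sqrt n)) ^ 3 * r * \<sigma>\<^sup>2"
            using h by (intro mult_right_mono power_mono) (auto simp: r_def)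
          also have "\<dots> = (c ^ 3 * (L * sqrt L)) / (\<sigma> ^ 3 * (n * sqrt n)) * r * \<sigma>\<^sup>2"
            by (simp only: power_divide power_mult_distrib cu[OF less_imp_le[OF L]] cu[OF less_imp_le[OF n]])
          also have "\<dots> = c ^ 3 / \<sigma> * (L * sqrt L) * (r / sqrt n) / n"
            using sigma_pos n by (simp add: power3_eq_cube power2_eq_square mult_ac)
          also have "r / sqrt n = real n powr (-1/4)"
            using n by (simp add: r_def powr_half_sqrt[symmetric] flip: powr_diff)
          finally show "(h x) ^ 3 * r * \<sigma>\<^sup>2 \<le> c ^ 3 / \<sigma> * e2 / n" by (simp add: e2_def mult.assoc)
        qed (use h lv c \<kappa> L n V0 sigma_pos in auto)
        also have "\<dots> = (c ^ 3 / \<sigma> * e2 + c ^ 3 * \<kappa> / \<sigma> ^ 3 * e1) / n"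
          by (simp add: e1_def add_divide_distrib power3_eq_cube power2_eq_square mult_ac)
        also have "\<dots> \<le> err \<kappa> c n / n" using n nn by (intro divide_right_mono) (auto simp: err)
        finally show "expectation (\<lambda>\<omega>. \<bar>scaled \<kappa> n x i \<omega>\<bar> ^ 3) \<le> err \<kappa> c n / n" for i .
        have "x\<^sup>2 \<le> (c * sqrt L)\<^sup>2" using x by (intro power_mono) auto
        then have "x\<^sup>2 / n \<le> c\<^sup>2 * L / n" using n by (intro divide_right_mono) (auto simp: power_mult_distrib sq)
        then have "(x\<^sup>2 / n)\<^sup>2 \<le> (c\<^sup>2 * L / n)\<^sup>2" by (intro power_mono) auto
        also have "\<dots> = c ^ 4 * e3 / n" by (simp add: e3_def power_divide power_mult_distrib power2_eq_square numeral_eq_Suc)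
        also have "\<dots> \<le> err \<kappa> c n / n" using n nn by (intro divide_right_mono) (auto simp: err)
        finally show "(x\<^sup>2 / n)\<^sup>2 \<le> err \<kappa> c n / n" .
      qed
    qed
  qed
qed

end

section \<open>Summability of tail probabilities\<close>

lemma Lg_mult_le:
  assumes "0 \<le> u" "0 \<le> w" shows "Lg (u * w) \<le> Lg u + Lg w"
proof -
  have "u * w \<le> max u (exp 1) * max w (exp 1)"
    using assms by (intro mult_mono) auto
  moreover have "exp 1 * 1 \<le> max u (exp 1) * max w (exp 1)"
    by (intro mult_mono) (auto simp: le_max_iff_disj)
  ultimately have "max (u * w) (exp 1) \<le> max u (exp 1) * max w (exp 1)" by simp
  then have "Lg (u * w) \<le> ln (max u (exp 1) * max w (exp 1))"
    unfolding Lg_def by (subst ln_le_cancel_iff) (auto simp: less_max_iff_disj intro!: mult_pos_pos)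
  also have "\<dots> = Lg u + Lg w"
  proof -
    have "max z (exp 1) \<noteq> 0" for z :: real using exp_gt_zero[of 1] by (smt (verit) max.cobounded2)
    then show ?thesis unfolding Lg_def by (simp add: ln_mult)
  qed
  finally show ?thesis .
qed

lemma Lg_power_le:
  assumes "0 \<le> w" shows "Lg (w ^ Suc k) \<le> real (Suc k) * Lg w"
proof (induction k)
  case (Suc k)
  have "Lg (w ^ Suc (Suc k)) \<le> Lg w + Lg (w ^ Suc k)"
    using Lg_mult_le[of w "w ^ Suc k"] assms by simp
  also have "\<dots> \<le> Lg w + real (Suc k) * Lg w" using Suc by simp
  finally show ?case by (simp add: algebra_simps)
qed simp

lemma Lg_le_poly:
  assumes "0 \<le> C" "0 \<le> x" "y \<le> C * x ^ Suc k"
  shows "Lg y \<le> (Lg C + real (Suc k)) * Lg x"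
proof -
  have "Lg y \<le> Lg (C * x ^ Suc k)" by (intro Lg_mono assms)
  also have "\<dots> \<le> Lg C + Lg (x ^ Suc k)" using assms by (intro Lg_mult_le) auto
  also have "\<dots> \<le> Lg C * Lg x + real (Suc k) * Lg x"
  proof -
    have "Lg C * 1 \<le> Lg C * Lg x" by (intro mult_left_mono Lg_ge_1) simp
    then show ?thesis using Lg_power_le[OF assms(2), of k] by linarith
  qed
  finally show ?thesis by (simp add: algebra_simps)
qed

lemma LgLg_le_of_Lg:
  assumes "0 \<le> C" "Lg y \<le> C * Lg x"
  shows "LgLg y \<le> (Lg C + 1) * LgLg x"
  using Lg_le_poly[of C "Lg x" "Lg y" 0] assms Lg_pos[of x] by (simp add: LgLg_def)

text \<open>The exponents of the weights may have either sign; two-sided comparability yields an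
  upper bound in both cases, at the price of a constant.\<close>

lemma powr_le_comparable:
  fixes u w C a :: real
  assumes "0 < u" "u \<le> w" "w \<le> C * u"
  shows "w powr a \<le> C powr \<bar>a\<bar> * u powr a"
proof -
  have "1 * u \<le> C * u" using order_trans[OF assms(2,3)] by simp
  then have C: "1 \<le> C" using assms(1) by (rule mult_right_le_imp_le)
  show ?thesis
  proof (cases "0 \<le> a")
    case True
    then have "w powr a \<le> (C * u) powr a" using assms by (intro powr_mono2) auto
    then show ?thesis using True assms C by (simp add: powr_mult)
  next
    case False
    then have "w powr a \<le> u powr a" using assms by (intro powr_mono2') auto
    also have "\<dots> \<le> C powr \<bar>a\<bar> * u powr a"
      using C ge_one_powr_ge_zero[of C "\<bar>a\<bar>"] mult_right_mono[of 1 "C powr \<bar>a\<bar>" "u powr a"] by simp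
    finally show ?thesis .
  qed
qed

lemma Lg_le_4_sqrt:
  assumes "1 \<le> x" shows "Lg x \<le> 4 * sqrt x"
proof -
  have "max x (exp 1) \<le> 4 * x" using assms exp_le by simp
  have "Lg x \<le> ln (4 * x)"
    unfolding Lg_def using assms \<open>max x (exp 1) \<le> 4 * x\<close> by (subst ln_le_cancel_iff) (auto simp: less_max_iff_disj)
  also have "\<dots> = 2 * ln (sqrt (4 * x))" using assms by (simp add: ln_sqrt)
  also have "\<dots> \<le> 2 * (sqrt (4 * x) - 1)" using assms by (intro mult_left_mono ln_le_minus_one) auto
  also have "\<dots> \<le> 4 * sqrt x" by (simp add: real_sqrt_mult)
  finally show ?thesis .
qed

lemma LgLg_le_Lg: "LgLg x \<le> Lg x"
proof -
  have "Lg x \<le> max x (exp 1)"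
    unfolding Lg_def using ln_le_minus_one[of "max x (exp 1)"] by (auto simp: less_max_iff_disj)
  then have "max (Lg x) (exp 1) \<le> max x (exp 1)" by simp
  then show ?thesis
    unfolding LgLg_def Lg_def[of "Lg x"] by (subst Lg_def) (subst ln_le_cancel_iff, auto simp: less_max_iff_disj)
qed

lemma LgLg_le_4_sqrt: "1 \<le> x \<Longrightarrow> LgLg x \<le> 4 * sqrt x"
  using LgLg_le_Lg[of x] Lg_le_4_sqrt[of x] by simp

definition wt :: "real \<Rightarrow> real \<Rightarrow> real \<Rightarrow> real" where
  "wt a b x = Lg x powr a * LgLg x powr b"

lemma wt_nonneg: "0 \<le> wt a b x" by (simp add: wt_def)

lemma wt_measurable [measurable]: "wt a b \<in> borel_measurable borel"
  unfolding wt_def[abs_def] by measurable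

lemma wt_le_comparable:
  assumes "0 \<le> C" "0 \<le> x" "x \<le> y" "y \<le> C * x ^ Suc k"
  defines "C' \<equiv> Lg C + real (Suc k)"
  shows "wt a b y \<le> C' powr \<bar>a\<bar> * (Lg C' + 1) powr \<bar>b\<bar> * wt a b x"
proof -
  have C': "0 \<le> C'" using Lg_pos[of C] by (simp add: C'_def)
  have 1: "Lg y \<le> C' * Lg x" unfolding C'_def by (rule Lg_le_poly[OF assms(1,2,4)])
  have "Lg y powr a \<le> C' powr \<bar>a\<bar> * Lg x powr a"
    by (intro powr_le_comparable Lg_pos Lg_mono 1 assms)
  moreover have "LgLg y powr b \<le> (Lg C' + 1) powr \<bar>b\<bar> * LgLg x powr b"
    by (intro powr_le_comparable LgLg_pos LgLg_mono LgLg_le_of_Lg 1 C' assms)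
  ultimately have "wt a b y \<le> (C' powr \<bar>a\<bar> * Lg x powr a) * ((Lg C' + 1) powr \<bar>b\<bar> * LgLg x powr b)"
    unfolding wt_def by (intro mult_mono) auto
  then show ?thesis by (simp add: wt_def mult_ac)
qed

lemma wt_le_linear: "\<exists>C\<ge>0. \<forall>n\<ge>1. wt a b (real n) \<le> C * real n"
proof -
  have "(\<lambda>n. ln (real n) powr a * ln (ln (real n)) powr b / real n) \<longlonglongrightarrow> 0" by real_asymp
  moreover have "\<forall>\<^sub>F n in sequentially. ln (real n) powr a * ln (ln (real n)) powr b / real n = wt a b (real n) / real n"
    using eventually_Lg_nat eventually_LgLg_nat by eventually_elim (simp add: wt_def)
  ultimately have "(\<lambda>n. wt a b (real n) / real n) \<longlonglongrightarrow> 0" by (rule Lim_transform_eventually)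
  then have "Bseq (\<lambda>n. wt a b (real n) / real n)" by (intro convergent_imp_Bseq convergentI)
  then obtain K where K: "0 < K" "\<And>n. norm (wt a b (real n) / real n) \<le> K" by (auto elim: BseqE)
  then have "wt a b (real n) \<le> K * real n" if "1 \<le> n" for n
    using K(2)[of n] that wt_nonneg[of a b "real n"] by (simp add: divide_le_eq)
  then show ?thesis using K(1) by (intro exI[of _ K]) auto
qed

section \<open>Weighted series of tail probabilities of one increment\<close>

context iid_walk
begin

text \<open>Sum and expectation are exchanged and, for fixed x, the indices n with thr n <= |x| are
  counted. There are at most |x| of them with n <= |x|, which costs C x^2. For the others
  \<open>big\<close> bounds their number by \<open>h x\<close> and the weight by
  \<open>g x\<close>.\<close>

lemma summable_tail_weights:
  fixes f thr :: "nat \<Rightarrow> real" and g h :: "real \<Rightarrow> real"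
  assumes f: "\<And>n. 0 \<le> f n" "\<And>n. 1 \<le> n \<Longrightarrow> f n \<le> C * real n" and C: "0 \<le> C"
    and big: "\<And>n x. 1 \<le> n \<Longrightarrow> \<bar>x\<bar> < real n \<Longrightarrow> thr n \<le> \<bar>x\<bar> \<Longrightarrow> f n \<le> g x \<and> real n \<le> h x"
    and g: "\<And>x. 0 \<le> g x" and h: "\<And>x. 0 \<le> h x" and int: "integrable M (\<lambda>\<omega>. h (X 0 \<omega>) * g (X 0 \<omega>))"
  shows "summable (\<lambda>n. f (Suc n) * prob {\<omega>\<in>space M. thr (Suc n) \<le> \<bar>X 0 \<omega>\<bar>})"
proof -
  have pt: "(\<Sum>n\<in>{1..N}. f n * indicator {x. thr n \<le> \<bar>x\<bar>} x) \<le> C * x\<^sup>2 + h x * g x" for N x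
  proof -
    let ?A = "{n\<in>{1..N}. real n \<le> \<bar>x\<bar>}" and ?B = "{n\<in>{1..N}. \<bar>x\<bar> < real n \<and> thr n \<le> \<bar>x\<bar>}"
    have fin: "finite ?A" "finite ?B" by auto
    have "(\<Sum>n\<in>{1..N}. f n * indicator {x. thr n \<le> \<bar>x\<bar>} x) \<le> (\<Sum>n\<in>{1..N}. (if n \<in> ?A then f n else 0) + (if n \<in> ?B then f n else 0))"
      using f(1) by (intro sum_mono) (auto simp: indicator_def not_le)
    also have "\<dots> = (\<Sum>n\<in>?A. f n) + (\<Sum>n\<in>?B. f n)"
      by (subst sum.distrib, intro arg_cong2[where f="(+)"]) (auto simp: sum.If_cases intro!: sum.cong)
    also have "(\<Sum>n\<in>?A. f n) \<le> real (card ?A) * (C * \<bar>x\<bar>)"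
      using f(2) C by (intro sum_bounded_above) (auto intro: order_trans[OF f(2)] mult_left_mono)
    also have "\<dots> \<le> \<bar>x\<bar> * (C * \<bar>x\<bar>)"
    proof (intro mult_right_mono)
      have "?A \<subseteq> {1..nat \<lfloor>\<bar>x\<bar>\<rfloor>}" by (auto simp: le_nat_floor)
      then have "card ?A \<le> nat \<lfloor>\<bar>x\<bar>\<rfloor>" using card_mono[of "{1..nat \<lfloor>\<bar>x\<bar>\<rfloor>}" ?A] by simp
      then show "real (card ?A) \<le> \<bar>x\<bar>" using of_nat_floor[of "\<bar>x\<bar>"] by linarith
    qed (use C in auto)
    also have "\<bar>x\<bar> * (C * \<bar>x\<bar>) = C * x\<^sup>2" by (simp add: power2_eq_square)
    also have "(\<Sum>n\<in>?B. f n) \<le> real (card ?B) * g x"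
      using big by (intro sum_bounded_above) auto
    also have "\<dots> \<le> h x * g x"
    proof (intro mult_right_mono g)
      have "?B \<subseteq> {1..nat \<lfloor>h x\<rfloor>}" using big by (auto simp: le_nat_floor)
      then have "card ?B \<le> nat \<lfloor>h x\<rfloor>" using card_mono[of "{1..nat \<lfloor>h x\<rfloor>}" ?B] by simp
      then show "real (card ?B) \<le> h x" using of_nat_floor[of "h x"] h[of x] by linarith
    qed
    finally show ?thesis by simp
  qed
  have int': "integrable M (\<lambda>\<omega>. C * (X 0 \<omega>)\<^sup>2 + h (X 0 \<omega>) * g (X 0 \<omega>))" using int int2 by simp
  have bound: "(\<Sum>n<N. f (Suc n) * prob {\<omega>\<in>space M. thr (Suc n) \<le> \<bar>X 0 \<omega>\<bar>})
     \<le> expectation (\<lambda>\<omega>. C * (X 0 \<omega>)\<^sup>2 + h (X 0 \<omega>) * g (X 0 \<omega>))" for N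
  proof -
    have i: "integrable M (\<lambda>\<omega>. f n * indicator {x. thr n \<le> \<bar>x\<bar>} (X 0 \<omega>))" for n
      by (intro integrable_mult_right integrable_const_bound[where B=1]) (auto simp: indicator_def)
    have "prob {\<omega>\<in>space M. thr n \<le> \<bar>X 0 \<omega>\<bar>} = expectation (\<lambda>\<omega>. indicator {x. thr n \<le> \<bar>x\<bar>} (X 0 \<omega>))" for n
    proof -
      have "prob {\<omega>\<in>space M. thr n \<le> \<bar>X 0 \<omega>\<bar>} = expectation (indicator {\<omega>\<in>space M. thr n \<le> \<bar>X 0 \<omega>\<bar>})" by simp
      also have "\<dots> = expectation (\<lambda>\<omega>. indicator {x. thr n \<le> \<bar>x\<bar>} (X 0 \<omega>))"
        by (intro Bochner_Integration.integral_cong) (auto simp: indicator_def)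
      finally show ?thesis .
    qed
    then have "(\<Sum>n<N. f (Suc n) * prob {\<omega>\<in>space M. thr (Suc n) \<le> \<bar>X 0 \<omega>\<bar>})
       = (\<Sum>n\<in>{1..N}. f n * expectation (\<lambda>\<omega>. indicator {x. thr n \<le> \<bar>x\<bar>} (X 0 \<omega>)))"
      by (intro sum.reindex_bij_witness[of _ "\<lambda>n. n - 1" Suc]) auto
    also have "\<dots> = expectation (\<lambda>\<omega>. \<Sum>n\<in>{1..N}. f n * indicator {x. thr n \<le> \<bar>x\<bar>} (X 0 \<omega>))"
      using i by (subst Bochner_Integration.integral_sum) auto
    also have "\<dots> \<le> expectation (\<lambda>\<omega>. C * (X 0 \<omega>)\<^sup>2 + h (X 0 \<omega>) * g (X 0 \<omega>))"
      by (rule integral_mono[OF Bochner_Integration.integrable_sum[OF i] int' pt])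
    finally show ?thesis .
  qed
  show ?thesis
    by (rule summableI_nonneg_bounded[OF _ bound]) (use f(1) in auto)
qed

text \<open>The number of relevant n is of order x^2 log log |x|, and the weight cancels the
  iterated logarithm, so finite variance is enough. This sets the target for the jump estimates:
  their other factors have to be brought down to 1 / log log n.\<close>

lemma summable_level:
  assumes \<kappa>: "0 < \<kappa>"
  shows "summable (\<lambda>n. 1 / LgLg (real (Suc n)) * prob {\<omega>\<in>space M. level \<kappa> (Suc n) \<le> \<bar>X 0 \<omega>\<bar>})"
proof -
  \<comment> \<open>From n <= log log n * x^2 / \<kappa>^2 and log log n <= 4 sqrt n follows n <= C
    |x|^4. \<open>C1\<close> and, up to 1 / \<kappa>^2, \<open>D\<close> are then the constants of
    \<open>Lg_le_poly\<close> and \<open>LgLg_le_of_Lg\<close>.\<close>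
  define C where "C = (4 / \<kappa>\<^sup>2)\<^sup>2"
  define C1 where "C1 = Lg C + real (Suc 3)"
  define D where "D = (Lg C1 + 1) / \<kappa>\<^sup>2"
  have D: "0 \<le> D" using \<kappa> Lg_pos[of C1] by (auto simp: D_def intro!: divide_nonneg_nonneg)
  show ?thesis
  proof (rule summable_tail_weights[where C=1 and g="\<lambda>x. 1 / LgLg \<bar>x\<bar>" and h="\<lambda>x. D * x\<^sup>2 * LgLg \<bar>x\<bar>" and f="\<lambda>n. 1 / LgLg (real n)"])
    show "0 \<le> 1 / LgLg (real n)" for n using LgLg_pos[of "real n"] by simp
    show "1 / LgLg (real n) \<le> 1 * real n" if "1 \<le> n" for n
    proof -
      have "1 / LgLg (real n) \<le> 1" using LgLg_ge_1[of "real n"] by simp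
      then show ?thesis using that by linarith
    qed
    show "integrable M (\<lambda>\<omega>. D * (X 0 \<omega>)\<^sup>2 * LgLg \<bar>X 0 \<omega>\<bar> * (1 / LgLg \<bar>X 0 \<omega>\<bar>))"
    proof -
      have "LgLg x \<noteq> 0" for x using LgLg_pos[of x] by linarith
      then show ?thesis using int2 by simp
    qed
    show "0 \<le> 1 / LgLg \<bar>x\<bar>" "0 \<le> D * x\<^sup>2 * LgLg \<bar>x\<bar>" for x
      using LgLg_pos[of "\<bar>x\<bar>"] D by (auto intro!: mult_nonneg_nonneg less_imp_le)
    fix n :: nat and x :: real
    assume n: "1 \<le> n" and xn: "\<bar>x\<bar> < real n" and thr: "level \<kappa> n \<le> \<bar>x\<bar>"
    have L: "0 < LgLg (real n)" by simp
    have "(level \<kappa> n)\<^sup>2 \<le> \<bar>x\<bar>\<^sup>2" using thr level_nonneg[of \<kappa> n] \<kappa> by (intro power_mono) auto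
    then have "\<kappa>\<^sup>2 * (n / LgLg (real n)) \<le> x\<^sup>2"
      using L by (simp add: level_def power_mult_distrib)
    then have n_le: "real n \<le> LgLg (real n) * x\<^sup>2 / \<kappa>\<^sup>2" using L \<kappa> by (simp add: field_simps)
    also have "\<dots> \<le> 4 * sqrt n * x\<^sup>2 / \<kappa>\<^sup>2"
      using n by (intro divide_right_mono mult_right_mono LgLg_le_4_sqrt) auto
    finally have "sqrt n * sqrt n \<le> sqrt n * (4 / \<kappa>\<^sup>2 * x\<^sup>2)" by (simp add: mult_ac)
    then have "sqrt n \<le> 4 / \<kappa>\<^sup>2 * x\<^sup>2" using n by (simp only: mult_le_cancel_left_pos real_sqrt_gt_zero of_nat_0_less_iff)
    then have "(sqrt n)\<^sup>2 \<le> (4 / \<kappa>\<^sup>2 * x\<^sup>2)\<^sup>2" by (intro power_mono) auto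
    also have "(4 / \<kappa>\<^sup>2 * x\<^sup>2)\<^sup>2 = C * \<bar>x\<bar> ^ Suc 3"
      by (simp only: C_def power_mult_distrib) (simp add: power_even_abs)
    finally have "real n \<le> C * \<bar>x\<bar> ^ Suc 3" by simp
    then have "Lg (real n) \<le> C1 * Lg \<bar>x\<bar>" unfolding C1_def by (intro Lg_le_poly) (auto simp: C_def)
    then have "LgLg (real n) \<le> (Lg C1 + 1) * LgLg \<bar>x\<bar>"
      using Lg_pos[of C] by (intro LgLg_le_of_Lg) (auto simp: C1_def)
    then have "LgLg (real n) * (x\<^sup>2 / \<kappa>\<^sup>2) \<le> (Lg C1 + 1) * LgLg \<bar>x\<bar> * (x\<^sup>2 / \<kappa>\<^sup>2)" by (intro mult_right_mono) auto
    with n_le have "real n \<le> D * x\<^sup>2 * LgLg \<bar>x\<bar>" by (simp add: D_def mult_ac)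
    moreover have "1 / LgLg (real n) \<le> 1 / LgLg \<bar>x\<bar>"
      using xn L by (intro divide_left_mono LgLg_mono mult_pos_pos) auto
    ultimately show "1 / LgLg (real n) \<le> 1 / LgLg \<bar>x\<bar> \<and> real n \<le> D * x\<^sup>2 * LgLg \<bar>x\<bar>" by simp
  qed simp
qed

text \<open>The number of relevant n is of order x^2 / log log |x|; multiplied by the weight this is
  x^2 times \<open>wt a (b - 1)\<close>, exactly the assumed moment.\<close>

lemma summable_large_jumps:
  assumes y: "0 < y" and moment: "integrable M (\<lambda>\<omega>. (X 0 \<omega>)\<^sup>2 * wt a (b - 1) \<bar>X 0 \<omega>\<bar>)"
  shows "summable (\<lambda>n. wt a b (real (Suc n)) * prob {\<omega>\<in>space M. y * phi (real (Suc n)) \<le> \<bar>X 0 \<omega>\<bar>})"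
proof -
  define C where "C = 1 / (2 * y\<^sup>2)"
  define C1 where "C1 = Lg C + real (Suc 1)"
  define D where "D = C1 powr \<bar>a\<bar> * (Lg C1 + 1) powr \<bar>b\<bar>"
  have C: "0 \<le> C" by (simp add: C_def)
  have D: "0 \<le> D" by (simp add: D_def)
  obtain K where K: "0 \<le> K" "\<And>n. 1 \<le> n \<Longrightarrow> wt a b (real n) \<le> K * real n" using wt_le_linear by blast
  have LLnz: "LgLg x \<noteq> 0" for x using LgLg_pos[of x] by linarith
  have eq: "C * x\<^sup>2 / LgLg \<bar>x\<bar> * (D * wt a b \<bar>x\<bar>) = C * D * (x\<^sup>2 * wt a (b - 1) \<bar>x\<bar>)" for x
    using LLnz[of "\<bar>x\<bar>"] LgLg_pos[of "\<bar>x\<bar>"] by (simp add: wt_def powr_diff)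
  show ?thesis
  proof (rule summable_tail_weights[where C=K and g="\<lambda>x. D * wt a b \<bar>x\<bar>" and h="\<lambda>x. C * x\<^sup>2 / LgLg \<bar>x\<bar>"
        and f="\<lambda>n. wt a b (real n)" and thr="\<lambda>n. y * phi (real n)"])
    show "integrable M (\<lambda>\<omega>. C * (X 0 \<omega>)\<^sup>2 / LgLg \<bar>X 0 \<omega>\<bar> * (D * wt a b \<bar>X 0 \<omega>\<bar>))"
      unfolding eq using moment by simp
    show "0 \<le> D * wt a b \<bar>x\<bar>" for x using D wt_nonneg by simp
    show "0 \<le> C * x\<^sup>2 / LgLg \<bar>x\<bar>" for x using C LgLg_pos[of "\<bar>x\<bar>"] by simp
    fix n :: nat and x :: real
    assume n: "1 \<le> n" and xn: "\<bar>x\<bar> < real n" and thr: "y * phi (real n) \<le> \<bar>x\<bar>"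
    have L: "1 \<le> LgLg (real n)" by (rule LgLg_ge_1)
    have "(y * phi (real n))\<^sup>2 \<le> \<bar>x\<bar>\<^sup>2" using thr y L by (intro power_mono) (auto simp: phi_def)
    moreover have "(phi (real n))\<^sup>2 = 2 * n * LgLg (real n)" using L by (simp add: phi_def)
    ultimately have "y\<^sup>2 * (2 * real n * LgLg (real n)) \<le> x\<^sup>2" by (simp add: power_mult_distrib)
    then have nL: "real n * LgLg (real n) \<le> C * x\<^sup>2" using y by (simp add: C_def field_simps)
    have "real n * 1 \<le> real n * LgLg (real n)" using L by (intro mult_left_mono) auto
    with nL have nC: "real n \<le> C * \<bar>x\<bar> ^ Suc 1" by (simp add: power2_eq_square)
    have "real n * LgLg \<bar>x\<bar> \<le> real n * LgLg (real n)" using xn by (intro mult_left_mono LgLg_mono) auto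
    with nL have "real n \<le> C * x\<^sup>2 / LgLg \<bar>x\<bar>" using LgLg_pos[of "\<bar>x\<bar>"] by (simp add: pos_le_divide_eq)
    moreover have "wt a b (real n) \<le> D * wt a b \<bar>x\<bar>"
      unfolding D_def C1_def using xn by (intro wt_le_comparable C nC) auto
    ultimately show "wt a b (real n) \<le> D * wt a b \<bar>x\<bar> \<and> real n \<le> C * x\<^sup>2 / LgLg \<bar>x\<bar>" by simp
  qed (use K wt_nonneg in auto)
qed

text \<open>The truncation constant is tuned so that the scaled increments meet the bound of
  \<open>moderate_deviation\<close>; the other smallness conditions hold for large n, uniformly in
  x.\<close>

lemma truncated_deviation:
  assumes \<rho>: "0 < \<rho>" and c: "0 < c1" "0 < c2"
  shows "\<exists>\<kappa>>0. c2 * \<kappa> / \<sigma> \<le> 1 \<and> (\<forall>\<^sub>F n in sequentially. \<forall>x. c1 * sqrt (LgLg (real n)) \<le> x \<and> x \<le> c2 * sqrt (LgLg (real n)) \<longrightarrow>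
     \<bar>prob {\<omega>\<in>space M. \<sigma> * sqrt n * x \<le> \<bar>partial_sum (\<lambda>i \<omega>. trunc (level \<kappa> n) (X i \<omega>)) n \<omega>\<bar>} - 2 * gauss_tail x\<bar> \<le> \<rho> * gauss_tail x \<and>
     \<bar>prob {\<omega>\<in>space M. \<exists>k\<le>n. \<sigma> * sqrt n * x \<le> \<bar>partial_sum (\<lambda>i \<omega>. trunc (level \<kappa> n) (X i \<omega>)) k \<omega>\<bar>} - 4 * gauss_tail x\<bar> \<le> \<rho> * gauss_tail x)"
proof -
  obtain \<kappa>' m0 x0 where \<kappa>': "0 < \<kappa>'" "\<kappa>' \<le> 1" and m0: "0 < m0" and x0: "1 \<le> x0"
    and md: "\<And>(M :: 'a measure) Z n v m. small_walk M Z n v m \<Longrightarrow> (\<And>i \<omega>. \<bar>Z i \<omega>\<bar> \<le> \<kappa>') \<Longrightarrow> m \<le> m0 \<Longrightarrow> v / n \<le> m0 \<Longrightarrow> x0 \<le> sqrt v \<Longrightarrow>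
      \<bar>measure M {\<omega>\<in>space M. v \<le> \<bar>partial_sum Z n \<omega>\<bar>} - 2 * gauss_tail (sqrt v)\<bar> \<le> \<rho> * gauss_tail (sqrt v) \<and>
      \<bar>measure M {\<omega>\<in>space M. \<not> stays {-v<..<v} Z n \<omega>} - 4 * gauss_tail (sqrt v)\<bar> \<le> \<rho> * gauss_tail (sqrt v)"
    using moderate_deviation[OF \<rho>] by blast
  define \<kappa> where "\<kappa> = \<kappa>' * \<sigma> / c2"
  have \<kappa>: "0 < \<kappa>" using \<kappa>' sigma_pos c by (simp add: \<kappa>_def)
  have c\<kappa>: "c2 * \<kappa> / \<sigma> = \<kappa>'" using sigma_pos c by (simp add: \<kappa>_def)
  have "\<forall>\<^sub>F n in sequentially. err \<kappa> c2 n < m0" using order_tendstoD(2)[OF err_lim m0] .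
  moreover have "\<forall>\<^sub>F n in sequentially. x0 \<le> c1 * sqrt (LgLg (real n))"
  proof -
    have "\<forall>\<^sub>F n in sequentially. x0 \<le> c1 * sqrt (ln (ln (real n)))" using c by real_asymp
    then show ?thesis using eventually_LgLg_nat by eventually_elim simp
  qed
  moreover have "\<forall>\<^sub>F n in sequentially. c2\<^sup>2 * LgLg (real n) / n \<le> m0"
  proof -
    have "(\<lambda>n. c2\<^sup>2 * ln (ln (real n)) / n) \<longlonglongrightarrow> 0" by real_asymp
    from order_tendstoD(2)[OF this m0] show ?thesis using eventually_LgLg_nat by eventually_elim simp
  qed
  moreover have "\<forall>\<^sub>F n in sequentially. \<forall>x. 0 < x \<and> x \<le> c2 * sqrt (LgLg (real n)) \<longrightarrow> small_walk M (scaled \<kappa> n x) n (x\<^sup>2) (err \<kappa> c2 n)"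
    using \<kappa> c\<kappa> \<kappa>' c by (intro scaled_small_walk) auto
  ultimately have "\<forall>\<^sub>F n in sequentially. \<forall>x. c1 * sqrt (LgLg (real n)) \<le> x \<and> x \<le> c2 * sqrt (LgLg (real n)) \<longrightarrow>
     \<bar>prob {\<omega>\<in>space M. \<sigma> * sqrt n * x \<le> \<bar>partial_sum (\<lambda>i \<omega>. trunc (level \<kappa> n) (X i \<omega>)) n \<omega>\<bar>} - 2 * gauss_tail x\<bar> \<le> \<rho> * gauss_tail x \<and>
     \<bar>prob {\<omega>\<in>space M. \<exists>k\<le>n. \<sigma> * sqrt n * x \<le> \<bar>partial_sum (\<lambda>i \<omega>. trunc (level \<kappa> n) (X i \<omega>)) k \<omega>\<bar>} - 4 * gauss_tail x\<bar> \<le> \<rho> * gauss_tail x"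
    using eventually_gt_at_top[of 0]
  proof eventually_elim
    case (elim n)
    show ?case
    proof (intro allI impI)
      fix x assume x: "c1 * sqrt (LgLg (real n)) \<le> x \<and> x \<le> c2 * sqrt (LgLg (real n))"
      have x1: "1 \<le> x" "x0 \<le> x" using x elim x0 by auto
      have n: "0 < sqrt (real n)" using elim by simp
      have sw: "small_walk M (scaled \<kappa> n x) n (x\<^sup>2) (err \<kappa> c2 n)" using elim x x1 by auto
      have b: "\<bar>scaled \<kappa> n x i \<omega>\<bar> \<le> \<kappa>'" for i \<omega>
        using scaled_bound[OF \<kappa>, of n x c2 i \<omega>] x x1 elim c\<kappa> by simp
      have "x\<^sup>2 \<le> (c2 * sqrt (LgLg (real n)))\<^sup>2" using x x1 by (intro power_mono) auto
      also have "\<dots> = c2\<^sup>2 * LgLg (real n)" using LgLg_pos[of "real n"] by (simp add: power_mult_distrib)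
      finally have "x\<^sup>2 / n \<le> c2\<^sup>2 * LgLg (real n) / n" by (intro divide_right_mono) auto
      then have vn: "x\<^sup>2 / n \<le> m0" using elim by linarith
      have ps: "partial_sum (scaled \<kappa> n x) k \<omega> = x / (\<sigma> * sqrt n) * partial_sum (\<lambda>i \<omega>. trunc (level \<kappa> n) (X i \<omega>)) k \<omega>" for k \<omega>
        unfolding partial_sum_def scaled_def by (simp add: sum_distrib_left)
      have iff: "x\<^sup>2 \<le> \<bar>partial_sum (scaled \<kappa> n x) k \<omega>\<bar> \<longleftrightarrow> \<sigma> * sqrt n * x \<le> \<bar>partial_sum (\<lambda>i \<omega>. trunc (level \<kappa> n) (X i \<omega>)) k \<omega>\<bar>" for k \<omega>
      proof -
        have "x\<^sup>2 \<le> \<bar>partial_sum (scaled \<kappa> n x) k \<omega>\<bar> \<longleftrightarrow> x * (\<sigma> * sqrt n * x) \<le> x * \<bar>partial_sum (\<lambda>i \<omega>. trunc (level \<kappa> n) (X i \<omega>)) k \<omega>\<bar>"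
          unfolding ps abs_mult using n sigma_pos x1 by (simp add: pos_le_divide_eq power2_eq_square mult_ac)
        also have "\<dots> \<longleftrightarrow> \<sigma> * sqrt n * x \<le> \<bar>partial_sum (\<lambda>i \<omega>. trunc (level \<kappa> n) (X i \<omega>)) k \<omega>\<bar>"
          using x1 by (intro mult_le_cancel_left_pos) simp
        finally show ?thesis .
      qed
      have st: "\<not> stays {- x\<^sup>2<..<x\<^sup>2} (scaled \<kappa> n x) n \<omega> \<longleftrightarrow> (\<exists>k\<le>n. x\<^sup>2 \<le> \<bar>partial_sum (scaled \<kappa> n x) k \<omega>\<bar>)" for \<omega>
        unfolding stays_def by (auto simp: abs_if not_less)
      have "sqrt (x\<^sup>2) = x" using x1 by simp
      then show "\<bar>prob {\<omega>\<in>space M. \<sigma> * sqrt n * x \<le> \<bar>partial_sum (\<lambda>i \<omega>. trunc (level \<kappa> n) (X i \<omega>)) n \<omega>\<bar>} - 2 * gauss_tail x\<bar> \<le> \<rho> * gauss_tail x \<and>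
        \<bar>prob {\<omega>\<in>space M. \<exists>k\<le>n. \<sigma> * sqrt n * x \<le> \<bar>partial_sum (\<lambda>i \<omega>. trunc (level \<kappa> n) (X i \<omega>)) k \<omega>\<bar>} - 4 * gauss_tail x\<bar> \<le> \<rho> * gauss_tail x"
        using md[OF sw b less_imp_le[OF elim(1)] vn] x1 unfolding st iff by simp
    qed
  qed
  then show ?thesis using \<kappa> c\<kappa> \<kappa>' by (intro exI[of _ \<kappa>]) auto
qed

end

section \<open>Large jumps\<close>

text \<open>If no increment reaches \<beta>, original and truncated sums differ by at most the sum
  of the large increments. Either those other than j0 add up to m \<beta>, or the difference is at
  most (m + 1) \<beta> and the truncated walk still deviates. In both cases the second condition
  avoids the coordinate j, so independence will apply.\<close>

lemma jump_decomposition: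
  fixes x :: "nat \<Rightarrow> real"
  assumes j0: "j0 \<in> {1..n}" "\<tau> \<le> \<bar>x j0\<bar>" and \<beta>: "0 \<le> \<beta>" and k: "k \<le> n"
    and dev: "\<theta> \<le> \<bar>\<Sum>i\<in>{1..k}. x i\<bar> \<or> \<theta> \<le> \<bar>\<Sum>i\<in>{1..k}. trunc \<tau> (x i)\<bar>"
  defines "J \<equiv> (\<lambda>u. if \<tau> \<le> \<bar>u\<bar> \<and> \<bar>u\<bar> < \<beta> then \<bar>u\<bar> else 0)"
  shows "(\<exists>j\<in>{1..n}. \<beta> \<le> \<bar>x j\<bar>) \<or> (\<exists>j\<in>{1..n}. \<tau> \<le> \<bar>x j\<bar> \<and> real m * \<beta> \<le> (\<Sum>i\<in>{1..n}-{j}. J (x i))) \<or>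
    (\<exists>j\<in>{1..n}. \<tau> \<le> \<bar>x j\<bar> \<and> (\<exists>k\<le>n. \<theta> - real (Suc m) * \<beta> \<le> \<bar>\<Sum>i\<in>{1..k}. if i = j then 0 else trunc \<tau> (x i)\<bar>))"
proof (cases "\<exists>j\<in>{1..n}. \<beta> \<le> \<bar>x j\<bar>")
  case False
  then have small: "\<bar>x j\<bar> < \<beta>" if "j \<in> {1..n}" for j using that by (auto simp: not_le)
  have J0: "0 \<le> J u" for u by (simp add: J_def)
  have Jj: "J (x j0) \<le> \<beta>" using small[OF j0(1)] \<beta> by (simp add: J_def)
  have split: "(\<Sum>i\<in>{1..n}. J (x i)) = J (x j0) + (\<Sum>i\<in>{1..n}-{j0}. J (x i))"
    using j0 by (intro sum.remove) auto
  show ?thesis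
  proof (cases "real m * \<beta> \<le> (\<Sum>i\<in>{1..n}-{j0}. J (x i))")
    case True
    then show ?thesis using j0 by blast
  next
    case False
    have "\<bar>(\<Sum>i\<in>{1..k}. x i) - (\<Sum>i\<in>{1..k}. trunc \<tau> (x i))\<bar> = \<bar>\<Sum>i\<in>{1..k}. x i - trunc \<tau> (x i)\<bar>"
      by (simp add: sum_subtractf)
    also have "\<dots> \<le> (\<Sum>i\<in>{1..k}. \<bar>x i - trunc \<tau> (x i)\<bar>)" by (rule sum_abs)
    also have "\<dots> \<le> (\<Sum>i\<in>{1..k}. J (x i))"
      using k small by (intro sum_mono) (auto simp: J_def trunc_def)
    also have "\<dots> \<le> (\<Sum>i\<in>{1..n}. J (x i))"
      using k J0 by (intro sum_mono2) auto
    also have "\<dots> \<le> real (Suc m) * \<beta>" using split Jj False by (simp add: algebra_simps)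
    finally have "\<theta> - real (Suc m) * \<beta> \<le> \<bar>\<Sum>i\<in>{1..k}. trunc \<tau> (x i)\<bar>"
    proof -
      assume *: "\<bar>(\<Sum>i\<in>{1..k}. x i) - (\<Sum>i\<in>{1..k}. trunc \<tau> (x i))\<bar> \<le> real (Suc m) * \<beta>"
      have "0 \<le> real (Suc m) * \<beta>" using \<beta> by (intro mult_nonneg_nonneg) auto
      with * dev show ?thesis by linarith
    qed
    \<comment> \<open>\<open>trunc\<close> is 0 at the large increment \<open>j0\<close>, so
      dropping this index leaves the truncated sum unchanged.\<close>
    moreover have "(\<Sum>i\<in>{1..k}. trunc \<tau> (x i)) = (\<Sum>i\<in>{1..k}. if i = j0 then 0 else trunc \<tau> (x i))"
      using j0(2) by (intro sum.cong) (auto simp: trunc_def)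
    ultimately show ?thesis using j0 k by auto
  qed
qed auto

lemma exp_le_chord:
  fixes u h \<beta> :: real
  assumes "0 \<le> u" "u \<le> \<beta>" "0 < \<beta>"
  shows "exp (h * u) \<le> 1 + u / \<beta> * (exp (h * \<beta>) - 1)"
proof -
  have "exp ((1 - u / \<beta>) *\<^sub>R 0 + (u / \<beta>) *\<^sub>R (h * \<beta>)) \<le> (1 - u / \<beta>) * exp 0 + (u / \<beta>) * exp (h * \<beta>)"
    using assms by (intro convex_onD[OF exp_convex]) auto
  then show ?thesis using assms by (simp add: algebra_simps)
qed

text \<open>Splits off the probability of one large increment as a factor in
  \<open>jump_event_prob\<close>.\<close>

lemma (in prob_space) indep_coordinate:
  fixes X :: "nat \<Rightarrow> 'a \<Rightarrow> real"
  assumes ind: "indep_vars (\<lambda>_. borel) X UNIV" and j: "j \<notin> I" and A: "A \<in> sets borel" and R: "R \<in> sets (PiM I (\<lambda>_. borel))"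
  shows "prob {\<omega>\<in>space M. X j \<omega> \<in> A \<and> (\<lambda>i\<in>I. X i \<omega>) \<in> R} =
    prob {\<omega>\<in>space M. X j \<omega> \<in> A} * prob {\<omega>\<in>space M. (\<lambda>i\<in>I. X i \<omega>) \<in> R}"
proof -
  define A' where "A' = {f \<in> space (PiM {j} (\<lambda>_. borel :: real measure)). f j \<in> A}"
  have A': "A' \<in> sets (PiM {j} (\<lambda>_. borel))" unfolding A'_def using A by measurable
  have "indep_var (PiM {j} (\<lambda>_. borel)) (\<lambda>\<omega>. restrict (\<lambda>i. X i \<omega>) {j}) (PiM I (\<lambda>_. borel)) (\<lambda>\<omega>. restrict (\<lambda>i. X i \<omega>) I)"
    using j by (intro indep_var_restrict[OF ind]) auto
  from indep_varD[OF this A' R]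
  have "prob ((\<lambda>x. (\<lambda>i\<in>{j}. X i x, \<lambda>i\<in>I. X i x)) -` (A' \<times> R) \<inter> space M) =
     prob ((\<lambda>\<omega>. \<lambda>i\<in>{j}. X i \<omega>) -` A' \<inter> space M) * prob ((\<lambda>\<omega>. \<lambda>i\<in>I. X i \<omega>) -` R \<inter> space M)" .
  moreover have "(\<lambda>x. (\<lambda>i\<in>{j}. X i x, \<lambda>i\<in>I. X i x)) -` (A' \<times> R) \<inter> space M = {\<omega>\<in>space M. X j \<omega> \<in> A \<and> (\<lambda>i\<in>I. X i \<omega>) \<in> R}"
    by (auto simp: A'_def space_PiM)
  moreover have "(\<lambda>\<omega>. \<lambda>i\<in>{j}. X i \<omega>) -` A' \<inter> space M = {\<omega>\<in>space M. X j \<omega> \<in> A}"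
    by (auto simp: A'_def space_PiM)
  moreover have "(\<lambda>\<omega>. \<lambda>i\<in>I. X i \<omega>) -` R \<inter> space M = {\<omega>\<in>space M. (\<lambda>i\<in>I. X i \<omega>) \<in> R}" by auto
  ultimately show ?thesis by simp
qed

context iid_walk
begin

lemma prob_tail_ident: "prob {\<omega>\<in>space M. t \<le> \<bar>X i \<omega>\<bar>} = prob {\<omega>\<in>space M. t \<le> \<bar>X 0 \<omega>\<bar>}"
  using prob_ident[of "{x. t \<le> \<bar>x\<bar>}" i] by simp

text \<open>Chernoff bound with the tilt h for which exp (h \<beta>) = 1 / vh. By convexity the
  exponential moment is at most 1 + E J / \<beta> * (1 / vh - 1), and E J <= vh / \<tau> cancels 1 /
  vh, leaving 1 + 1 / (\<tau> \<beta>). Reaching m \<beta> costs vh^m. A positive bound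
  \<open>vh\<close> replaces the tail moment, which could be 0.\<close>

lemma jump_sum_tail:
  assumes \<tau>: "0 < \<tau>" and \<beta>: "0 < \<beta>" and vh: "tail_moment \<tau> \<le> vh" "0 < vh" "vh \<le> 1" and I: "finite I" "card I \<le> n"
  defines "J \<equiv> (\<lambda>u. if \<tau> \<le> \<bar>u\<bar> \<and> \<bar>u\<bar> < \<beta> then \<bar>u\<bar> else 0)"
  shows "prob {\<omega>\<in>space M. real m * \<beta> \<le> (\<Sum>i\<in>I. J (X i \<omega>))} \<le> exp (n / (\<tau> * \<beta>)) * vh ^ m"
proof -
  have J0: "0 \<le> J u" "J u \<le> \<beta>" for u using \<beta> by (auto simp: J_def)
  have [measurable]: "J \<in> borel_measurable borel" unfolding J_def by measurable
  define h where "h = ln (1 / vh) / \<beta>"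
  have h: "0 \<le> h" using vh \<beta> by (simp add: h_def)
  have h\<beta>: "exp (h * \<beta>) = 1 / vh" using \<beta> vh by (simp add: h_def exp_minus ln_div inverse_eq_divide)
  have iJ: "integrable M (\<lambda>\<omega>. J (X i \<omega>))" for i
    using J0 by (intro integrable_const_bound[where B=\<beta>]) auto
  have iE: "integrable M (\<lambda>\<omega>. exp (h * J (X i \<omega>)))" for i
    using J0 h by (intro integrable_const_bound[where B="exp (h * \<beta>)"]) (auto intro!: mult_left_mono)
  have EJ: "expectation (\<lambda>\<omega>. J (X i \<omega>)) \<le> tail_moment \<tau> / \<tau>" for i
  proof -
    have "expectation (\<lambda>\<omega>. J (X i \<omega>)) = expectation (\<lambda>\<omega>. J (X 0 \<omega>))" by (rule expectation_ident) simp
    also have "\<dots> \<le> expectation (\<lambda>\<omega>. (if \<tau> \<le> \<bar>X 0 \<omega>\<bar> then (X 0 \<omega>)\<^sup>2 else 0) / \<tau>)"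
    proof (rule integral_mono)
      show "integrable M (\<lambda>\<omega>. (if \<tau> \<le> \<bar>X 0 \<omega>\<bar> then (X 0 \<omega>)\<^sup>2 else 0) / \<tau>)" using tail_moment_integrable by simp
      show "J (X 0 \<omega>) \<le> (if \<tau> \<le> \<bar>X 0 \<omega>\<bar> then (X 0 \<omega>)\<^sup>2 else 0) / \<tau>" for \<omega>
        using \<tau> mult_left_mono[of \<tau> "\<bar>X 0 \<omega>\<bar>" "\<bar>X 0 \<omega>\<bar>"] by (auto simp: J_def pos_le_divide_eq power2_eq_square)
    qed (rule iJ)
    finally show ?thesis by (simp add: tail_moment_def)
  qed
  have EE: "expectation (\<lambda>\<omega>. exp (h * J (X i \<omega>))) \<le> exp (1 / (\<tau> * \<beta>))" for i
  proof -
    have "expectation (\<lambda>\<omega>. exp (h * J (X i \<omega>))) \<le> expectation (\<lambda>\<omega>. 1 + J (X i \<omega>) / \<beta> * (exp (h * \<beta>) - 1))"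
      using iJ iE J0 \<beta> by (intro integral_mono exp_le_chord) auto
    also have "\<dots> = 1 + expectation (\<lambda>\<omega>. J (X i \<omega>)) / \<beta> * (1 / vh - 1)"
      using iJ by (simp add: prob_space h\<beta>)
    also have "\<dots> \<le> 1 + (vh / \<tau>) / \<beta> * (1 / vh)"
    proof -
      have "expectation (\<lambda>\<omega>. J (X i \<omega>)) \<le> vh / \<tau>" using EJ[of i] vh \<tau> by (meson divide_right_mono less_imp_le order_trans)
      then show ?thesis using vh \<beta> \<tau> J0 by (intro add_left_mono mult_mono divide_right_mono) (auto intro!: divide_nonneg_nonneg)
    qed
    also have "\<dots> = 1 + 1 / (\<tau> * \<beta>)" using vh by simp
    also have "\<dots> \<le> exp (1 / (\<tau> * \<beta>))" by (rule exp_ge_add_one_self)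
    finally show ?thesis .
  qed
  have ind': "indep_vars (\<lambda>_. borel) (\<lambda>i \<omega>. exp (h * J (X i \<omega>))) I"
    by (rule indep_vars_compose2[OF indep_vars_subset[OF indep]]) auto
  have int: "integrable M (\<lambda>\<omega>. \<Prod>i\<in>I. exp (h * J (X i \<omega>)))"
    by (rule indep_vars_integrable[OF I(1) ind' iE])
  have "expectation (\<lambda>\<omega>. \<Prod>i\<in>I. exp (h * J (X i \<omega>))) = (\<Prod>i\<in>I. expectation (\<lambda>\<omega>. exp (h * J (X i \<omega>))))"
    by (rule indep_vars_lebesgue_integral[OF I(1) ind' iE])
  also have "\<dots> \<le> (\<Prod>i\<in>I. exp (1 / (\<tau> * \<beta>)))"
    by (intro prod_mono conjI EE) (auto intro!: Bochner_Integration.integral_nonneg)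
  also have "\<dots> = exp (card I / (\<tau> * \<beta>))" by (simp flip: exp_of_nat_mult)
  also have "\<dots> \<le> exp (n / (\<tau> * \<beta>))" using I \<tau> \<beta> by (simp add: divide_right_mono)
  finally have prod: "expectation (\<lambda>\<omega>. \<Prod>i\<in>I. exp (h * J (X i \<omega>))) \<le> exp (n / (\<tau> * \<beta>))" .
  have vhm: "exp (- (h * (real m * \<beta>))) = vh ^ m"
  proof -
    have "exp (- (h * (real m * \<beta>))) = exp (- (h * \<beta>)) ^ m" by (simp flip: exp_of_nat_mult add: mult_ac)
    then show ?thesis unfolding exp_minus h\<beta> by simp
  qed
  have "prob {\<omega>\<in>space M. real m * \<beta> \<le> (\<Sum>i\<in>I. J (X i \<omega>))} = expectation (indicator {\<omega>\<in>space M. real m * \<beta> \<le> (\<Sum>i\<in>I. J (X i \<omega>))})"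
    by simp
  also have "\<dots> \<le> expectation (\<lambda>\<omega>. vh ^ m * (\<Prod>i\<in>I. exp (h * J (X i \<omega>))))"
  proof (rule integral_mono)
    show "integrable M (indicator {\<omega>\<in>space M. real m * \<beta> \<le> (\<Sum>i\<in>I. J (X i \<omega>))} :: 'a \<Rightarrow> real)"
      by (intro integrable_indicator_event) measurable
    show "integrable M (\<lambda>\<omega>. vh ^ m * (\<Prod>i\<in>I. exp (h * J (X i \<omega>))))" using int by simp
    fix \<omega>
    have eq: "vh ^ m * (\<Prod>i\<in>I. exp (h * J (X i \<omega>))) = exp (h * ((\<Sum>i\<in>I. J (X i \<omega>)) - real m * \<beta>))"
      unfolding vhm[symmetric] exp_sum[OF I(1), symmetric] exp_add[symmetric] by (simp add: algebra_simps sum_distrib_left)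
    show "indicator {\<omega>\<in>space M. real m * \<beta> \<le> (\<Sum>i\<in>I. J (X i \<omega>))} \<omega> \<le> vh ^ m * (\<Prod>i\<in>I. exp (h * J (X i \<omega>)))"
      unfolding eq using h by (auto simp: indicator_def)
  qed
  also have "\<dots> \<le> vh ^ m * exp (n / (\<tau> * \<beta>))" using prod vh by simp
  finally show ?thesis by (simp add: mult.commute)
qed

text \<open>With tilt 1, the level x^2 against the exponential moment exp (x^2/2 + 3m) leaves exp (3
  - x^2/2). Erasing an increment is harmless as \<Lambda> >= 1; the 2 accounts for both
  signs.\<close>

lemma skipped_walk_tail:
  fixes j :: nat
  assumes sw: "small_walk M (scaled \<kappa> n x) n (x\<^sup>2) m"
  defines "Z' \<equiv> (\<lambda>i \<omega>. if i = j then 0 else scaled \<kappa> n x i \<omega>)"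
  shows "prob {\<omega>\<in>space M. \<exists>k\<le>n. x\<^sup>2 \<le> \<bar>partial_sum Z' k \<omega>\<bar>} \<le> 2 * exp (3 - x\<^sup>2 / 2)"
proof -
  interpret sw: small_walk M "scaled \<kappa> n x" n "x\<^sup>2" m by (rule sw)
  define \<Lambda> where "\<Lambda> = exp (x\<^sup>2 / (2 * n) + 3 * m / n)"
  have \<Lambda>: "1 \<le> \<Lambda>" unfolding \<Lambda>_def using sw.m by (simp add: add_nonneg_nonneg)
  have \<Lambda>n: "exp (- x\<^sup>2) * \<Lambda> ^ n \<le> exp (3 - x\<^sup>2 / 2)"
  proof -
    have "\<Lambda> ^ n = exp (x\<^sup>2 / 2 + 3 * m)"
      unfolding \<Lambda>_def exp_of_nat_mult[symmetric] using sw.n by (simp add: field_simps)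
    then show ?thesis using sw.m by (simp flip: exp_add)
  qed
  have *: "prob {\<omega>\<in>space M. \<exists>k\<le>n. x\<^sup>2 \<le> partial_sum (\<lambda>i \<omega>. s * Z' i \<omega>) k \<omega>} \<le> exp (3 - x\<^sup>2 / 2)" if s: "s = 1 \<or> s = - 1" for s :: real
  proof (rule order_trans[OF max_chernoff[of _ \<Lambda>] \<Lambda>n])
    \<comment> \<open>The map applied to an increment may depend on its index, so erasing increment
      j preserves independence.\<close>
    have "(\<lambda>i \<omega>. s * Z' i \<omega>) = (\<lambda>i \<omega>. (if i = j then (\<lambda>z. 0) else (\<lambda>z. s * z)) (scaled \<kappa> n x i \<omega>))"
      by (auto simp: Z'_def fun_eq_iff)
    then show "indep_vars (\<lambda>_. borel) (\<lambda>i \<omega>. s * Z' i \<omega>) UNIV"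
      by (simp only:) (rule indep_vars_compose2[OF sw.ind], auto)
    show "\<bar>s * Z' i \<omega>\<bar> \<le> 1" for i \<omega> using s sw.Z1[of i \<omega>] by (auto simp: Z'_def)
    show "expectation (\<lambda>\<omega>. exp (s * Z' i \<omega>)) \<le> \<Lambda>" for i
    proof (cases "i = j")
      case True
      then show ?thesis using \<Lambda> by (simp add: Z'_def prob_space)
    next
      case False
      then show ?thesis using s sw.mgf1[of i] small_walk.mgf1[OF sw.uminus_walk, of i] by (auto simp: Z'_def \<Lambda>_def)
    qed
    show "0 < x\<^sup>2" by (rule sw.v)
  qed (rule \<Lambda>)
  have psm: "partial_sum (\<lambda>i \<omega>. s * Z' i \<omega>) k \<omega> = s * partial_sum Z' k \<omega>" for s k \<omega>
    by (simp add: partial_sum_def sum_distrib_left)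
  have [measurable]: "Z' i \<in> borel_measurable M" for i unfolding Z'_def by (cases "i = j") auto
  have [measurable]: "partial_sum Z' k \<in> borel_measurable M" for k by measurable
  have "prob {\<omega>\<in>space M. \<exists>k\<le>n. x\<^sup>2 \<le> \<bar>partial_sum Z' k \<omega>\<bar>} \<le>
    prob ({\<omega>\<in>space M. \<exists>k\<le>n. x\<^sup>2 \<le> partial_sum Z' k \<omega>} \<union> {\<omega>\<in>space M. \<exists>k\<le>n. x\<^sup>2 \<le> - partial_sum Z' k \<omega>})"
    by (intro finite_measure_mono) (auto simp: abs_if split: if_splits)
  also have "\<dots> \<le> prob {\<omega>\<in>space M. \<exists>k\<le>n. x\<^sup>2 \<le> partial_sum Z' k \<omega>} + prob {\<omega>\<in>space M. \<exists>k\<le>n. x\<^sup>2 \<le> - partial_sum Z' k \<omega>}"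
    by (intro measure_Un_le) auto
  also have "\<dots> \<le> exp (3 - x\<^sup>2 / 2) + exp (3 - x\<^sup>2 / 2)"
    using *[of 1] *[of "-1"] unfolding psm by (intro add_mono) auto
  finally show ?thesis by simp
qed

text \<open>The event on which truncation may change a deviation event.\<close>

definition jump_event :: "real \<Rightarrow> nat \<Rightarrow> real \<Rightarrow> 'a set" where
  "jump_event \<tau> n \<theta> = {\<omega>\<in>space M. (\<exists>j\<in>{1..n}. \<tau> \<le> \<bar>X j \<omega>\<bar>) \<and>
     (\<exists>k\<le>n. \<theta> \<le> \<bar>partial_sum X k \<omega>\<bar> \<or> \<theta> \<le> \<bar>partial_sum (\<lambda>i \<omega>. trunc \<tau> (X i \<omega>)) k \<omega>\<bar>)}"

text \<open>Union over the position j of a large increment, with the three alternatives of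
  \<open>jump_decomposition\<close>. In \<open>B\<close> and \<open>C\<close> independence splits
  off the probability \<open>q\<close> of a large increment. Level times \<beta> equals \<kappa> y
  sqrt 2 times n, which keeps the prefactor from \<open>jump_sum_tail\<close> bounded.\<close>

lemma jump_event_prob:
  assumes \<kappa>: "0 < \<kappa>" and n: "0 < n" and g: "0 < g" and y: "0 < y" and x: "x = g * sqrt (2 * LgLg (real n))"
    and sw: "small_walk M (scaled \<kappa> n x) n (x\<^sup>2) e" and vh: "tail_moment (level \<kappa> n) \<le> vh" "0 < vh" "vh \<le> 1"
  shows "prob (jump_event (level \<kappa> n) n (\<sigma> * g * phi n + real (Suc m) * (y * phi n))) \<le>
    n * (prob {\<omega>\<in>space M. y * phi n \<le> \<bar>X 0 \<omega>\<bar>} + prob {\<omega>\<in>space M. level \<kappa> n \<le> \<bar>X 0 \<omega>\<bar>} *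
      (exp (1 / (\<kappa> * y * sqrt 2)) * vh ^ m + 2 * exp (3 - g\<^sup>2 * LgLg (real n))))"
proof -
  define \<tau> where "\<tau> = level \<kappa> n"
  define \<beta> where "\<beta> = y * phi n"
  define L where "L = LgLg (real n)"
  have L: "0 < L" by (simp add: L_def)
  have \<tau>: "0 < \<tau>" using level_pos[OF \<kappa> n] by (simp add: \<tau>_def)
  have phi: "phi n = sqrt n * sqrt (2 * L)" by (simp add: phi_def L_def real_sqrt_mult)
  have phi0: "0 < phi n" using n L by (simp add: phi)
  have \<beta>: "0 < \<beta>" using y phi0 by (simp add: \<beta>_def)
  have \<tau>\<beta>: "n / (\<tau> * \<beta>) = 1 / (\<kappa> * y * sqrt 2)"
  proof -
    have "\<tau> * \<beta> = sqrt n * sqrt n * (\<kappa> * y * sqrt 2)"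
      using n L by (simp add: \<tau>_def \<beta>_def level_def phi L_def[symmetric] real_sqrt_mult real_sqrt_divide)
    then have "\<tau> * \<beta> = n * (\<kappa> * y * sqrt 2)" by simp
    then show ?thesis using n by simp
  qed
  have x2: "x\<^sup>2 = 2 * (g\<^sup>2 * L)" using L by (simp add: x L_def power_mult_distrib)
  have x0: "0 < x" using g L by (simp add: x L_def)
  define J where "J = (\<lambda>u. if \<tau> \<le> \<bar>u\<bar> \<and> \<bar>u\<bar> < \<beta> then \<bar>u\<bar> else 0)"
  have [measurable]: "J \<in> borel_measurable borel" unfolding J_def by measurable
  define \<theta> where "\<theta> = \<sigma> * g * phi n + real (Suc m) * \<beta>"
  define q where "q = prob {\<omega>\<in>space M. \<tau> \<le> \<bar>X 0 \<omega>\<bar>}"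
  define A where "A = (\<lambda>j. {\<omega>\<in>space M. \<beta> \<le> \<bar>X j \<omega>\<bar>})"
  define B where "B = (\<lambda>j. {\<omega>\<in>space M. \<tau> \<le> \<bar>X j \<omega>\<bar> \<and> real m * \<beta> \<le> (\<Sum>i\<in>{1..n}-{j}. J (X i \<omega>))})"
  define C where "C = (\<lambda>j. {\<omega>\<in>space M. \<tau> \<le> \<bar>X j \<omega>\<bar> \<and> (\<exists>k\<le>n. \<sigma> * g * phi n \<le> \<bar>\<Sum>i\<in>{1..k}. if i = j then 0 else trunc \<tau> (X i \<omega>)\<bar>)})"
  have sets: "A j \<in> events" "B j \<in> events" "C j \<in> events" for j
  proof -
    show "A j \<in> events" "B j \<in> events" unfolding A_def B_def by measurable
    have [measurable]: "(\<lambda>\<omega>. if i = j then 0 else trunc \<tau> (X i \<omega>)) \<in> borel_measurable M" for i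
      by (cases "i = j") auto
    show "C j \<in> events" unfolding C_def by measurable
  qed
  have sub: "jump_event \<tau> n \<theta> \<subseteq> (\<Union>j\<in>{1..n}. A j \<union> (B j \<union> C j))"
  proof
    fix \<omega> assume "\<omega> \<in> jump_event \<tau> n \<theta>"
    then obtain j k where *: "\<omega> \<in> space M" "j \<in> {1..n}" "\<tau> \<le> \<bar>X j \<omega>\<bar>" "k \<le> n"
      "\<theta> \<le> \<bar>\<Sum>i\<in>{1..k}. X i \<omega>\<bar> \<or> \<theta> \<le> \<bar>\<Sum>i\<in>{1..k}. trunc \<tau> (X i \<omega>)\<bar>"
      by (auto simp: jump_event_def partial_sum_def)
    have "\<theta> - real (Suc m) * \<beta> = \<sigma> * g * phi n" by (simp add: \<theta>_def)
    with jump_decomposition[OF *(2,3) less_imp_le[OF \<beta>] *(4,5), of m] *(1)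
    show "\<omega> \<in> (\<Union>j\<in>{1..n}. A j \<union> (B j \<union> C j))"
      unfolding A_def B_def C_def J_def by auto
  qed
  have pA: "prob (A j) = prob {\<omega>\<in>space M. \<beta> \<le> \<bar>X 0 \<omega>\<bar>}" for j
    unfolding A_def by (rule prob_tail_ident)
  have qj: "prob {\<omega>\<in>space M. X j \<omega> \<in> {u. \<tau> \<le> \<bar>u\<bar>}} = q" for j
    unfolding q_def using prob_tail_ident[of \<tau> j] by simp
  have q0: "0 \<le> q" by (simp add: q_def)
  have pB: "prob (B j) \<le> q * (exp (1 / (\<kappa> * y * sqrt 2)) * vh ^ m)" if j: "j \<in> {1..n}" for j
  proof -
    let ?I = "{1..n} - {j}"
    define R where "R = {f \<in> space (PiM ?I (\<lambda>_. borel)). real m * \<beta> \<le> (\<Sum>i\<in>?I. J (f i))}"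
    have R: "R \<in> sets (PiM ?I (\<lambda>_. borel))" unfolding R_def by measurable
    have Riff: "(\<lambda>i\<in>?I. X i \<omega>) \<in> R \<longleftrightarrow> real m * \<beta> \<le> (\<Sum>i\<in>?I. J (X i \<omega>))" for \<omega>
      by (auto simp: R_def space_PiM)
    have "prob (B j) = prob {\<omega>\<in>space M. X j \<omega> \<in> {u. \<tau> \<le> \<bar>u\<bar>} \<and> (\<lambda>i\<in>?I. X i \<omega>) \<in> R}"
      unfolding B_def Riff by simp
    also have "\<dots> = q * prob {\<omega>\<in>space M. real m * \<beta> \<le> (\<Sum>i\<in>?I. J (X i \<omega>))}"
      using indep_coordinate[OF indep, of j ?I "{u. \<tau> \<le> \<bar>u\<bar>}" R] R unfolding qj Riff by simp
    also have "\<dots> \<le> q * (exp (n / (\<tau> * \<beta>)) * vh ^ m)"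
      unfolding J_def using \<tau> \<beta> vh j by (intro mult_left_mono jump_sum_tail q0) (auto simp: \<tau>_def)
    finally show ?thesis by (simp add: \<tau>\<beta>)
  qed
  have pC: "prob (C j) \<le> q * (2 * exp (3 - g\<^sup>2 * L))" if j: "j \<in> {1..n}" for j
  proof -
    let ?I = "{1..n} - {j}"
    define R where "R = {f \<in> space (PiM ?I (\<lambda>_. borel)). \<exists>k\<in>{..n}. \<sigma> * g * phi n \<le> \<bar>\<Sum>i\<in>{1..k} - {j}. trunc \<tau> (f i)\<bar>}"
    have R: "R \<in> sets (PiM ?I (\<lambda>_. borel))"
    proof -
      have "(\<lambda>f. \<Sum>i\<in>{1..k} - {j}. trunc \<tau> (f i)) \<in> borel_measurable (PiM ?I (\<lambda>_. borel))" if "k \<in> {..n}" for k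
        proof (intro borel_measurable_sum measurable_compose[OF _ trunc_measurable])
        fix i assume "i \<in> {1..k} - {j}"
        then have "i \<in> ?I" using that by auto
        then show "(\<lambda>f. f i) \<in> borel_measurable (PiM ?I (\<lambda>_. borel))"
          by (rule measurable_component_singleton)
      qed
      then show ?thesis unfolding R_def pred_def[symmetric] by (intro pred_intros_finite) measurable
    qed
    have sumeq: "(\<Sum>i\<in>{1..k}. if i = j then 0 else f i) = (\<Sum>i\<in>{1..k} - {j}. f i)" for k and f :: "nat \<Rightarrow> real"
      by (rule sum.mono_neutral_cong_right) auto
    have Riff: "(\<lambda>i\<in>?I. X i \<omega>) \<in> R \<longleftrightarrow> (\<exists>k\<le>n. \<sigma> * g * phi n \<le> \<bar>\<Sum>i\<in>{1..k}. if i = j then 0 else trunc \<tau> (X i \<omega>)\<bar>)" for \<omega>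
    proof -
      have "(\<Sum>i\<in>{1..k} - {j}. trunc \<tau> ((\<lambda>i\<in>?I. X i \<omega>) i)) = (\<Sum>i\<in>{1..k} - {j}. trunc \<tau> (X i \<omega>))" if "k \<le> n" for k
        using that by (intro sum.cong) auto
      then show ?thesis unfolding sumeq by (auto simp: R_def space_PiM)
    qed
    have "prob (C j) = prob {\<omega>\<in>space M. X j \<omega> \<in> {u. \<tau> \<le> \<bar>u\<bar>} \<and> (\<lambda>i\<in>?I. X i \<omega>) \<in> R}"
      unfolding C_def Riff by simp
    also have "\<dots> = q * prob {\<omega>\<in>space M. \<exists>k\<le>n. \<sigma> * g * phi n \<le> \<bar>\<Sum>i\<in>{1..k}. if i = j then 0 else trunc \<tau> (X i \<omega>)\<bar>}"
      using indep_coordinate[OF indep, of j ?I "{u. \<tau> \<le> \<bar>u\<bar>}" R] R unfolding qj Riff by simp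
    also have "{\<omega>\<in>space M. \<exists>k\<le>n. \<sigma> * g * phi n \<le> \<bar>\<Sum>i\<in>{1..k}. if i = j then 0 else trunc \<tau> (X i \<omega>)\<bar>}
       = {\<omega>\<in>space M. \<exists>k\<le>n. x\<^sup>2 \<le> \<bar>partial_sum (\<lambda>i \<omega>. if i = j then 0 else scaled \<kappa> n x i \<omega>) k \<omega>\<bar>}"
    proof -
      have "x\<^sup>2 \<le> \<bar>partial_sum (\<lambda>i \<omega>. if i = j then 0 else scaled \<kappa> n x i \<omega>) k \<omega>\<bar> \<longleftrightarrow>
         \<sigma> * g * phi n \<le> \<bar>\<Sum>i\<in>{1..k}. if i = j then 0 else trunc \<tau> (X i \<omega>)\<bar>" for k \<omega>
      proof -
        define S where "S = (\<Sum>i\<in>{1..k}. if i = j then 0 else trunc \<tau> (X i \<omega>))"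
        have "partial_sum (\<lambda>i \<omega>. if i = j then 0 else scaled \<kappa> n x i \<omega>) k \<omega> = x / (\<sigma> * sqrt n) * S"
          unfolding S_def partial_sum_def sum_distrib_left by (intro sum.cong) (auto simp: scaled_def \<tau>_def)
        then have "x\<^sup>2 \<le> \<bar>partial_sum (\<lambda>i \<omega>. if i = j then 0 else scaled \<kappa> n x i \<omega>) k \<omega>\<bar> \<longleftrightarrow> x * (\<sigma> * sqrt n * x) \<le> x * \<bar>S\<bar>"
          using n sigma_pos x0 by (simp add: abs_mult pos_le_divide_eq power2_eq_square mult_ac)
        also have "\<dots> \<longleftrightarrow> \<sigma> * sqrt n * x \<le> \<bar>S\<bar>" using x0 by (intro mult_le_cancel_left_pos)
        also have "\<sigma> * sqrt n * x = \<sigma> * g * phi n" by (simp add: x phi L_def)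
        finally show ?thesis by (simp add: S_def)
      qed
      then show ?thesis by simp
    qed
    also have "q * prob \<dots> \<le> q * (2 * exp (3 - x\<^sup>2 / 2))"
      by (intro mult_left_mono skipped_walk_tail[OF sw] q0)
    finally show ?thesis by (simp add: x2)
  qed
  have "prob (jump_event \<tau> n \<theta>) \<le> prob (\<Union>j\<in>{1..n}. A j \<union> (B j \<union> C j))"
    using sets by (intro finite_measure_mono sub) auto
  also have "\<dots> \<le> (\<Sum>j\<in>{1..n}. prob (A j \<union> (B j \<union> C j)))"
    using sets by (intro finite_measure_subadditive_finite) auto
  also have "\<dots> \<le> (\<Sum>j\<in>{1..n}. prob {\<omega>\<in>space M. \<beta> \<le> \<bar>X 0 \<omega>\<bar>} + q * (exp (1 / (\<kappa> * y * sqrt 2)) * vh ^ m + 2 * exp (3 - g\<^sup>2 * L)))"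
  proof (rule sum_mono)
    fix j assume j: "j \<in> {1..n}"
    have "prob (A j \<union> (B j \<union> C j)) \<le> prob (A j) + prob (B j \<union> C j)"
      using sets by (intro measure_Un_le) auto
    also have "prob (B j \<union> C j) \<le> prob (B j) + prob (C j)"
      using sets by (intro measure_Un_le) auto
    finally show "prob (A j \<union> (B j \<union> C j)) \<le> prob {\<omega>\<in>space M. \<beta> \<le> \<bar>X 0 \<omega>\<bar>} + q * (exp (1 / (\<kappa> * y * sqrt 2)) * vh ^ m + 2 * exp (3 - g\<^sup>2 * L))"
      using pA[of j] pB[OF j] pC[OF j] unfolding distrib_left by linarith
  qed
  finally show ?thesis by (simp add: \<theta>_def \<beta>_def \<tau>_def q_def L_def)
qed

end

section \<open>Jump errors under the weighted moment condition\<close>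

locale iid_moment = iid_walk +
  fixes a b :: real
  assumes moment: "integrable M (\<lambda>\<omega>. (X 0 \<omega>)\<^sup>2 * wt a (b - 1) \<bar>X 0 \<omega>\<bar>)"
begin

lemma eventually_level_tail_moment:
  assumes \<kappa>: "0 < \<kappa>" shows "\<forall>\<^sub>F n in sequentially. tail_moment (level \<kappa> n) \<le> tail_moment (real n powr (1/4))"
  using eventually_level_ge[OF \<kappa>] by eventually_elim (rule tail_moment_antimono)

text \<open>Markov's inequality with the weight; lowering the exponent from a to 3a/4 absorbs the
  power of log log, whose sign is arbitrary.\<close>

lemma tail_moment_log_bound:
  assumes a: "0 < a"
  shows "\<exists>K>0. \<forall>\<^sub>F t in at_top. tail_moment t \<le> K * Lg t powr (- (3 * a / 4))"
proof -
  have "\<forall>\<^sub>F x in at_top. ln x powr (3 * a / 4) \<le> ln x powr a * ln (ln x) powr (b - 1)"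
    using a by real_asymp
  with eventually_Lg_eq eventually_LgLg_eq
  have "\<forall>\<^sub>F x in at_top. Lg x powr (3 * a / 4) \<le> wt a (b - 1) x"
    by eventually_elim (simp add: wt_def)
  then obtain x1 where x1: "\<And>x. x1 \<le> x \<Longrightarrow> Lg x powr (3 * a / 4) \<le> wt a (b - 1) x"
    by (auto simp: eventually_at_top_linorder)
  define K where "K = expectation (\<lambda>\<omega>. (X 0 \<omega>)\<^sup>2 * wt a (b - 1) \<bar>X 0 \<omega>\<bar>) + 1"
  have K: "0 < K" unfolding K_def by (intro add_nonneg_pos Bochner_Integration.integral_nonneg mult_nonneg_nonneg wt_nonneg) auto
  have "tail_moment t \<le> K * Lg t powr (- (3 * a / 4))" if t: "x1 \<le> t" for t
  proof -
    have "tail_moment t * Lg t powr (3 * a / 4) = expectation (\<lambda>\<omega>. (if t \<le> \<bar>X 0 \<omega>\<bar> then (X 0 \<omega>)\<^sup>2 else 0) * Lg t powr (3 * a / 4))"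
      unfolding tail_moment_def by simp
    also have "\<dots> \<le> expectation (\<lambda>\<omega>. (X 0 \<omega>)\<^sup>2 * wt a (b - 1) \<bar>X 0 \<omega>\<bar>)"
    proof (rule integral_mono[OF _ moment])
      show "integrable M (\<lambda>\<omega>. (if t \<le> \<bar>X 0 \<omega>\<bar> then (X 0 \<omega>)\<^sup>2 else 0) * Lg t powr (3 * a / 4))"
        by (intro integrable_mult_left tail_moment_integrable)
      fix \<omega>
      show "(if t \<le> \<bar>X 0 \<omega>\<bar> then (X 0 \<omega>)\<^sup>2 else 0) * Lg t powr (3 * a / 4) \<le> (X 0 \<omega>)\<^sup>2 * wt a (b - 1) \<bar>X 0 \<omega>\<bar>"
      proof (cases "t \<le> \<bar>X 0 \<omega>\<bar>")
        case True
        have "Lg t powr (3 * a / 4) \<le> Lg \<bar>X 0 \<omega>\<bar> powr (3 * a / 4)" using a True by (intro powr_mono2 Lg_mono) auto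
        also have "\<dots> \<le> wt a (b - 1) \<bar>X 0 \<omega>\<bar>" using True t by (intro x1) auto
        finally show ?thesis using True by (simp add: mult_left_mono)
      qed (simp add: wt_nonneg)
    qed
    finally have "tail_moment t * Lg t powr (3 * a / 4) \<le> K" by (simp add: K_def)
    moreover have "0 < Lg t powr (3 * a / 4)" by (simp add: less_imp_neq[OF Lg_pos, symmetric])
    ultimately show ?thesis unfolding powr_minus by (simp add: pos_le_divide_eq flip: divide_inverse)
  qed
  then show ?thesis using K by (auto simp: eventually_at_top_linorder)
qed

text \<open>A power of the tail moment has to push the weight down to 1 / log log n. For a > 0 the
  moment gives vh = (log n)^(-a/2), whose cube beats (log n)^a. For a <= 0 the weight is at most a
  power of log log n, and the tail condition supplies factors 1 / log log n.\<close>

lemma tail_envelope: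
  assumes \<kappa>: "0 < \<kappa>"
  shows "\<exists>vh m. \<forall>\<^sub>F n in sequentially. tail_moment (level \<kappa> n) \<le> vh n \<and> 0 < vh n \<and> vh n \<le> 1 \<and>
    wt a b (real n) * vh n ^ m \<le> 1 / LgLg (real n)"
proof (cases "0 < a")
  case True
  obtain K where K: "0 < K" and VK: "\<forall>\<^sub>F t in at_top. tail_moment t \<le> K * Lg t powr (- (3 * a / 4))"
    using tail_moment_log_bound[OF True] by blast
  have root: "filterlim (\<lambda>n. real n powr (1/4)) at_top sequentially" by real_asymp
  have "\<forall>\<^sub>F n in sequentially. tail_moment (real n powr (1/4)) \<le> K * Lg (real n powr (1/4)) powr (- (3 * a / 4))"
    by (rule eventually_compose_filterlim[OF VK root])
  moreover have "\<forall>\<^sub>F n in sequentially. Lg (real n powr (1/4)) = ln (real n powr (1/4))"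
    by (rule eventually_compose_filterlim[OF eventually_Lg_eq root])
  \<comment> \<open>Passing from the exponent 3a/4 to a/2 absorbs \<open>K\<close> and the fourth
    root.\<close>
  moreover have "\<forall>\<^sub>F n in sequentially. K * ln (real n powr (1/4)) powr (- (3 * a / 4)) \<le> ln (real n) powr (- (a / 2))"
    using True K by real_asymp
  moreover have "\<forall>\<^sub>F n in sequentially. ln (real n) powr (a - 3 * (a / 2)) * ln (ln (real n)) powr b \<le> 1 / ln (ln (real n))"
    using True by real_asymp
  moreover note eventually_level_tail_moment[OF \<kappa>] eventually_Lg_nat eventually_LgLg_nat
  ultimately have "\<forall>\<^sub>F n in sequentially. tail_moment (level \<kappa> n) \<le> Lg (real n) powr (- (a / 2)) \<and> 0 < Lg (real n) powr (- (a / 2)) \<and> Lg (real n) powr (- (a / 2)) \<le> 1 \<and>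
    wt a b (real n) * (Lg (real n) powr (- (a / 2))) ^ 3 \<le> 1 / LgLg (real n)"
  proof eventually_elim
    case (elim n)
    have pos: "0 < Lg (real n)" by simp
    have "(Lg (real n) powr (- (a / 2))) ^ 3 = Lg (real n) powr (- (3 * (a / 2)))"
      unfolding numeral_3_eq_3 using pos by (simp flip: powr_add)
    then have "wt a b (real n) * (Lg (real n) powr (- (a / 2))) ^ 3 = Lg (real n) powr a * Lg (real n) powr (- (3 * (a / 2))) * LgLg (real n) powr b"
      by (simp add: wt_def)
    also have "Lg (real n) powr a * Lg (real n) powr (- (3 * (a / 2))) = Lg (real n) powr (a - 3 * (a / 2))"
      by (subst powr_add[symmetric]) simp
    finally have "wt a b (real n) * (Lg (real n) powr (- (a / 2))) ^ 3 \<le> 1 / LgLg (real n)" using elim by simp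
    moreover have "Lg (real n) powr (- (a / 2)) \<le> 1"
      using True Lg_ge_1[of "real n"] by (simp add: powr_minus inverse_le_1_iff ge_one_powr_ge_zero)
    moreover have "0 < Lg (real n) powr (- (a / 2))" using pos by (simp add: less_imp_neq[OF Lg_pos, symmetric])
    moreover have "tail_moment (level \<kappa> n) \<le> Lg (real n) powr (- (a / 2))"
      using elim(5,1,3) unfolding elim(2,6) by linarith
    ultimately show ?case by blast
  qed
  then show ?thesis by (intro exI[of _ "\<lambda>n. Lg (real n) powr (- (a / 2))"] exI[of _ 3])
next
  case False
  \<comment> \<open>Gives m >= b + 1 for either sign of b, so that (log log n)^(b-m) is at most 1 /
    log log n.\<close>
  define m where "m = nat \<lceil>b\<rceil> + 1"
  have m: "b + 1 \<le> real m" unfolding m_def by (auto simp: nat_le_iff) linarith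
  have "\<forall>\<^sub>F n in sequentially. tail_moment (real n powr (1/4)) * LgLg (real n) < 1"
    using order_tendstoD(2)[OF tail_moment_LgLg_lim] by simp
  with eventually_level_tail_moment[OF \<kappa>]
  have "\<forall>\<^sub>F n in sequentially. tail_moment (level \<kappa> n) \<le> 1 / LgLg (real n) \<and> 0 < 1 / LgLg (real n) \<and> 1 / LgLg (real n) \<le> 1 \<and>
    wt a b (real n) * (1 / LgLg (real n)) ^ m \<le> 1 / LgLg (real n)"
  proof eventually_elim
    case (elim n)
    define L where "L = LgLg (real n)"
    have L: "0 < L" "1 \<le> L" using LgLg_ge_1[of "real n"] by (auto simp: L_def)
    have "tail_moment (real n powr (1/4)) \<le> 1 / L" using elim L by (simp add: pos_le_divide_eq L_def)
    moreover have "wt a b (real n) * (1 / L) ^ m \<le> 1 / L"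
    proof -
      have "Lg (real n) powr a \<le> Lg (real n) powr 0" using False Lg_ge_1[of "real n"] by (intro powr_mono) auto
      moreover have "Lg (real n) powr 0 = 1" by (simp add: less_imp_neq[OF Lg_pos, symmetric])
      ultimately have "Lg (real n) powr a \<le> 1" by (simp only:)
      then have "wt a b (real n) * (1 / L) ^ m \<le> L powr b * (1 / L) ^ m"
        unfolding wt_def L_def[symmetric] using L mult_right_mono[of "Lg (real n) powr a" 1 "L powr b"]
        by (intro mult_right_mono) auto
      also have "L powr b * (1 / L) ^ m = L powr (b - real m)"
        using L by (simp add: powr_diff powr_realpow power_divide)
      also have "\<dots> \<le> L powr (- 1)" using m L by (intro powr_mono) auto
      also have "\<dots> = 1 / L" using L by (simp add: powr_minus_divide)
      finally show ?thesis .
    qed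
    ultimately show ?case using elim L by (auto simp: L_def)
  qed
  then show ?thesis by (intro exI[of _ "\<lambda>n. 1 / LgLg (real n)"] exI[of _ m])
qed

text \<open>There is room for g between sqrt (max a 0) and g0. A truncated walk that still reaches g
  costs (log n)^(-g^2) with g^2 > a, which beats the weight; the gap g0 - g is divided into m + 1
  portions for the large increments. What remains is summable by \<open>summable_large_jumps\<close>
  and \<open>summable_level\<close>.\<close>

lemma jump_error_summable:
  assumes \<kappa>: "0 < \<kappa>" and g0: "0 < g0" "a < g0\<^sup>2" and g\<kappa>: "g0 * sqrt 2 * \<kappa> / \<sigma> \<le> 1"
  shows "\<exists>e. summable e \<and> (\<forall>n. 0 \<le> e n) \<and>
    (\<forall>\<^sub>F n in sequentially. wt a b (real n) / n * prob (jump_event (level \<kappa> n) n (\<sigma> * g0 * phi (real n))) \<le> e n)"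
proof -
  have "sqrt (max a 0) < g0" using g0 by (intro real_less_lsqrt) auto
  then obtain g where g: "sqrt (max a 0) < g" "g < g0" using dense by blast
  have gpos: "0 < g" using g(1) by (rule order_le_less_trans[rotated]) simp
  have ga: "a < g\<^sup>2"
  proof -
    have "(sqrt (max a 0))\<^sup>2 < g\<^sup>2" using g by (intro power_strict_mono) auto
    then show ?thesis by simp
  qed
  obtain vh m where env: "\<forall>\<^sub>F n in sequentially. tail_moment (level \<kappa> n) \<le> vh n \<and> 0 < vh n \<and> vh n \<le> 1 \<and>
    wt a b (real n) * vh n ^ m \<le> 1 / LgLg (real n)" using tail_envelope[OF \<kappa>] by blast
  define y where "y = \<sigma> * (g0 - g) / real (Suc m)"
  have y: "0 < y" using g sigma_pos by (simp add: y_def)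
  define K where "K = exp (1 / (\<kappa> * y * sqrt 2))"
  define e where "e = (\<lambda>n. wt a b (real n) * prob {\<omega>\<in>space M. y * phi (real n) \<le> \<bar>X 0 \<omega>\<bar>} +
    (K + 2 * exp 3) * (1 / LgLg (real n) * prob {\<omega>\<in>space M. level \<kappa> n \<le> \<bar>X 0 \<omega>\<bar>}))"
  have "summable (\<lambda>n. e (Suc n))"
    unfolding e_def by (intro summable_add summable_mult summable_large_jumps[OF y moment] summable_level[OF \<kappa>])
  then have "summable e" by (simp only: summable_Suc_iff)
  moreover have "0 \<le> e n" for n
    unfolding e_def K_def using wt_nonneg by (intro add_nonneg_nonneg mult_nonneg_nonneg) auto
  moreover have "\<forall>\<^sub>F n in sequentially. wt a b (real n) / n * prob (jump_event (level \<kappa> n) n (\<sigma> * g0 * phi (real n))) \<le> e n"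
  proof -
    have "\<forall>\<^sub>F n in sequentially. \<forall>x. 0 < x \<and> x \<le> (g * sqrt 2) * sqrt (LgLg (real n)) \<longrightarrow> small_walk M (scaled \<kappa> n x) n (x\<^sup>2) (err \<kappa> (g * sqrt 2) n)"
    proof (rule scaled_small_walk[OF \<kappa>])
      have "g * sqrt 2 * \<kappa> / \<sigma> \<le> g0 * sqrt 2 * \<kappa> / \<sigma>"
        using g \<kappa> sigma_pos by (intro divide_right_mono mult_right_mono) auto
      then show "g * sqrt 2 * \<kappa> / \<sigma> \<le> 1" using g\<kappa> by simp
    qed (use gpos in auto)
    moreover have "\<forall>\<^sub>F n in sequentially. ln (real n) powr (a - g\<^sup>2) * ln (ln (real n)) powr b \<le> 1 / ln (ln (real n))"
    proof -
      define d where "d = g\<^sup>2 - a"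
      have d: "0 < d" using ga by (simp add: d_def)
      then have "\<forall>\<^sub>F n in sequentially. ln (real n) powr (- d) * ln (ln (real n)) powr b \<le> 1 / ln (ln (real n))"
        by real_asymp
      then show ?thesis by (simp add: d_def)
    qed
    moreover note env eventually_Lg_nat eventually_LgLg_nat eventually_gt_at_top[of 3]
    ultimately show ?thesis
    proof eventually_elim
      case (elim n)
      define L where "L = LgLg (real n)"
      have L: "0 < L" by (simp add: L_def)
      have n: "0 < n" using elim by simp
      define x where "x = g * sqrt (2 * LgLg (real n))"
      have sw: "small_walk M (scaled \<kappa> n x) n (x\<^sup>2) (err \<kappa> (g * sqrt 2) n)"
        using elim(1) gpos by (auto simp: x_def real_sqrt_mult)
      have thr: "\<sigma> * g * phi n + real (Suc m) * (y * phi n) = \<sigma> * g0 * phi n"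
      proof -
        have "real (Suc m) * (y * phi n) = (real (Suc m) * y) * phi n" by (simp only: mult.assoc)
        also have "real (Suc m) * y = \<sigma> * (g0 - g)" by (simp add: y_def)
        finally show ?thesis by (simp only:) (simp add: algebra_simps)
      qed
      define pA where "pA = prob {\<omega>\<in>space M. y * phi (real n) \<le> \<bar>X 0 \<omega>\<bar>}"
      define q where "q = prob {\<omega>\<in>space M. level \<kappa> n \<le> \<bar>X 0 \<omega>\<bar>}"
      have q0: "0 \<le> q" by (simp add: q_def)
      have exp_eq: "wt a b (real n) * exp (- (g\<^sup>2 * L)) \<le> 1 / L"
      proof -
        have ln0: "0 < ln (real n)" using elim by simp
        have "exp (- (g\<^sup>2 * L)) = Lg (real n) powr (- (g\<^sup>2))" using ln0 elim by (simp add: L_def powr_def)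
        then have "wt a b (real n) * exp (- (g\<^sup>2 * L)) = Lg (real n) powr a * Lg (real n) powr (- (g\<^sup>2)) * LgLg (real n) powr b"
          by (simp add: wt_def)
        also have "Lg (real n) powr a * Lg (real n) powr (- (g\<^sup>2)) = Lg (real n) powr (a - g\<^sup>2)"
          by (subst powr_add[symmetric]) simp
        finally show ?thesis using elim by (simp add: L_def)
      qed
      have "wt a b (real n) / n * prob (jump_event (level \<kappa> n) n (\<sigma> * g0 * phi (real n))) \<le>
         wt a b (real n) / n * (n * (pA + q * (K * vh n ^ m + 2 * exp (3 - g\<^sup>2 * L))))"
        using jump_event_prob[OF \<kappa> n gpos y x_def sw, of "vh n" m] elim wt_nonneg[of a b "real n"] unfolding thr
        by (intro mult_left_mono) (auto simp: pA_def q_def K_def L_def)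
      also have "\<dots> = wt a b (real n) * pA + q * (K * (wt a b (real n) * vh n ^ m) + 2 * exp 3 * (wt a b (real n) * exp (- (g\<^sup>2 * L))))"
        using n exp_add[of 3 "- (g\<^sup>2 * L)"] by (simp add: algebra_simps)
      also have "\<dots> \<le> wt a b (real n) * pA + q * (K * (1 / L) + 2 * exp 3 * (1 / L))"
        using elim exp_eq q0 by (intro add_left_mono mult_left_mono add_mono) (auto simp: K_def L_def)
      also have "\<dots> = e n" by (simp add: e_def pA_def q_def L_def algebra_simps add_divide_distrib)
      finally show ?case .
    qed
  qed
  ultimately show ?thesis by blast
qed

end

section \<open>The deterministic series\<close>

definition gamma_density :: "real \<Rightarrow> real \<Rightarrow> real" where
  "gamma_density c t = indicator {0..} t * t powr c / exp t"

text \<open>The lower incomplete Gamma function with parameter c + 1, taken as a distribution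
  function so that its limits come from those of a finite measure.\<close>

definition gamma_cdf :: "real \<Rightarrow> real \<Rightarrow> real" where
  "gamma_cdf c = cdf (density lborel (gamma_density c))"

context
  fixes c :: real
  assumes c: "- 1 < c"
begin

lemma gamma_density_nonneg: "0 \<le> gamma_density c t"
  by (simp add: gamma_density_def)

lemma gamma_density_measurable [measurable]: "gamma_density c \<in> borel_measurable borel"
  unfolding gamma_density_def[abs_def] by measurable

lemma gamma_density_nn_integral: "(\<integral>\<^sup>+t. gamma_density c t \<partial>lborel) = ennreal (Gamma (c + 1))"
  using Gamma_conv_nn_integral_real[of "c + 1"] c by (simp add: gamma_density_def)

lemma gamma_density_integrable: "integrable lborel (gamma_density c)"
  using gamma_density_nonneg gamma_density_nn_integral by (intro integrableI_nonneg) auto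

lemma gamma_measure: "finite_borel_measure (density lborel (gamma_density c))"
  by (intro finite_borel_measure.intro finite_borel_measure_axioms.intro finite_measureI)
    (simp_all add: emeasure_density gamma_density_nn_integral)

text \<open>\<open>cdf_density_deriv\<close> asks for continuity only near t, which matters here:
  for c < 0 the density is unbounded at 0.\<close>

lemma gamma_cdf_deriv:
  assumes "0 < t" shows "(gamma_cdf c has_real_derivative t powr c / exp t) (at t)"
proof -
  have "continuous_on {t/2..t+1} (\<lambda>t. t powr c / exp t)"
    using assms by (intro continuous_intros) auto
  then have "continuous_on {t/2..t+1} (gamma_density c)"
    using assms by (subst continuous_on_cong[of _ _ _ "\<lambda>t. t powr c / exp t"]) (auto simp: gamma_density_def)
  from cdf_density_deriv[OF gamma_density_integrable gamma_density_nonneg this, of t] assms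
  show ?thesis by (simp add: gamma_cdf_def gamma_density_def)
qed

lemma gamma_cdf_at_top: "(gamma_cdf c \<longlongrightarrow> Gamma (c + 1)) at_top"
proof -
  interpret finite_borel_measure "density lborel (gamma_density c)" by (rule gamma_measure)
  have "measure (density lborel (gamma_density c)) UNIV = Gamma (c + 1)"
    using c Gamma_real_pos[of "c + 1"]
    by (simp add: measure_def emeasure_density gamma_density_nn_integral)
  then show ?thesis using cdf_lim_at_top by (simp add: gamma_cdf_def)
qed

lemma gamma_cdf_at_0: "(gamma_cdf c \<longlongrightarrow> 0) (at_right 0)"
proof -
  interpret finite_borel_measure "density lborel (gamma_density c)" by (rule gamma_measure)
  have "emeasure (density lborel (gamma_density c)) {..0} = (\<integral>\<^sup>+x. 0 \<partial>(lborel :: real measure))"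
  proof (subst emeasure_density)
    show "(\<integral>\<^sup>+x. ennreal (gamma_density c x) * indicator {..0} x \<partial>lborel) = (\<integral>\<^sup>+x. 0 \<partial>(lborel :: real measure))"
    proof (rule nn_integral_cong_AE)
      show "AE x in lborel. ennreal (gamma_density c x) * indicator {..0} x = 0"
        using AE_lborel_singleton[of "0::real"] by eventually_elim (auto simp: gamma_density_def indicator_def)
    qed
  qed auto
  then have "gamma_cdf c 0 = 0" by (simp add: gamma_cdf_def cdf_def measure_def)
  then show ?thesis using cdf_is_right_cont[of 0] by (simp add: gamma_cdf_def continuous_within)
qed

text \<open>The shape of the weighted Gaussian term for \<theta> = \<epsilon>^2 - a - 1 and c = b -
  1/2: (log n)^a exp (-\<epsilon>^2 log log n) is (log n)^(-1-\<theta>), and the 1/x of the tail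
  lowers the power of log log n by 1/2.\<close>

definition loglog_term :: "real \<Rightarrow> nat \<Rightarrow> real" where
  "loglog_term \<theta> n = Lg (real n) powr (- 1 - \<theta>) * LgLg (real n) powr c / real n"

lemma loglog_term_nonneg: "0 \<le> loglog_term \<theta> n"
  by (simp add: loglog_term_def)

text \<open>Since \<open>d (log log x) = dx / (x log x)\<close>, the terms are, up to factors tending to 1 uniformly
  in \<open>\<theta>\<close>, increments of the incomplete Gamma function along \<open>\<theta> log log n\<close>; so the series telescopes.\<close>

lemma loglog_term_increment:
  assumes \<eta>: "0 < \<eta>"
  shows "\<forall>\<^sub>F n in sequentially. \<forall>\<theta>. 0 < \<theta> \<and> \<theta> \<le> 1 \<longrightarrow>
    \<bar>(gamma_cdf c (\<theta> * LgLg (real (Suc n))) - gamma_cdf c (\<theta> * LgLg (real n))) - \<theta> powr (c + 1) * loglog_term \<theta> n\<bar> \<le> \<eta> * (\<theta> powr (c + 1) * loglog_term \<theta> n)"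
proof -
  \<comment> \<open>\<open>u\<close> compares the increment \<open>d\<close> of log log with 1 / (n
    log n); \<open>q\<close> bounds the ratio of an intermediate point to log log n.\<close>
  define d where "d = (\<lambda>n. ln (ln (real (Suc n))) - ln (ln (real n)))"
  define q where "q = (\<lambda>n. ln (ln (real (Suc n))) / ln (ln (real n)))"
  define u where "u = (\<lambda>n. real n * ln (real n) * d n)"
  have q: "q \<longlonglongrightarrow> 1" unfolding q_def by real_asymp
  have u: "u \<longlonglongrightarrow> 1" unfolding u_def d_def by real_asymp
  have d: "d \<longlonglongrightarrow> 0" unfolding d_def by real_asymp
  have lo: "(\<lambda>n. u n * q n powr (- \<bar>c\<bar>) * exp (- d n)) \<longlonglongrightarrow> 1 * 1 powr (- \<bar>c\<bar>) * exp (- 0)"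
    by (intro tendsto_intros u q d) auto
  have hi: "(\<lambda>n. u n * q n powr \<bar>c\<bar>) \<longlonglongrightarrow> 1 * 1 powr \<bar>c\<bar>"
    by (intro tendsto_intros u q) auto
  have "\<forall>\<^sub>F n in sequentially. 1 - \<eta> < u n * q n powr (- \<bar>c\<bar>) * exp (- d n)"
    using order_tendstoD(1)[OF lo, of "1 - \<eta>"] \<eta> by simp
  moreover have "\<forall>\<^sub>F n in sequentially. u n * q n powr \<bar>c\<bar> < 1 + \<eta>"
    using order_tendstoD(2)[OF hi, of "1 + \<eta>"] \<eta> by simp
  moreover have "\<forall>\<^sub>F n in sequentially. exp (exp 1) \<le> real n" by real_asymp
  ultimately show ?thesis
  proof eventually_elim
    case (elim n)
    have n: "1 < real n" using elim(3) by (smt (verit) exp_gt_one exp_gt_zero)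
    have eln: "exp 1 \<le> ln (real n)" using elim(3) n by (subst ln_ge_iff) auto
    have en: "exp 1 \<le> real n" using elim(3) exp_ge_add_one_self[of 1] by (smt (verit) exp_le_cancel_iff)
    have eln': "exp 1 \<le> ln (real (Suc n))" using eln n by (smt (verit) ln_le_cancel_iff of_nat_Suc)
    have Lg: "Lg (real n) = ln n" "LgLg (real n) = ln (ln n)" "LgLg (real (Suc n)) = ln (ln (real (Suc n)))"
      using en eln eln' by (auto simp: LgLg_def Lg_eq)
    define L where "L = ln (ln (real n))"
    define L' where "L' = ln (ln (real (Suc n)))"
    have L1: "1 \<le> L" unfolding L_def using eln n by (subst ln_ge_iff) (auto intro: order_less_le_trans[OF exp_gt_zero])
    have lnpos: "0 < ln (real n)" using n by simp
    have LL': "L < L'" unfolding L_def L'_def using n by (subst ln_less_cancel_iff) auto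
    have expL: "exp L = ln n" unfolding L_def using lnpos by simp
    show ?case
    proof (intro allI impI)
      fix \<theta> :: real assume \<theta>: "0 < \<theta> \<and> \<theta> \<le> 1"
      define T where "T = \<theta> powr (c + 1) * loglog_term \<theta> n"
      have T0: "0 \<le> T" by (simp add: T_def loglog_term_nonneg)
      \<comment> \<open>The mean value theorem is applied in the variable log log n.\<close>
      have "\<exists>\<xi>. L < \<xi> \<and> \<xi> < L' \<and> gamma_cdf c (\<theta> * L') - gamma_cdf c (\<theta> * L) = (L' - L) * ((\<theta> * \<xi>) powr c / exp (\<theta> * \<xi>) * \<theta>)"
      proof (rule MVT2[OF LL'])
        fix s assume "L \<le> s" "s \<le> L'"
        then have "0 < \<theta> * s" using L1 \<theta> by auto
        then show "((\<lambda>s. gamma_cdf c (\<theta> * s)) has_real_derivative (\<theta> * s) powr c / exp (\<theta> * s) * \<theta>) (at s)"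
          by (intro DERIV_chain2[OF gamma_cdf_deriv]) (auto intro!: derivative_eq_intros)
      qed
      then obtain \<xi> where \<xi>: "L < \<xi>" "\<xi> < L'"
        and eq: "gamma_cdf c (\<theta> * L') - gamma_cdf c (\<theta> * L) = (L' - L) * ((\<theta> * \<xi>) powr c / exp (\<theta> * \<xi>) * \<theta>)" by blast
      have Teq: "T = \<theta> powr (c + 1) * (exp (- (\<theta> * L)) * L powr c / (n * ln n))"
      proof -
        have "Lg (real n) powr (- 1 - \<theta>) = ln n powr (- 1) * ln n powr (- \<theta>)" unfolding Lg by (subst powr_add[symmetric]) simp
        also have "ln n powr (- \<theta>) = exp (- (\<theta> * L))" using lnpos by (simp add: powr_def L_def)
        also have "ln n powr (- 1) = 1 / ln n" using lnpos by (simp add: powr_minus_divide)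
        finally show ?thesis using n by (simp add: T_def loglog_term_def Lg L_def)
      qed
      \<comment> \<open>The exact ratio of increment to term. Apart from the choice of \<xi>,
        \<theta> enters only through exp (-\<theta>(\<xi> - L)), which lies between exp (-d n) and 1
        because \<theta> <= 1; this is the uniformity in \<theta>.\<close>
      have "gamma_cdf c (\<theta> * L') - gamma_cdf c (\<theta> * L) = T * (u n * (\<xi> / L) powr c * exp (- (\<theta> * (\<xi> - L))))"
      proof -
        have "(\<theta> * \<xi>) powr c / exp (\<theta> * \<xi>) * \<theta> = \<theta> powr (c + 1) * (\<xi> powr c * exp (- (\<theta> * \<xi>)))"
          using \<theta> \<xi> L1 by (simp add: powr_mult powr_add exp_minus field_simps)
        also have "\<xi> powr c = L powr c * (\<xi> / L) powr c" using \<xi> L1 by (simp add: powr_divide)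
        also have "exp (- (\<theta> * \<xi>)) = exp (- (\<theta> * L)) * exp (- (\<theta> * (\<xi> - L)))" by (simp add: algebra_simps flip: exp_add)
        finally have *: "(\<theta> * \<xi>) powr c / exp (\<theta> * \<xi>) * \<theta> = \<theta> powr (c + 1) * (L powr c * (\<xi> / L) powr c * (exp (- (\<theta> * L)) * exp (- (\<theta> * (\<xi> - L)))))" .
        have "L' - L = u n / (n * ln n)" using n lnpos by (simp add: u_def d_def L_def L'_def)
        then show ?thesis unfolding eq * Teq by simp
      qed
      moreover have "u n * q n powr (- \<bar>c\<bar>) * exp (- d n) \<le> u n * (\<xi> / L) powr c * exp (- (\<theta> * (\<xi> - L)))"
        and "u n * (\<xi> / L) powr c * exp (- (\<theta> * (\<xi> - L))) \<le> u n * q n powr \<bar>c\<bar>"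
      proof -
        have u0: "0 \<le> u n" using n lnpos LL' by (auto simp: u_def d_def L_def L'_def)
        have x1: "1 \<le> \<xi> / L" "\<xi> / L \<le> q n" using \<xi> L1 by (auto simp: q_def L_def L'_def divide_right_mono)
        have q1: "1 \<le> q n" using x1 by simp
        have "(\<xi> / L) powr c \<le> (\<xi> / L) powr \<bar>c\<bar>" using x1 by (intro powr_mono) auto
        also have "\<dots> \<le> q n powr \<bar>c\<bar>" using x1 by (intro powr_mono2) auto
        finally have hi: "(\<xi> / L) powr c \<le> q n powr \<bar>c\<bar>" .
        have "q n powr (- \<bar>c\<bar>) \<le> (\<xi> / L) powr (- \<bar>c\<bar>)" using x1 by (intro powr_mono2') auto
        also have "\<dots> \<le> (\<xi> / L) powr c" using x1 by (intro powr_mono) auto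
        finally have lo: "q n powr (- \<bar>c\<bar>) \<le> (\<xi> / L) powr c" .
        have "\<theta> * (\<xi> - L) \<le> 1 * d n" using \<theta> \<xi> by (intro mult_mono) (auto simp: d_def L_def L'_def)
        then have "exp (- d n) \<le> exp (- (\<theta> * (\<xi> - L)))" by simp
        then show "u n * q n powr (- \<bar>c\<bar>) * exp (- d n) \<le> u n * (\<xi> / L) powr c * exp (- (\<theta> * (\<xi> - L)))"
          using u0 lo by (intro mult_mono mult_left_mono) auto
        have "exp (- (\<theta> * (\<xi> - L))) \<le> 1" using \<theta> \<xi> by simp
        then have "u n * (\<xi> / L) powr c * exp (- (\<theta> * (\<xi> - L))) \<le> u n * q n powr \<bar>c\<bar> * 1"
          using u0 hi by (intro mult_mono mult_left_mono) auto
        then show "u n * (\<xi> / L) powr c * exp (- (\<theta> * (\<xi> - L))) \<le> u n * q n powr \<bar>c\<bar>" by simp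
      qed
      ultimately obtain R where R: "gamma_cdf c (\<theta> * L') - gamma_cdf c (\<theta> * L) = T * R" "1 - \<eta> \<le> R" "R \<le> 1 + \<eta>"
        using elim(1,2) by (metis less_imp_le order_trans)
      have "T * R - T = T * (R - 1)" by (simp add: algebra_simps)
      then have "\<bar>T * R - T\<bar> = T * \<bar>R - 1\<bar>" using T0 by (simp add: abs_mult)
      also have "\<dots> \<le> T * \<eta>" using R T0 by (intro mult_left_mono) auto
      finally show "\<bar>(gamma_cdf c (\<theta> * LgLg (real (Suc n))) - gamma_cdf c (\<theta> * LgLg (real n))) - \<theta> powr (c + 1) * loglog_term \<theta> n\<bar> \<le> \<eta> * (\<theta> powr (c + 1) * loglog_term \<theta> n)"
        unfolding Lg(2,3) L_def[symmetric] L'_def[symmetric] T_def[symmetric] R(1) by (simp add: mult.commute)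
    qed
  qed
qed

lemma gamma_increment_sums:
  assumes "0 < \<theta>"
  shows "(\<lambda>n. gamma_cdf c (\<theta> * LgLg (real (Suc (n + N)))) - gamma_cdf c (\<theta> * LgLg (real (n + N))))
     sums (Gamma (c + 1) - gamma_cdf c (\<theta> * LgLg (real N)))"
proof -
  have "filterlim (\<lambda>n. \<theta> * LgLg (real (n + N))) at_top sequentially"
  proof -
    have "filterlim (\<lambda>n. \<theta> * ln (ln (real n))) at_top sequentially" using assms by real_asymp
    then have "filterlim (\<lambda>n. \<theta> * LgLg (real n)) at_top sequentially"
    proof (subst (asm) filterlim_cong[OF refl refl])
      show "\<forall>\<^sub>F n in sequentially. \<theta> * ln (ln (real n)) = \<theta> * LgLg (real n)"
        using eventually_LgLg_nat by eventually_elim simp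
    qed
    then show ?thesis by (rule filterlim_compose[OF _ filterlim_add_const_nat_at_top])
  qed
  from filterlim_compose[OF gamma_cdf_at_top this]
  have "(\<lambda>n. gamma_cdf c (\<theta> * LgLg (real (n + N)))) \<longlonglongrightarrow> Gamma (c + 1)" .
  from telescope_sums[OF this] show ?thesis by simp
qed

text \<open>Summation of \<open>loglog_term_increment\<close>. The terms are summable because t (1 -
  \<eta>) is dominated by the telescoping increments.\<close>

lemma loglog_term_tail_sum:
  assumes \<eta>: "0 < \<eta>" "\<eta> < 1"
  shows "\<forall>\<^sub>F N in sequentially. \<forall>\<theta>. 0 < \<theta> \<and> \<theta> \<le> 1 \<longrightarrow> summable (loglog_term \<theta>) \<and>
    \<bar>(Gamma (c + 1) - gamma_cdf c (\<theta> * LgLg (real N))) - \<theta> powr (c + 1) * (\<Sum>n. loglog_term \<theta> (n + N))\<bar>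
      \<le> \<eta> * (\<theta> powr (c + 1) * (\<Sum>n. loglog_term \<theta> (n + N)))"
proof -
  obtain N0 where N0: "\<And>n \<theta>. N0 \<le> n \<Longrightarrow> 0 < \<theta> \<Longrightarrow> \<theta> \<le> 1 \<Longrightarrow>
    \<bar>(gamma_cdf c (\<theta> * LgLg (real (Suc n))) - gamma_cdf c (\<theta> * LgLg (real n))) - \<theta> powr (c + 1) * loglog_term \<theta> n\<bar> \<le> \<eta> * (\<theta> powr (c + 1) * loglog_term \<theta> n)"
    using loglog_term_increment[OF \<eta>(1)] by (auto simp: eventually_sequentially)
  show ?thesis
  proof (rule eventually_sequentiallyI[of N0], intro allI impI)
    fix N \<theta> assume N: "N0 \<le> N" and \<theta>: "0 < \<theta> \<and> \<theta> \<le> (1::real)"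
    define D where "D = (\<lambda>n. gamma_cdf c (\<theta> * LgLg (real (Suc (n + N)))) - gamma_cdf c (\<theta> * LgLg (real (n + N))))"
    define t where "t = (\<lambda>n. \<theta> powr (c + 1) * loglog_term \<theta> (n + N))"
    have b: "\<bar>D n - t n\<bar> \<le> \<eta> * t n" for n unfolding D_def t_def using N0[of "n + N" \<theta>] N \<theta> by simp
    have D: "D sums (Gamma (c + 1) - gamma_cdf c (\<theta> * LgLg (real N)))"
      unfolding D_def using gamma_increment_sums[of \<theta> N] \<theta> by simp
    have t0: "0 \<le> t n" for n by (simp add: t_def loglog_term_nonneg)
    have st: "summable t"
    proof (rule summable_comparison_test')
      show "summable (\<lambda>n. 1 / (1 - \<eta>) * D n)" using D by (intro summable_mult) (auto simp: sums_iff)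
      show "norm (t n) \<le> 1 / (1 - \<eta>) * D n" if "0 \<le> n" for n
      proof -
        have "t n * (1 - \<eta>) \<le> D n" using b[of n] by (simp add: abs_le_iff algebra_simps)
        then show ?thesis using \<eta> t0[of n] by (simp add: pos_le_divide_eq)
      qed
    qed
    have "summable (\<lambda>n. loglog_term \<theta> (n + N))"
      using st \<theta> unfolding t_def by (subst (asm) summable_cmult_iff) auto
    then have s: "summable (loglog_term \<theta>)" by (simp only: summable_iff_shift)
    have sD: "summable D" "suminf D = Gamma (c + 1) - gamma_cdf c (\<theta> * LgLg (real N))" using D by (auto simp: sums_iff)
    have "\<bar>suminf D - suminf t\<bar> = \<bar>\<Sum>n. D n - t n\<bar>" by (subst suminf_diff[OF sD(1) st]) simp
    also have "\<dots> \<le> (\<Sum>n. \<bar>D n - t n\<bar>)"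
      by (rule summable_rabs) (rule summable_comparison_test'[OF summable_mult[OF st, of \<eta>]], use b in auto)
    also have "\<dots> \<le> (\<Sum>n. \<eta> * t n)"
      by (intro suminf_le b summable_mult st summable_comparison_test'[OF summable_mult[OF st, of \<eta>]]) (use b in auto)
    also have "\<dots> = \<eta> * suminf t" by (rule suminf_mult[OF st])
    finally have "\<bar>suminf D - suminf t\<bar> \<le> \<eta> * suminf t" .
    moreover have "suminf t = \<theta> powr (c + 1) * (\<Sum>n. loglog_term \<theta> (n + N))"
      unfolding t_def using \<open>summable (\<lambda>n. loglog_term \<theta> (n + N))\<close> by (rule suminf_mult)
    ultimately show "summable (loglog_term \<theta>) \<and>
      \<bar>(Gamma (c + 1) - gamma_cdf c (\<theta> * LgLg (real N))) - \<theta> powr (c + 1) * (\<Sum>n. loglog_term \<theta> (n + N))\<bar>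
      \<le> \<eta> * (\<theta> powr (c + 1) * (\<Sum>n. loglog_term \<theta> (n + N)))" using s sD by simp
  qed
qed

end

section \<open>Precise rates\<close>

text \<open>The first N terms are bounded by \<open>B\<close> uniformly in \<epsilon> and the
  additive errors have a finite sum; both are killed by \<theta>^(c+1). The remaining terms follow
  the incomplete Gamma integral, whose missing part near 0 vanishes with \<theta>.\<close>

lemma loglog_series_limit:
  fixes f :: "nat \<Rightarrow> real \<Rightarrow> real" and \<theta> :: "real \<Rightarrow> real"
  assumes c: "- 1 < c" and \<theta>: "filterlim \<theta> (at_right 0) F"
    and f0: "\<And>n \<epsilon>. 0 \<le> f n \<epsilon>" and fB: "\<And>n \<epsilon>. f n \<epsilon> \<le> B n"
    and approx: "\<And>\<rho>. 0 < \<rho> \<Longrightarrow> \<exists>e. summable e \<and> (\<forall>n. 0 \<le> e n) \<and>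
      (\<forall>\<^sub>F (n, \<epsilon>) in sequentially \<times>\<^sub>F F. \<bar>f n \<epsilon> - C * loglog_term c (\<theta> \<epsilon>) n\<bar> \<le> \<rho> * loglog_term c (\<theta> \<epsilon>) n + e n)"
  shows "((\<lambda>\<epsilon>. \<theta> \<epsilon> powr (c + 1) * (\<Sum>n. f (Suc n) \<epsilon>)) \<longlongrightarrow> C * Gamma (c + 1)) F"
proof (rule tendstoI)
  fix \<eta> :: real assume \<eta>: "0 < \<eta>"
  define \<Gamma> where "\<Gamma> = Gamma (c + 1)"
  have \<Gamma>: "0 < \<Gamma>" using c by (simp add: \<Gamma>_def Gamma_real_pos)
  define \<rho> where "\<rho> = \<eta> / (8 * \<Gamma>)"
  \<comment> \<open>The cap 1/2 yields A <= 2 \<Gamma> below; the other bound keeps |C| times the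
    relative error under \<eta>/4.\<close>
  define \<eta>' where "\<eta>' = min (1 / 2) (\<eta> / (8 * \<Gamma> * (\<bar>C\<bar> + 1)))"
  have \<rho>: "0 < \<rho>" using \<eta> \<Gamma> by (simp add: \<rho>_def)
  have \<eta>': "0 < \<eta>'" "\<eta>' < 1" "\<eta>' \<le> 1 / 2" using \<eta> \<Gamma> by (auto simp: \<eta>'_def)
  have \<eta>'2: "\<bar>C\<bar> * (2 * \<eta>' * \<Gamma>) \<le> \<eta> / 4"
  proof -
    have "\<eta>' * (8 * \<Gamma> * (\<bar>C\<bar> + 1)) \<le> \<eta>"
      using \<Gamma> by (subst pos_le_divide_eq[symmetric]) (auto simp: \<eta>'_def intro!: mult_pos_pos)
    then have "2 * (\<eta>' * \<Gamma> * \<bar>C\<bar>) + 2 * (\<eta>' * \<Gamma>) \<le> \<eta> / 4" by (simp add: algebra_simps)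
    moreover have "0 \<le> \<eta>' * \<Gamma>" using \<Gamma> \<eta>' by simp
    ultimately have "2 * (\<eta>' * \<Gamma> * \<bar>C\<bar>) \<le> \<eta> / 4" by linarith
    then show ?thesis by (simp add: mult_ac)
  qed
  obtain e where e: "summable e" "\<And>n. 0 \<le> e n" and
    ev: "\<forall>\<^sub>F (n, \<epsilon>) in sequentially \<times>\<^sub>F F. \<bar>f n \<epsilon> - C * loglog_term c (\<theta> \<epsilon>) n\<bar> \<le> \<rho> * loglog_term c (\<theta> \<epsilon>) n + e n"
    using approx[OF \<rho>] by blast
  \<comment> \<open>The joint eventuality splits into a condition on n and one on \<epsilon>, so N
    can be fixed before \<epsilon>.\<close>
  obtain P1 P2 where P1: "\<forall>\<^sub>F n in sequentially. P1 n" and P2: "\<forall>\<^sub>F \<epsilon> in F. P2 \<epsilon>"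
    and P12: "\<And>n \<epsilon>. P1 n \<Longrightarrow> P2 \<epsilon> \<Longrightarrow> \<bar>f n \<epsilon> - C * loglog_term c (\<theta> \<epsilon>) n\<bar> \<le> \<rho> * loglog_term c (\<theta> \<epsilon>) n + e n"
    using ev unfolding eventually_prod_filter by auto
  obtain N1 where N1: "\<And>n. N1 \<le> n \<Longrightarrow> P1 n" using P1 by (auto simp: eventually_sequentially)
  obtain N2 where N2: "\<And>N t. N2 \<le> N \<Longrightarrow> 0 < t \<Longrightarrow> t \<le> 1 \<Longrightarrow> summable (loglog_term c t) \<and>
    \<bar>(\<Gamma> - gamma_cdf c (t * LgLg (real N))) - t powr (c + 1) * (\<Sum>n. loglog_term c t (n + N))\<bar>
      \<le> \<eta>' * (t powr (c + 1) * (\<Sum>n. loglog_term c t (n + N)))"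
    using loglog_term_tail_sum[OF c \<eta>'(1,2)] by (auto simp: eventually_sequentially \<Gamma>_def)
  define N where "N = max N1 N2"
  define K where "K = (\<Sum>n<N. B (Suc n)) + (\<Sum>n. e (n + Suc N))"
  have c1: "0 < c + 1" using c by simp
  have \<theta>0: "(\<theta> \<longlongrightarrow> 0) F" using \<theta> by (rule filterlim_mono) (auto simp: at_within_le_nhds)
  have lim1: "((\<lambda>\<epsilon>. \<theta> \<epsilon> powr (c + 1) * K) \<longlongrightarrow> 0) F"
  proof -
    have "((\<lambda>t::real. t powr (c + 1)) \<longlongrightarrow> 0) (at_right 0)" using c1 by real_asymp
    from filterlim_compose[OF this \<theta>] show ?thesis by (rule tendsto_mult_left_zero)
  qed
  have lim2: "((\<lambda>\<epsilon>. \<bar>C\<bar> * gamma_cdf c (\<theta> \<epsilon> * LgLg (real (Suc N)))) \<longlongrightarrow> 0) F"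
  proof -
    have "filterlim (\<lambda>t. t * LgLg (real (Suc N))) (at_right 0) (at_right 0)"
    proof -
      define l where "l = LgLg (real (Suc N))"
      have "0 < l" by (simp add: l_def)
      then have "filterlim (\<lambda>t. t * l) (at_right 0) (at_right 0)" by real_asymp
      then show ?thesis by (simp add: l_def)
    qed
    from filterlim_compose[OF gamma_cdf_at_0[OF c] filterlim_compose[OF this \<theta>]]
    show ?thesis by (rule tendsto_mult_right_zero)
  qed
  have "\<forall>\<^sub>F \<epsilon> in F. \<theta> \<epsilon> powr (c + 1) * K < \<eta> / 8" using order_tendstoD(2)[OF lim1, of "\<eta> / 8"] \<eta> by simp
  moreover have "\<forall>\<^sub>F \<epsilon> in F. \<bar>C\<bar> * gamma_cdf c (\<theta> \<epsilon> * LgLg (real (Suc N))) < \<eta> / 8" using order_tendstoD(2)[OF lim2, of "\<eta> / 8"] \<eta> by simp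
  moreover have "\<forall>\<^sub>F \<epsilon> in F. 0 < \<theta> \<epsilon>" using \<theta> by (auto simp: filterlim_at elim: eventually_mono)
  moreover have "\<forall>\<^sub>F \<epsilon> in F. \<theta> \<epsilon> < 1" using order_tendstoD(2)[OF \<theta>0] by simp
  ultimately show "\<forall>\<^sub>F \<epsilon> in F. dist (\<theta> \<epsilon> powr (c + 1) * (\<Sum>n. f (Suc n) \<epsilon>)) (C * Gamma (c + 1)) < \<eta>"
    using P2
  proof eventually_elim
    case (elim \<epsilon>)
    define t where "t = \<theta> \<epsilon>"
    define w where "w = t powr (c + 1)"
    have w: "0 \<le> w" by (simp add: w_def)
    \<comment> \<open>The tail starts at \<open>Suc N\<close> because the series runs over
      \<open>f (Suc n)\<close>.\<close>
    define T where "T = (\<lambda>n. loglog_term c t (n + Suc N))"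
    define g where "g = (\<lambda>n. f (n + Suc N) \<epsilon>)"
    define h where "h = (\<lambda>n. e (n + Suc N))"
    note lt = loglog_term_nonneg[OF c]
    have T0: "0 \<le> T n" for n by (simp add: T_def lt)
    have N2': "summable (loglog_term c t) \<and> \<bar>(\<Gamma> - gamma_cdf c (t * LgLg (real (Suc N)))) - w * suminf T\<bar> \<le> \<eta>' * (w * suminf T)"
      using N2[of "Suc N" t] elim by (simp add: N_def t_def w_def T_def)
    then have sT: "summable T" unfolding T_def by (subst summable_iff_shift) simp
    have sh: "summable h" unfolding h_def using e by (subst summable_iff_shift)
    have b: "\<bar>g n - C * T n\<bar> \<le> \<rho> * T n + h n" for n
      unfolding g_def T_def h_def t_def using N1[of "n + Suc N"] elim by (intro P12) (auto simp: N_def)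
    have sb: "summable (\<lambda>n. \<rho> * T n + h n)" using sT sh by (intro summable_add summable_mult)
    have sd: "summable (\<lambda>n. \<bar>g n - C * T n\<bar>)" by (rule summable_comparison_test'[OF sb]) (use b in auto)
    have sd': "summable (\<lambda>n. g n - C * T n)" by (rule summable_rabs_cancel[OF sd])
    have sg: "summable g"
      using summable_add[OF sd' summable_mult[OF sT, of C]] by simp
    have sf: "summable (\<lambda>n. f (Suc n) \<epsilon>)"
      using sg unfolding g_def by (subst summable_iff_shift[symmetric, of _ N]) simp
    have "\<bar>suminf g - C * suminf T\<bar> = \<bar>\<Sum>n. g n - C * T n\<bar>"
      using sg sT by (subst suminf_diff[symmetric]) (auto simp: suminf_mult summable_mult)
    also have "\<dots> \<le> (\<Sum>n. \<bar>g n - C * T n\<bar>)" by (rule summable_rabs[OF sd])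
    also have "\<dots> \<le> (\<Sum>n. \<rho> * T n + h n)" by (intro suminf_le b sd sb)
    also have "\<dots> = \<rho> * suminf T + suminf h" using sT sh by (simp add: suminf_add[symmetric] suminf_mult summable_mult)
    finally have main: "\<bar>suminf g - C * suminf T\<bar> \<le> \<rho> * suminf T + suminf h" .
    have split: "(\<Sum>n. f (Suc n) \<epsilon>) = suminf g + (\<Sum>n<N. f (Suc n) \<epsilon>)"
      using suminf_split_initial_segment[OF sf, of N] by (simp add: g_def)
    have init: "0 \<le> (\<Sum>n<N. f (Suc n) \<epsilon>)" "(\<Sum>n<N. f (Suc n) \<epsilon>) \<le> (\<Sum>n<N. B (Suc n))"
      by (intro sum_nonneg f0, intro sum_mono fB)
    define A where "A = w * suminf T"
    define G where "G = gamma_cdf c (t * LgLg (real (Suc N)))"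
    have A0: "0 \<le> A" unfolding A_def using w suminf_nonneg[OF sT T0] by simp
    have G0: "0 \<le> G" unfolding G_def gamma_cdf_def cdf_def by simp
    have AG: "\<bar>\<Gamma> - G - A\<bar> \<le> \<eta>' * A" using N2' by (simp add: A_def G_def)
    have A2: "A \<le> 2 * \<Gamma>"
    proof -
      have "\<eta>' * A \<le> 1 / 2 * A" using \<eta>' A0 by (intro mult_right_mono) auto
      then show ?thesis using AG G0 by linarith
    qed
    have "\<bar>A - \<Gamma>\<bar> \<le> \<eta>' * A + G" using AG G0 by linarith
    also have "\<eta>' * A \<le> \<eta>' * (2 * \<Gamma>)" using A2 \<eta>' by (intro mult_left_mono) auto
    finally have "\<bar>A - \<Gamma>\<bar> \<le> 2 * \<eta>' * \<Gamma> + G" by simp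
    then have "\<bar>C\<bar> * \<bar>A - \<Gamma>\<bar> \<le> \<bar>C\<bar> * (2 * \<eta>' * \<Gamma> + G)" by (intro mult_left_mono) auto
    also have "\<dots> = \<bar>C\<bar> * (2 * \<eta>' * \<Gamma>) + \<bar>C\<bar> * G" by (simp add: distrib_left)
    finally have p1: "\<bar>C * A - C * \<Gamma>\<bar> \<le> \<eta> / 4 + \<eta> / 8"
      using \<eta>'2 elim(2) by (simp add: abs_mult G_def t_def flip: right_diff_distrib)
    have "w * \<bar>suminf g - C * suminf T\<bar> \<le> w * (\<rho> * suminf T + suminf h)" using main w by (rule mult_left_mono)
    then have "\<bar>w * suminf g - C * A\<bar> \<le> \<rho> * A + w * suminf h"
      using w by (simp add: A_def abs_mult_pos' algebra_simps)
    also have "\<rho> * A \<le> \<rho> * (2 * \<Gamma>)" using A2 \<rho> by (intro mult_left_mono) auto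
    also have "\<rho> * (2 * \<Gamma>) = \<eta> / 4" using \<Gamma> by (simp add: \<rho>_def)
    finally have p2: "\<bar>w * suminf g - C * A\<bar> \<le> \<eta> / 4 + w * suminf h" by simp
    have p3: "w * (\<Sum>n<N. f (Suc n) \<epsilon>) + w * suminf h < \<eta> / 8"
    proof -
      have "w * (\<Sum>n<N. f (Suc n) \<epsilon>) \<le> w * (\<Sum>n<N. B (Suc n))" using init w by (intro mult_left_mono)
      then have "w * (\<Sum>n<N. f (Suc n) \<epsilon>) + w * suminf h \<le> w * K" by (simp add: K_def h_def distrib_left)
      then show ?thesis using elim(1) by (simp add: w_def t_def)
    qed
    have p4: "0 \<le> w * (\<Sum>n<N. f (Suc n) \<epsilon>)" "0 \<le> w * suminf h"
      using w init suminf_nonneg[OF sh] e by (auto simp: h_def)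
    have "w * (\<Sum>n. f (Suc n) \<epsilon>) = w * suminf g + w * (\<Sum>n<N. f (Suc n) \<epsilon>)"
      unfolding split by (rule distrib_left)
    then have "\<bar>w * (\<Sum>n. f (Suc n) \<epsilon>) - C * \<Gamma>\<bar> < \<eta>"
      using p1 p2 p3 p4 \<eta> by linarith
    then show ?case by (simp add: dist_real_def w_def t_def \<Gamma>_def)
  qed
qed

section \<open>The joint limit in n and \<epsilon>\<close>

locale precise_rates = iid_moment +
  fixes \<tau> :: real and an :: "nat \<Rightarrow> real \<Rightarrow> real"
  assumes a: "- 1 < a" and b: "- 1 / 2 < b"
    and an: "\<forall>\<eta>>0. \<exists>n0 \<delta>. 0 < \<delta> \<and> (\<forall>n\<ge>n0. \<forall>\<epsilon>. sqrt (1 + a) < \<epsilon> \<and> \<epsilon> < sqrt (1 + a) + \<delta>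
               \<longrightarrow> \<bar>an n \<epsilon> * LgLg (real n) - \<tau>\<bar> < \<eta>)"
begin

definition s :: real where "s = sqrt (1 + a)"

text \<open>Encodes the joint limit: a property holds eventually along this filter if it holds for
  all large n and all \<epsilon> in one right neighbourhood of sqrt (1 + a).\<close>

definition joint :: "(nat \<times> real) filter" where "joint = sequentially \<times>\<^sub>F at_right s"

lemma s_pos: "0 < s" and s_sq: "s\<^sup>2 = 1 + a"
  using a by (auto simp: s_def)

lemma an_joint: "((\<lambda>(n, \<epsilon>). an n \<epsilon> * LgLg (real n)) \<longlongrightarrow> \<tau>) joint"
proof (rule tendstoI)
  fix \<eta> :: real assume "0 < \<eta>"
  with an obtain n0 \<delta> where *: "0 < \<delta>" "\<And>n \<epsilon>. n0 \<le> n \<Longrightarrow> s < \<epsilon> \<Longrightarrow> \<epsilon> < s + \<delta> \<Longrightarrow> \<bar>an n \<epsilon> * LgLg (real n) - \<tau>\<bar> < \<eta>"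
    unfolding s_def by blast
  have "\<forall>\<^sub>F \<epsilon> in at_right s. s < \<epsilon> \<and> \<epsilon> < s + \<delta>"
    using * by (auto simp: eventually_at_right_field intro!: exI[of _ "s + \<delta>"])
  moreover have "\<forall>\<^sub>F n in sequentially. n0 \<le> n" by (rule eventually_ge_at_top)
  ultimately show "\<forall>\<^sub>F z in joint. dist (case z of (n, \<epsilon>) \<Rightarrow> an n \<epsilon> * LgLg (real n)) \<tau> < \<eta>"
    unfolding joint_def eventually_prod_filter
    by (intro exI[of _ "\<lambda>n. n0 \<le> n"] exI[of _ "\<lambda>\<epsilon>. s < \<epsilon> \<and> \<epsilon> < s + \<delta>"]) (auto simp: dist_real_def *)
qed

lemma fst_joint: "filterlim fst sequentially joint" and snd_joint: "filterlim snd (at_right s) joint"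
  unfolding joint_def by (rule filterlim_fst filterlim_snd)+

lemma LgLg_joint: "filterlim (\<lambda>z. LgLg (real (fst z))) at_top joint"
proof -
  have "filterlim (\<lambda>n. ln (ln (real n))) at_top sequentially" by real_asymp
  then have "filterlim (\<lambda>n. LgLg (real n)) at_top sequentially"
  proof (subst (asm) filterlim_cong[OF refl refl])
    show "\<forall>\<^sub>F n in sequentially. ln (ln (real n)) = LgLg (real n)"
      using eventually_LgLg_nat by eventually_elim simp
  qed
  from filterlim_compose[OF this fst_joint] show ?thesis .
qed

lemma eps_joint: "(snd \<longlongrightarrow> s) joint"
  using snd_joint by (rule filterlim_mono) (auto simp: at_within_le_nhds)

lemma an_joint_0: "((\<lambda>z. an (fst z) (snd z)) \<longlongrightarrow> 0) joint"
proof -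
  have "((\<lambda>z. (case z of (n, \<epsilon>) \<Rightarrow> an n \<epsilon> * LgLg (real n)) / LgLg (real (fst z))) \<longlongrightarrow> 0) joint"
    by (rule real_tendsto_divide_at_top[OF an_joint LgLg_joint])
  moreover have "(case z of (n, \<epsilon>) \<Rightarrow> an n \<epsilon> * LgLg (real n)) / LgLg (real (fst z)) = an (fst z) (snd z)" for z
    by (simp add: split_beta less_imp_neq[OF LgLg_pos, symmetric])
  ultimately show ?thesis by simp
qed

text \<open>The normalised threshold: \<sigma> sqrt n x is \<sigma> phi(n) (\<epsilon> +
  a_n(\<epsilon>)).\<close>

definition x :: "nat \<times> real \<Rightarrow> real" where
  "x z = sqrt (2 * LgLg (real (fst z))) * (snd z + an (fst z) (snd z))"

lemma eps_an_joint: "((\<lambda>z. snd z + an (fst z) (snd z)) \<longlongrightarrow> s) joint"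
  using tendsto_add[OF eps_joint an_joint_0] by simp

lemma x_joint: "filterlim x at_top joint"
proof -
  have "filterlim (\<lambda>z. sqrt (2 * LgLg (real (fst z)))) at_top joint"
    by (rule filterlim_compose[OF _ LgLg_joint, of "\<lambda>L. sqrt (2 * L)"]) real_asymp
  from filterlim_tendsto_pos_mult_at_top[OF eps_an_joint s_pos this]
  show ?thesis unfolding x_def[abs_def] by (simp add: mult.commute)
qed

text \<open>Limit ratio of the weighted Gaussian tail to \<open>loglog_term\<close>; sqrt (4 pi)
  joins the sqrt (2 pi) of the density with the sqrt 2 of \<open>phi\<close>.\<close>

definition C0 :: real where "C0 = exp (- 2 * \<tau> * s) / (sqrt (4 * pi) * s)"

text \<open>With L = log log n one has x^2/2 = \<epsilon>^2 L + (2\<epsilon> + a_n) a_n L. The first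
  summand gives the power of log n in \<open>loglog_term\<close>; the second tends to 2 s \<tau> and
  is the source of exp (-2 \<tau> s).\<close>

lemma gaussian_term_joint:
  assumes \<eta>: "0 < \<eta>"
  shows "\<forall>\<^sub>F z in joint. \<bar>wt a b (real (fst z)) / fst z * gauss_tail (x z) - C0 * loglog_term (b - 1/2) ((snd z)\<^sup>2 - a - 1) (fst z)\<bar>
    \<le> \<eta> * loglog_term (b - 1/2) ((snd z)\<^sup>2 - a - 1) (fst z)"
proof -
  define A where "A = (\<lambda>z. an (fst z) (snd z))"
  define t where "t = (\<lambda>z. A z * LgLg (real (fst z)))"
  define G where "G = (\<lambda>z. gauss_tail z * z * exp (z\<^sup>2 / 2) * sqrt (2 * pi))"
  define R where "R = (\<lambda>z. G (x z) / (sqrt (4 * pi) * (snd z + A z)) * exp (- ((2 * snd z + A z) * t z)))"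
  have t: "(t \<longlongrightarrow> \<tau>) joint" using an_joint unfolding t_def A_def case_prod_beta' .
  have "(R \<longlongrightarrow> 1 / (sqrt (4 * pi) * s) * exp (- ((2 * s + 0) * \<tau>))) joint"
    unfolding R_def A_def G_def
    using s_pos by (intro tendsto_intros filterlim_compose[OF gauss_tail_asymp x_joint] eps_an_joint t[unfolded A_def] eps_joint an_joint_0) auto
  then have "(R \<longlongrightarrow> C0) joint" by (simp add: C0_def mult_ac)
  from tendstoD[OF this \<eta>] have "\<forall>\<^sub>F z in joint. dist (R z) C0 < \<eta>" .
  moreover have "\<forall>\<^sub>F z in joint. 3 < fst z \<and> Lg (real (fst z)) = ln (real (fst z)) \<and> LgLg (real (fst z)) = ln (ln (real (fst z)))"
    by (rule eventually_compose_filterlim[OF _ fst_joint])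
      (intro eventually_conj eventually_Lg_nat eventually_LgLg_nat eventually_gt_at_top)
  moreover have "\<forall>\<^sub>F z in joint. 0 < snd z + A z"
    using order_tendstoD(1)[OF eps_an_joint s_pos] by (simp add: A_def)
  ultimately show ?thesis
  proof eventually_elim
    case (elim z)
    define n where "n = fst z"
    define \<epsilon> where "\<epsilon> = snd z"
    define L where "L = LgLg (real n)"
    define T where "T = loglog_term (b - 1/2) (\<epsilon>\<^sup>2 - a - 1) n"
    have c: "- 1 < b - 1/2" using b by simp
    have T0: "0 \<le> T" unfolding T_def by (rule loglog_term_nonneg[OF c])
    have L: "0 < L" by (simp add: L_def)
    have pos: "0 < \<epsilon> + A z" using elim by (simp add: \<epsilon>_def)
    have n: "3 < n" and lg: "Lg (real n) = ln n" "L = ln (ln n)" using elim by (auto simp: n_def L_def)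
    have ln0: "0 < ln (real n)" using n by simp
    have "wt a b (real n) / n * gauss_tail (x z) = R z * T"
    proof -
      have xz: "x z = sqrt 2 * sqrt L * (\<epsilon> + A z)" by (simp add: x_def n_def L_def \<epsilon>_def A_def real_sqrt_mult)
      have x0: "0 < x z" unfolding xz using L pos by (intro mult_pos_pos) auto
      have "(x z)\<^sup>2 / 2 = L * (\<epsilon> + A z)\<^sup>2" unfolding xz using L by (simp add: power_mult_distrib)
      also have "\<dots> = \<epsilon>\<^sup>2 * L + (2 * \<epsilon> + A z) * t z"
        by (simp add: t_def L_def n_def power2_eq_square algebra_simps)
      finally have x2: "(x z)\<^sup>2 / 2 = \<epsilon>\<^sup>2 * L + (2 * \<epsilon> + A z) * t z" .
      have Qx: "gauss_tail (x z) = G (x z) / (x z * sqrt (2 * pi)) * exp (- ((x z)\<^sup>2 / 2))"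
        using x0 by (simp add: G_def exp_minus)
      have e1: "exp (- ((x z)\<^sup>2 / 2)) = Lg (real n) powr (- \<epsilon>\<^sup>2) * exp (- ((2 * \<epsilon> + A z) * t z))"
        unfolding x2 lg(1) using ln0 by (simp add: powr_def lg(2) flip: exp_add)
      have lgp: "Lg (real n) powr a * Lg (real n) powr (- \<epsilon>\<^sup>2) = Lg (real n) powr (- 1 - (\<epsilon>\<^sup>2 - a - 1))"
        by (subst powr_add[symmetric]) simp
      have lp: "L powr (b - 1/2) = L powr b / sqrt L"
        using L by (simp add: powr_diff powr_half_sqrt)
      have sq: "sqrt (4 * pi) = sqrt 2 * sqrt (2 * pi)" by (simp flip: real_sqrt_mult)
      have "wt a b (real n) / n * gauss_tail (x z) = (Lg (real n) powr a * Lg (real n) powr (- \<epsilon>\<^sup>2)) * (L powr b / sqrt L) / n *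
         (G (x z) / (sqrt 2 * sqrt (2 * pi) * (\<epsilon> + A z)) * exp (- ((2 * \<epsilon> + A z) * t z)))"
        unfolding Qx e1 wt_def L_def[symmetric] using L pos by (simp add: xz mult_ac)
      then show ?thesis
        unfolding lgp lp[symmetric] sq[symmetric] by (simp add: R_def T_def loglog_term_def[OF c] L_def \<epsilon>_def mult_ac)
    qed
    then have "\<bar>wt a b (real n) / n * gauss_tail (x z) - C0 * T\<bar> = \<bar>R z - C0\<bar> * T"
      using T0 by (simp add: abs_mult_pos' algebra_simps abs_mult flip: left_diff_distrib)
    also have "\<dots> \<le> \<eta> * T" using elim T0 by (intro mult_right_mono) (auto simp: dist_real_def)
    finally show ?case by (simp add: n_def \<epsilon>_def T_def)
  qed
qed

lemma theta_filterlim: "filterlim (\<lambda>\<epsilon>. \<epsilon>\<^sup>2 - a - 1) (at_right 0) (at_right s)"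
proof -
  have "((\<lambda>\<epsilon>. \<epsilon>\<^sup>2 - a - 1) \<longlongrightarrow> s\<^sup>2 - a - 1) (at_right s)" by (intro tendsto_intros)
  moreover have "\<forall>\<^sub>F \<epsilon> in at_right s. 0 < \<epsilon>\<^sup>2 - a - 1"
    using eventually_at_right_less
  proof eventually_elim
    case (elim \<epsilon>)
    then have "s\<^sup>2 < \<epsilon>\<^sup>2" using s_pos by (intro power_strict_mono) auto
    then show ?case by (simp add: s_sq)
  qed
  ultimately show ?thesis by (auto simp: filterlim_at s_sq elim: eventually_mono)
qed

text \<open>The two events agree unless some increment is cut and one of the two walks deviates. The
  lower threshold \<theta>' allows a bound that does not depend on \<epsilon>.\<close>

lemma truncation_error:
  assumes n: "0 < n" and \<theta>: "\<theta>' \<le> \<theta>" and E: "E = (\<lambda>f. \<theta> \<le> \<bar>f n\<bar>) \<or> E = (\<lambda>f. \<exists>k\<le>n. \<theta> \<le> \<bar>f k\<bar>)"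
  shows "\<bar>prob {\<omega>\<in>space M. E (\<lambda>k. partial_sum X k \<omega>)} - prob {\<omega>\<in>space M. E (\<lambda>k. partial_sum (\<lambda>i \<omega>. trunc \<tau>' (X i \<omega>)) k \<omega>)}\<bar>
    \<le> prob (jump_event \<tau>' n \<theta>')"
proof -
  let ?Y = "\<lambda>i \<omega>. trunc \<tau>' (X i \<omega>)"
  let ?A = "{\<omega>\<in>space M. E (\<lambda>k. partial_sum X k \<omega>)}" and ?B = "{\<omega>\<in>space M. E (\<lambda>k. partial_sum ?Y k \<omega>)}"
  have [measurable]: "partial_sum X k \<in> borel_measurable M" "partial_sum ?Y k \<in> borel_measurable M" for k by measurable
  have s: "?A \<in> events" "?B \<in> events" "jump_event \<tau>' n \<theta>' \<in> events"
    using E unfolding jump_event_def by (auto; measurable)+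
  have eq: "partial_sum X k \<omega> = partial_sum ?Y k \<omega>" if "\<not> (\<exists>j\<in>{1..n}. \<tau>' \<le> \<bar>X j \<omega>\<bar>)" "k \<le> n" for k \<omega>
    unfolding partial_sum_def using that by (intro sum.cong) (auto simp: trunc_def not_le)
  have Eq: "E (\<lambda>k. partial_sum X k \<omega>) = E (\<lambda>k. partial_sum ?Y k \<omega>)" if "\<not> (\<exists>j\<in>{1..n}. \<tau>' \<le> \<bar>X j \<omega>\<bar>)" for \<omega>
    using E eq[OF that] by auto
  have dev: "\<exists>k\<le>n. \<theta>' \<le> \<bar>f k\<bar>" if "E f" for f using E that \<theta> by (auto intro: order_trans)
  have "?A \<subseteq> ?B \<union> jump_event \<tau>' n \<theta>'"
    using Eq dev unfolding jump_event_def by blast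
  then have "prob ?A \<le> prob (?B \<union> jump_event \<tau>' n \<theta>')" using s by (intro finite_measure_mono) auto
  also have "\<dots> \<le> prob ?B + prob (jump_event \<tau>' n \<theta>')" using s by (intro measure_Un_le)
  finally have 1: "prob ?A \<le> prob ?B + prob (jump_event \<tau>' n \<theta>')" .
  have "?B \<subseteq> ?A \<union> jump_event \<tau>' n \<theta>'"
    using Eq dev unfolding jump_event_def by blast
  then have "prob ?B \<le> prob (?A \<union> jump_event \<tau>' n \<theta>')" using s by (intro finite_measure_mono) auto
  also have "\<dots> \<le> prob ?A + prob (jump_event \<tau>' n \<theta>')" using s by (intro measure_Un_le)
  finally show ?thesis using 1 by linarith
qed

text \<open>Three comparisons are chained: original with truncated walk (additive error
  \<open>e\<close>), truncated walk with Gaussian tail (relative error \<rho>'), Gaussian tail with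
  \<open>loglog_term\<close> (error \<eta> times that term).\<close>

lemma deviation_term_joint:
  assumes \<rho>: "0 < \<rho>"
    and E: "(\<forall>n \<theta>. E n \<theta> = (\<lambda>f. \<theta> \<le> \<bar>f n :: real\<bar>)) \<and> k = 2 \<or> (\<forall>n \<theta>. E n \<theta> = (\<lambda>f. \<exists>k\<le>n. \<theta> \<le> \<bar>f k\<bar>)) \<and> k = (4 :: real)"
  shows "\<exists>e. summable e \<and> (\<forall>n. 0 \<le> e n) \<and> (\<forall>\<^sub>F (n, \<epsilon>) in sequentially \<times>\<^sub>F at_right s.
    \<bar>wt a b (real n) / n * prob {\<omega>\<in>space M. E n (\<sigma> * phi (real n) * (\<epsilon> + an n \<epsilon>)) (\<lambda>k. partial_sum X k \<omega>)}
      - k * C0 * loglog_term (b - 1/2) (\<epsilon>\<^sup>2 - a - 1) n\<bar> \<le> \<rho> * loglog_term (b - 1/2) (\<epsilon>\<^sup>2 - a - 1) n + e n)"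
proof -
  have c: "- 1 < b - 1/2" using b by simp
  have k: "0 < k" "k \<le> 4" using E by auto
  have C0: "0 < C0" using s_pos by (simp add: C0_def)
  \<comment> \<open>The error \<rho>' times the Gaussian term, itself at most (C0 + 1) T, and the
    error 4 \<eta> T each use half of \<rho> T.\<close>
  define \<rho>' where "\<rho>' = min 1 (\<rho> / (2 * (C0 + 1)))"
  define \<eta> where "\<eta> = min 1 (\<rho> / 8)"
  have \<rho>': "0 < \<rho>'" using \<rho> C0 by (simp add: \<rho>'_def)
  have \<eta>: "0 < \<eta>" using \<rho> by (simp add: \<eta>_def)
  have \<eta>8: "\<eta> \<le> \<rho> / 8" by (simp add: \<eta>_def)
  \<comment> \<open>As \<epsilon> + a_n(\<epsilon>) tends to s, it is eventually between s/2 and 2s;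
    with the sqrt 2 of \<open>phi\<close> these are the two multiples passed to
    \<open>truncated_deviation\<close>.\<close>
  define c2 where "c2 = sqrt 2 * (2 * s)"
  obtain \<kappa> where \<kappa>: "0 < \<kappa>" "c2 * \<kappa> / \<sigma> \<le> 1" and dev:
    "\<forall>\<^sub>F n in sequentially. \<forall>x. sqrt 2 * (s / 2) * sqrt (LgLg (real n)) \<le> x \<and> x \<le> c2 * sqrt (LgLg (real n)) \<longrightarrow>
     \<bar>prob {\<omega>\<in>space M. \<sigma> * sqrt n * x \<le> \<bar>partial_sum (\<lambda>i \<omega>. trunc (level \<kappa> n) (X i \<omega>)) n \<omega>\<bar>} - 2 * gauss_tail x\<bar> \<le> \<rho>' * gauss_tail x \<and>
     \<bar>prob {\<omega>\<in>space M. \<exists>k\<le>n. \<sigma> * sqrt n * x \<le> \<bar>partial_sum (\<lambda>i \<omega>. trunc (level \<kappa> n) (X i \<omega>)) k \<omega>\<bar>} - 4 * gauss_tail x\<bar> \<le> \<rho>' * gauss_tail x"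
    using truncated_deviation[OF \<rho>', of "sqrt 2 * (s / 2)" c2] s_pos by (auto simp: c2_def)
  \<comment> \<open>Here a > -1 enters: max a 0 < 1 + a leaves room for g0 with a < g0^2 < 1 + a. A
    fixed g0 makes the jump error independent of \<epsilon>.\<close>
  have "sqrt (max a 0) < s" unfolding s_def using a by (intro real_sqrt_less_mono) auto
  then obtain g0 where g0: "sqrt (max a 0) < g0" "g0 < s" using dense by blast
  have g0pos: "0 < g0" using g0(1) by (rule order_le_less_trans[rotated]) simp
  have g0a: "a < g0\<^sup>2"
  proof -
    have "(sqrt (max a 0))\<^sup>2 < g0\<^sup>2" using g0 by (intro power_strict_mono) auto
    then show ?thesis by simp
  qed
  have "g0 * sqrt 2 * \<kappa> / \<sigma> \<le> c2 * \<kappa> / \<sigma>"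
    using g0 \<kappa> sigma_pos s_pos by (intro divide_right_mono mult_right_mono) (auto simp: c2_def mult.commute)
  then have g0\<kappa>: "g0 * sqrt 2 * \<kappa> / \<sigma> \<le> 1" using \<kappa> by simp
  obtain e where e: "summable e" "\<And>n. 0 \<le> e n" and
    ej: "\<forall>\<^sub>F n in sequentially. wt a b (real n) / n * prob (jump_event (level \<kappa> n) n (\<sigma> * g0 * phi (real n))) \<le> e n"
    using jump_error_summable[OF \<kappa>(1) g0pos g0a g0\<kappa>] by blast
  have "\<forall>\<^sub>F z in joint. g0 < snd z + an (fst z) (snd z)"
    using order_tendstoD(1)[OF eps_an_joint g0(2)] .
  moreover have "\<forall>\<^sub>F z in joint. s / 2 < snd z + an (fst z) (snd z)"
    using order_tendstoD(1)[OF eps_an_joint, of "s / 2"] s_pos by simp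
  moreover have "\<forall>\<^sub>F z in joint. snd z + an (fst z) (snd z) < 2 * s"
    using order_tendstoD(2)[OF eps_an_joint, of "2 * s"] s_pos by simp
  moreover note gaussian_term_joint[OF \<eta>]
  moreover note eventually_compose_filterlim[OF dev fst_joint] eventually_compose_filterlim[OF ej fst_joint]
    eventually_compose_filterlim[OF eventually_gt_at_top[of 0] fst_joint]
  ultimately have "\<forall>\<^sub>F z in joint. \<bar>wt a b (real (fst z)) / fst z * prob {\<omega>\<in>space M. E (fst z) (\<sigma> * phi (real (fst z)) * (snd z + an (fst z) (snd z))) (\<lambda>k. partial_sum X k \<omega>)}
      - k * C0 * loglog_term (b - 1/2) ((snd z)\<^sup>2 - a - 1) (fst z)\<bar> \<le> \<rho> * loglog_term (b - 1/2) ((snd z)\<^sup>2 - a - 1) (fst z) + e (fst z)"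
  proof eventually_elim
    case (elim z)
    define n where "n = fst z"
    define \<epsilon> where "\<epsilon> = snd z"
    define u where "u = \<epsilon> + an n \<epsilon>"
    define W where "W = wt a b (real n) / n"
    define T where "T = loglog_term (b - 1/2) (\<epsilon>\<^sup>2 - a - 1) n"
    define \<theta> where "\<theta> = \<sigma> * phi (real n) * u"
    define P where "P = prob {\<omega>\<in>space M. E n \<theta> (\<lambda>k. partial_sum X k \<omega>)}"
    define P' where "P' = prob {\<omega>\<in>space M. E n \<theta> (\<lambda>k. partial_sum (\<lambda>i \<omega>. trunc (level \<kappa> n) (X i \<omega>)) k \<omega>)}"
    have n: "0 < n" using elim by (simp add: n_def)
    have T0: "0 \<le> T" unfolding T_def by (rule loglog_term_nonneg[OF c])
    have W0: "0 \<le> W" unfolding W_def using wt_nonneg by simp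
    have L: "0 < sqrt (LgLg (real n))" by simp
    have xz: "x z = sqrt 2 * u * sqrt (LgLg (real n))" by (simp add: x_def u_def n_def \<epsilon>_def real_sqrt_mult)
    have \<theta>x: "\<theta> = \<sigma> * sqrt n * x z" by (simp add: \<theta>_def phi_def xz real_sqrt_mult)
    have u: "g0 < u" "s / 2 < u" "u < 2 * s" using elim by (auto simp: u_def n_def \<epsilon>_def)
    have "\<bar>P' - k * gauss_tail (x z)\<bar> \<le> \<rho>' * gauss_tail (x z)"
    proof -
      have "sqrt 2 * (s / 2) * sqrt (LgLg (real n)) \<le> x z" "x z \<le> c2 * sqrt (LgLg (real n))"
        unfolding xz c2_def using u L by (auto intro!: mult_right_mono mult_left_mono)
      then show ?thesis using elim(5) E unfolding P'_def \<theta>x n_def[symmetric] by auto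
    qed
    then have "W * \<bar>P' - k * gauss_tail (x z)\<bar> \<le> W * (\<rho>' * gauss_tail (x z))" using W0 by (intro mult_left_mono)
    then have 1: "\<bar>W * P' - k * (W * gauss_tail (x z))\<bar> \<le> \<rho>' * (W * gauss_tail (x z))"
      using W0 by (simp add: abs_mult_pos' algebra_simps)
    have 2: "\<bar>W * gauss_tail (x z) - C0 * T\<bar> \<le> \<eta> * T"
      using elim(4) by (simp add: W_def n_def \<epsilon>_def T_def)
    have "\<sigma> * g0 * phi (real n) \<le> \<theta>"
      unfolding \<theta>_def using u sigma_pos mult_right_mono[of g0 u "\<sigma> * phi (real n)"]
      by (simp add: phi_def mult_ac)
    then have "\<bar>P - P'\<bar> \<le> prob (jump_event (level \<kappa> n) n (\<sigma> * g0 * phi (real n)))"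
      unfolding P_def P'_def using E n by (intro truncation_error) auto
    then have "W * \<bar>P - P'\<bar> \<le> W * prob (jump_event (level \<kappa> n) n (\<sigma> * g0 * phi (real n)))" using W0 by (rule mult_left_mono)
    also have "\<dots> \<le> e n" using elim(6) by (simp add: W_def n_def)
    finally have 3: "\<bar>W * P - W * P'\<bar> \<le> e n" using W0 by (simp add: abs_mult_pos' right_diff_distrib)
    have "\<bar>k * (W * gauss_tail (x z)) - k * (C0 * T)\<bar> = k * \<bar>W * gauss_tail (x z) - C0 * T\<bar>"
      using k by (simp add: abs_mult flip: right_diff_distrib)
    also have "\<dots> \<le> 4 * (\<eta> * T)" using 2 k T0 \<eta> by (intro mult_mono) auto
    also have "\<dots> \<le> \<rho> / 2 * T" using mult_right_mono[OF \<eta>8 T0] by simp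
    finally have 4: "\<bar>k * (W * gauss_tail (x z)) - k * (C0 * T)\<bar> \<le> \<rho> / 2 * T" .
    have "W * gauss_tail (x z) \<le> (C0 + 1) * T"
    proof -
      have "\<eta> * T \<le> 1 * T" using T0 by (intro mult_right_mono) (auto simp: \<eta>_def)
      then show ?thesis using 2 by (simp add: abs_le_iff algebra_simps)
    qed
    then have "\<rho>' * (W * gauss_tail (x z)) \<le> \<rho>' * ((C0 + 1) * T)" using \<rho>' by (intro mult_left_mono) auto
    also have "\<dots> = \<rho>' * (C0 + 1) * T" by simp
    also have "\<dots> \<le> \<rho> / 2 * T"
    proof (rule mult_right_mono[OF _ T0])
      have "\<rho>' * (C0 + 1) \<le> \<rho> / (2 * (C0 + 1)) * (C0 + 1)" using C0 by (intro mult_right_mono) (auto simp: \<rho>'_def)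
      also have "\<dots> = \<rho> / 2" using C0 by (simp add: field_simps)
      finally show "\<rho>' * (C0 + 1) \<le> \<rho> / 2" .
    qed
    finally have 5: "\<rho>' * (W * gauss_tail (x z)) \<le> \<rho> / 2 * T" .
    have "\<bar>W * P - k * (C0 * T)\<bar> \<le> \<rho> * T + e n"
      using 1 3 4 5 by linarith
    then show ?case by (simp add: W_def P_def T_def \<theta>_def u_def n_def \<epsilon>_def mult.assoc)
  qed
  then have "\<forall>\<^sub>F (n, \<epsilon>) in sequentially \<times>\<^sub>F at_right s.
    \<bar>wt a b (real n) / n * prob {\<omega>\<in>space M. E n (\<sigma> * phi (real n) * (\<epsilon> + an n \<epsilon>)) (\<lambda>k. partial_sum X k \<omega>)}
      - k * C0 * loglog_term (b - 1/2) (\<epsilon>\<^sup>2 - a - 1) n\<bar> \<le> \<rho> * loglog_term (b - 1/2) (\<epsilon>\<^sup>2 - a - 1) n + e n"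
    unfolding joint_def case_prod_beta' .
  then show ?thesis using e by blast
qed

lemma precise_rates_limit:
  assumes E: "(\<forall>n \<theta>. E n \<theta> = (\<lambda>f. \<theta> \<le> \<bar>f n :: real\<bar>)) \<and> k = 2 \<or> (\<forall>n \<theta>. E n \<theta> = (\<lambda>f. \<exists>k\<le>n. \<theta> \<le> \<bar>f k\<bar>)) \<and> k = (4 :: real)"
  shows "((\<lambda>\<epsilon>. (\<epsilon>\<^sup>2 - a - 1) powr (b + 1/2) * (\<Sum>n. wt a b (real (Suc n)) / real (Suc n) *
    prob {\<omega>\<in>space M. E (Suc n) (\<sigma> * phi (real (Suc n)) * (\<epsilon> + an (Suc n) \<epsilon>)) (\<lambda>k. partial_sum X k \<omega>)}))
    \<longlongrightarrow> k * C0 * Gamma (b + 1/2)) (at_right s)"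
proof -
  have c: "- 1 < b - 1/2" using b by simp
  define f where "f = (\<lambda>n \<epsilon>. wt a b (real n) / real n *
    prob {\<omega>\<in>space M. E n (\<sigma> * phi (real n) * (\<epsilon> + an n \<epsilon>)) (\<lambda>k. partial_sum X k \<omega>)})"
  have "((\<lambda>\<epsilon>. (\<epsilon>\<^sup>2 - a - 1) powr (b - 1/2 + 1) * (\<Sum>n. f (Suc n) \<epsilon>)) \<longlongrightarrow> (k * C0) * Gamma (b - 1/2 + 1)) (at_right s)"
  proof (rule loglog_series_limit[OF c theta_filterlim])
    show "0 \<le> f n \<epsilon>" for n \<epsilon> unfolding f_def using wt_nonneg by simp
    show "f n \<epsilon> \<le> wt a b (real n) / real n" for n \<epsilon>
      unfolding f_def using wt_nonneg[of a b "real n"] by (intro mult_left_le) auto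
    fix \<rho> :: real assume "0 < \<rho>"
    from deviation_term_joint[OF this E]
    show "\<exists>e. summable e \<and> (\<forall>n. 0 \<le> e n) \<and> (\<forall>\<^sub>F (n, \<epsilon>) in sequentially \<times>\<^sub>F at_right s.
       \<bar>f n \<epsilon> - k * C0 * loglog_term (b - 1/2) (\<epsilon>\<^sup>2 - a - 1) n\<bar> \<le> \<rho> * loglog_term (b - 1/2) (\<epsilon>\<^sup>2 - a - 1) n + e n)"
      unfolding f_def .
  qed
  moreover have "b - 1/2 + 1 = b + 1/2" by simp
  ultimately show ?thesis unfolding f_def by simp
qed

end

theorem theorem1:
  fixes M :: "'a measure" and X :: "nat \<Rightarrow> 'a \<Rightarrow> real"
    and a b \<tau> \<sigma> :: real and an :: "nat \<Rightarrow> real \<Rightarrow> real"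
  assumes "prob_space M"
    and a: "a > -1" and b: "b > -1/2"
    and meas: "\<And>n. X n \<in> borel_measurable M"
    and indep: "prob_space.indep_vars M (\<lambda>_. borel) X UNIV"
    and ident: "\<And>n. distr M borel (X n) = distr M borel (X 0)"
    and int2: "integrable M (\<lambda>\<omega>. (X 0 \<omega>)^2)"
    and mean0: "(\<integral>\<omega>. X 0 \<omega> \<partial>M) = 0"
    and sigma: "\<sigma> = sqrt (\<integral>\<omega>. (X 0 \<omega>)^2 \<partial>M)"
    and sigma_pos: "\<sigma> > 0"
    and moment: "integrable M (\<lambda>\<omega>. (X 0 \<omega>)^2 * Lg \<bar>X 0 \<omega>\<bar> powr a
                                  * LgLg \<bar>X 0 \<omega>\<bar> powr (b - 1))"
    and tail: "((\<lambda>t. (\<integral>\<omega>. (if \<bar>X 0 \<omega>\<bar> \<ge> t then (X 0 \<omega>)^2 else 0) \<partial>M) * LgLg t)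
                 \<longlongrightarrow> 0) at_top"
    and an: "\<forall>\<eta>>0. \<exists>n0 \<delta>. \<delta> > 0 \<and> (\<forall>n\<ge>n0. \<forall>\<epsilon>. sqrt (1 + a) < \<epsilon> \<and> \<epsilon> < sqrt (1 + a) + \<delta>
               \<longrightarrow> \<bar>an n \<epsilon> * LgLg (real n) - \<tau>\<bar> < \<eta>)"
  shows "((\<lambda>\<epsilon>. (\<epsilon>^2 - a - 1) powr (b + 1/2) *
            (\<Sum>n. Lg (real (Suc n)) powr a * LgLg (real (Suc n)) powr b / real (Suc n) *
               measure M {\<omega> \<in> space M. max_partial_sum X (Suc n) \<omega> \<ge>
                   \<sigma> * phi (real (Suc n)) * (\<epsilon> + an (Suc n) \<epsilon>)}))
          \<longlongrightarrow> 2 * sqrt (1 / (pi * (a + 1))) * exp (- 2 * \<tau> * sqrt (1 + a)) * Gamma (b + 1/2))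
          (at_right (sqrt (1 + a)))
    \<and> ((\<lambda>\<epsilon>. (\<epsilon>^2 - a - 1) powr (b + 1/2) *
            (\<Sum>n. Lg (real (Suc n)) powr a * LgLg (real (Suc n)) powr b / real (Suc n) *
               measure M {\<omega> \<in> space M. \<bar>partial_sum X (Suc n) \<omega>\<bar> \<ge>
                   \<sigma> * phi (real (Suc n)) * (\<epsilon> + an (Suc n) \<epsilon>)}))
          \<longlongrightarrow> sqrt (1 / (pi * (a + 1))) * exp (- 2 * \<tau> * sqrt (1 + a)) * Gamma (b + 1/2))
          (at_right (sqrt (1 + a)))"
proof -
  interpret prob_space M by fact
  interpret precise_rates M X \<sigma> a b \<tau> an
    by unfold_locales (use assms in \<open>auto simp: wt_def mult.assoc\<close>)
  \<comment> \<open>The maximum includes k = 0, where the partial sum is 0; for n >= 1 this does not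
    change the maximum of |S_k| over 1 <= k <= n.\<close>
  have max_iff: "\<theta> \<le> max_partial_sum X n \<omega> \<longleftrightarrow> (\<exists>k\<le>n. \<theta> \<le> \<bar>partial_sum X k \<omega>\<bar>)" for \<theta> n \<omega>
    unfolding max_partial_sum_def by (subst Max_ge_iff) auto
  have s': "sqrt (1 + a) = s" by (simp add: s_def)
  \<comment> \<open>Multiplied by 4 for the maximum and by 2 for the sum, this gives the prefactors
    2 and 1 of the two limits.\<close>
  have C0': "C0 = sqrt (1 / (pi * (a + 1))) * exp (- 2 * \<tau> * s) / 2"
    by (simp add: C0_def s_def real_sqrt_mult real_sqrt_divide add.commute)
  show ?thesis
    unfolding s' max_iff wt_def[symmetric]
    using precise_rates_limit[of "\<lambda>n \<theta> f. \<exists>k\<le>n. \<theta> \<le> \<bar>f k\<bar>" 4] precise_rates_limit[of "\<lambda>n \<theta> f. \<theta> \<le> \<bar>f n\<bar>" 2]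
    by (simp add: C0' mult.assoc)
qed

end
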